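(* Let $(a,b)\subset\mathbb{R}$ be a finite interval, $m,n\in\mathbb{N}$, $\varepsilon_0>0$. For each $\varepsilon\in[0,\varepsilon_0)$ let $A(\cdot;\varepsilon)\in (W^{n-1}_\infty)^{m\times m}$ and let $B(\varepsilon)\colon (W^n_\infty)^m\to\mathbb{C}^m$ be a bounded linear operator, and consider the family of boundary-value problems $$y'(t;\varepsilon)+A(t;\varepsilon)y(t;\varepsilon)=f(t;\varepsilon),\ t\in(a,b),\qquad B(\varepsilon)y(\cdot;\varepsilon)=c(\varepsilon),$$ with $f(\cdot;\varepsilon)\in (W^{n-1}_\infty)^m$, $c(\varepsilon)\in\mathbb{C}^m$. The solution of this problem continuously depends on the parameter $\varepsilon$ at $\varepsilon=0$ (in the sense defined in the context) if and only if the following three conditions hold: (0) the homogeneous problem $y'(t)+A(t;0)y(t)=0$ for $t\in(a,b)$, $B(0)y=0$ has only the trivial solution $y=0$ in $(W^n_\infty)^m$; (I) $A(\cdot;\varepsilon)\to A(\cdot;0)$ in $(W^{n-1}_\infty)^{m\times m}$ as $\varepsilon\to0+$; (II) $B(\varepsilon)y\to B(0)y$ in $\mathbb{C}^m$ as $\varepsilon\to0+$ for every $y\in(W^n_\infty)^m$.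
   Context: For an integer $k\ge0$, $W^k_\infty=W^k_\infty([a,b];\mathbb{C})$ is the Sobolev space of complex functions on $[a,b]$ whose derivatives up to order $k$ (in the sense of absolute continuity of the lower ones) are essentially bounded, with norm $\|y\|_{k,\infty}=\sum_{j=0}^k\|y^{(j)}\|_{L_\infty}$; $W^0_\infty=L_\infty$. $(W^k_\infty)^m$ and $(W^k_\infty)^{m\times m}$ denote the spaces of vector/matrix functions with components in $W^k_\infty$, normed componentwise. A solution of the problem is a $y(\cdot;\varepsilon)\in (W^n_\infty)^m$ satisfying the differential equation almost everywhere on $(a,b)$ and the boundary condition. Definition: the solution of the problem continuously depends on $\varepsilon$ at $\varepsilon=0$ if ($\ast$) there exists $\varepsilon_1\in(0,\varepsilon_0)$ such that for every $\varepsilon\in[0,\varepsilon_1)$ and all $f(\cdot;\varepsilon)\in(W^{n-1}_\infty)^m$, $c(\varepsilon)\in\mathbb{C}^m$ the problem has a unique solution $y(\cdot;\varepsilon)\in(W^n_\infty)^m$; and ($\ast\ast$) whenever $f(\cdot;\varepsilon)\to f(\cdot;0)$ in $(W^{n-1}_\infty)^m$ and $c(\varepsilon)\to c(0)$ in $\mathbb{C}^m$ as $\varepsilon\to0+$, the corresponding solutions satisfy $y(\cdot;\varepsilon)\to y(\cdot;0)$ in $(W^n_\infty)^m$ as $\varepsilon\to0+$. *)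

theory Defs
  imports "HOL-Analysis.Analysis"
begin

definition abs_cont_on :: "real \<Rightarrow> real \<Rightarrow> (real \<Rightarrow> 'v::real_normed_vector) \<Rightarrow> bool" where
  "abs_cont_on a b g \<longleftrightarrow>
     (\<forall>e>0. \<exists>d>0. \<forall>(N::nat) (u::nat \<Rightarrow> real) v.
        (\<forall>i<N. a \<le> u i \<and> u i \<le> v i \<and> v i \<le> b) \<longrightarrow>
        (\<forall>i<N. \<forall>j<N. i \<noteq> j \<longrightarrow> v i \<le> u j \<or> v j \<le> u i) \<longrightarrow>
        (\<Sum>i<N. v i - u i) < d \<longrightarrow>
        (\<Sum>i<N. norm (g (v i) - g (u i))) < e)"

definition Linf :: "real \<Rightarrow> real \<Rightarrow> (real \<Rightarrow> complex) \<Rightarrow> bool" where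
  "Linf a b g \<longleftrightarrow> set_borel_measurable lebesgue {a..b} g \<and>
     (\<exists>C. AE t in lebesgue. t \<in> {a..b} \<longrightarrow> norm (g t) \<le> C)"

definition Linf_norm :: "real \<Rightarrow> real \<Rightarrow> (real \<Rightarrow> complex) \<Rightarrow> real" where
  "Linf_norm a b g = Inf {C. C \<ge> 0 \<and> (AE t in lebesgue. t \<in> {a..b} \<longrightarrow> norm (g t) \<le> C)}"

definition W_derivs :: "real \<Rightarrow> real \<Rightarrow> nat \<Rightarrow> (real \<Rightarrow> complex) \<Rightarrow> (nat \<Rightarrow> real \<Rightarrow> complex) \<Rightarrow> bool" where
  "W_derivs a b k y D \<longleftrightarrow>
     (\<forall>t\<in>{a..b}. D 0 t = y t) \<and>
     (\<forall>j<k. abs_cont_on a b (D j) \<and>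
        (AE t in lebesgue. t \<in> {a<..<b} \<longrightarrow> (D j has_vector_derivative D (Suc j) t) (at t))) \<and>
     Linf a b (D k)"

definition Wk :: "real \<Rightarrow> real \<Rightarrow> nat \<Rightarrow> (real \<Rightarrow> complex) \<Rightarrow> bool" where
  "Wk a b k y \<longleftrightarrow> (\<exists>D. W_derivs a b k y D)"

definition Wk_norm :: "real \<Rightarrow> real \<Rightarrow> nat \<Rightarrow> (real \<Rightarrow> complex) \<Rightarrow> real" where
  "Wk_norm a b k y = (let D = (SOME D. W_derivs a b k y D) in (\<Sum>j\<le>k. Linf_norm a b (D j)))"

definition Wvec :: "real \<Rightarrow> real \<Rightarrow> nat \<Rightarrow> (real \<Rightarrow> complex ^ 'm) \<Rightarrow> bool" where
  "Wvec a b k y \<longleftrightarrow> (\<forall>i. Wk a b k (\<lambda>t. y t $ i))"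

definition Wvec_norm :: "real \<Rightarrow> real \<Rightarrow> nat \<Rightarrow> (real \<Rightarrow> complex ^ 'm::finite) \<Rightarrow> real" where
  "Wvec_norm a b k y = (\<Sum>i\<in>UNIV. Wk_norm a b k (\<lambda>t. y t $ i))"

definition Wmat :: "real \<Rightarrow> real \<Rightarrow> nat \<Rightarrow> (real \<Rightarrow> complex ^ 'm ^ 'm) \<Rightarrow> bool" where
  "Wmat a b k M \<longleftrightarrow> (\<forall>i j. Wk a b k (\<lambda>t. M t $ i $ j))"

definition Wvec_conv :: "real \<Rightarrow> real \<Rightarrow> nat \<Rightarrow> (real \<Rightarrow> real \<Rightarrow> complex ^ 'm) \<Rightarrow> bool" where
  "Wvec_conv a b k F \<longleftrightarrow>
     (\<forall>i. ((\<lambda>\<epsilon>. Wk_norm a b k (\<lambda>t. F \<epsilon> t $ i - F 0 t $ i)) \<longlongrightarrow> 0) (at_right 0))"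

definition Wmat_conv :: "real \<Rightarrow> real \<Rightarrow> nat \<Rightarrow> (real \<Rightarrow> real \<Rightarrow> complex ^ 'm ^ 'm) \<Rightarrow> bool" where
  "Wmat_conv a b k F \<longleftrightarrow>
     (\<forall>i j. ((\<lambda>\<epsilon>. Wk_norm a b k (\<lambda>t. F \<epsilon> t $ i $ j - F 0 t $ i $ j)) \<longlongrightarrow> 0) (at_right 0))"

definition bounded_lin_op :: "real \<Rightarrow> real \<Rightarrow> nat \<Rightarrow> ((real \<Rightarrow> complex ^ 'm::finite) \<Rightarrow> complex ^ 'm) \<Rightarrow> bool" where
  "bounded_lin_op a b n L \<longleftrightarrow>
     (\<forall>y z. Wvec a b n y \<longrightarrow> Wvec a b n z \<longrightarrow> L (\<lambda>t. y t + z t) = L y + L z) \<and>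
     (\<forall>c y. Wvec a b n y \<longrightarrow> L (\<lambda>t. c *s y t) = c *s L y) \<and>
     (\<exists>C. \<forall>y. Wvec a b n y \<longrightarrow> norm (L y) \<le> C * Wvec_norm a b n y)"

definition is_solution :: "real \<Rightarrow> real \<Rightarrow> nat \<Rightarrow> (real \<Rightarrow> complex ^ 'm ^ 'm) \<Rightarrow>
    ((real \<Rightarrow> complex ^ 'm) \<Rightarrow> complex ^ 'm) \<Rightarrow> (real \<Rightarrow> complex ^ 'm) \<Rightarrow> complex ^ 'm \<Rightarrow>
    (real \<Rightarrow> complex ^ 'm::finite) \<Rightarrow> bool" where
  "is_solution a b n A L f c y \<longleftrightarrow>
     Wvec a b n y \<and>
     (AE t in lebesgue. t \<in> {a<..<b} \<longrightarrow>
        (\<exists>y'. (y has_vector_derivative y') (at t) \<and> y' + A t *v y t = f t)) \<and>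
     L y = c"

text \<open>Continuous dependence of the solution on eps at eps = 0 (conditions (*) and (**)).
  Uniqueness is up to equality on [a,b] (i.e. as elements of W^n_infinity).\<close>
definition cont_dep :: "real \<Rightarrow> real \<Rightarrow> nat \<Rightarrow> real \<Rightarrow> (real \<Rightarrow> real \<Rightarrow> complex ^ 'm ^ 'm) \<Rightarrow>
    (real \<Rightarrow> (real \<Rightarrow> complex ^ 'm) \<Rightarrow> complex ^ 'm::finite) \<Rightarrow> bool" where
  "cont_dep a b n \<epsilon>0 A B \<longleftrightarrow>
     (\<exists>\<epsilon>1\<in>{0<..<\<epsilon>0}.
        (\<forall>\<epsilon>\<in>{0..<\<epsilon>1}. \<forall>f c. Wvec a b (n - 1) f \<longrightarrow>
            (\<exists>y. is_solution a b n (A \<epsilon>) (B \<epsilon>) f c y) \<and>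
            (\<forall>y z. is_solution a b n (A \<epsilon>) (B \<epsilon>) f c y \<longrightarrow>
                   is_solution a b n (A \<epsilon>) (B \<epsilon>) f c z \<longrightarrow> (\<forall>t\<in>{a..b}. y t = z t))) \<and>
        (\<forall>F C Y. (\<forall>\<epsilon>\<in>{0..<\<epsilon>1}. Wvec a b (n - 1) (F \<epsilon>) \<and>
                     is_solution a b n (A \<epsilon>) (B \<epsilon>) (F \<epsilon>) (C \<epsilon>) (Y \<epsilon>)) \<longrightarrow>
                  Wvec_conv a b (n - 1) F \<longrightarrow> (C \<longlongrightarrow> C 0) (at_right 0) \<longrightarrow>
                  Wvec_conv a b n Y))"

end

theory Submission
  imports Defs
begin

text \<open>Write y(eps) = p(eps) + Y(eps) q(eps), with p the solution of the differential equation
  vanishing at a and Y(eps) the fundamental matrix normalised at a. The boundary condition becomes a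
  linear equation in finite dimension for q(eps), whose matrix is obtained by applying B(eps) to the
  columns of Y(eps).
  Under (0), (I) and (II) this matrix converges to an invertible one: the initial value problem depends
  continuously on A and f by a Gronwall estimate, and B(eps) is uniformly bounded near 0 by the
  Banach--Steinhaus theorem. Conversely, solutions of the homogeneous equation with suitable fixed
  boundary values form a matrix Z(eps) with Z(eps) \<rightarrow> Y(0), and
  A(eps) = - Z'(eps) Z(eps)^(-1) formally yields (I); then (II) follows by comparing a given y with the solution
  u(eps) of the boundary value problem with right-hand side y' + A(eps) y and boundary value B(0) y, as the
  initial value of y - u(eps) is an asymptotically injective linear function of B(eps) y - B(0) y.\<close>

subsection \<open>Absolutely continuous functions\<close>

text \<open>Membership in the Sobolev spaces is stated through absolute continuity and derivatives
  almost everywhere, so both halves of Lebesgue's fundamental theorem of calculus are proved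
  beforehand, with Henstock gauges and a Vitali covering. They show that W^(k+1) consists of the
  functions c + integral of z with z in W^k; most facts about these spaces are then inductions on k.

  Three obstacles shape the converse direction. No bound on the norm of \<open>A \<epsilon>\<close>
  is known while \<open>A \<epsilon> - A 0\<close> is estimated: that norm reappears on the
  right-hand side with a factor tending to 0 and is absorbed. The matrix Z(eps) is never inverted:
  only its limit is, and the inverse is assembled from solutions of the adjoint equation, which
  places it in the right Sobolev space without any discussion of determinants. Finally, convergence
  of solutions is granted only for boundary data already known to converge, so
  \<open>B \<epsilon> y\<close> cannot serve as data; the data are frozen and the discrepancy is
  read off at the point \<open>a\<close>.\<close>

lemma AE_lebesgue_iff_negligible:
  "(AE x in lebesgue. P x) \<longleftrightarrow> negligible {x. \<not> P x}"
  by (simp add: completion.AE_iff_null_sets negligible_iff_null_sets)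

lemma negligible_subset_open_small:
  fixes S :: "'a::euclidean_space set"
  assumes "negligible S" "e > 0"
  obtains U where "open U" "S \<subseteq> U" "U \<in> lmeasurable" "measure lebesgue U < e"
proof -
  have S: "S \<in> lmeasurable" "measure lebesgue S = 0" "S \<in> sets lebesgue"
    using assms by (simp_all add: negligible_imp_measurable negligible_imp_measure0 negligible_imp_sets)
  obtain U where U: "open U" "S \<subseteq> U" "U - S \<in> lmeasurable" "emeasure lebesgue (U - S) < ennreal e"
    using sets_lebesgue_outer_open[OF S(3) assms(2)] by blast
  have eq: "U = S \<union> (U - S)" using U(2) by blast
  have "U \<in> lmeasurable" by (subst eq) (intro fmeasurable.Un S U)
  moreover have "measure lebesgue U \<le> measure lebesgue S + measure lebesgue (U - S)"
    by (subst eq) (rule measure_Un_le, use S U in \<open>auto simp: fmeasurableD\<close>)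
  moreover have "measure lebesgue (U - S) < e"
    using U(4) assms(2) emeasure_eq_measure2[OF U(3)] by (simp add: ennreal_less_iff)
  ultimately show ?thesis using that U S by auto
qed

text \<open>Absolute continuity is defined with indexed families of ordered intervals, whereas gauge
  integration works with tagged divisions. An enumeration of the division translates the one into
  the other.\<close>

lemma abs_cont_on_tagged_sum_small:
  fixes g :: "real \<Rightarrow> 'v::real_normed_vector"
  assumes ac: "abs_cont_on a b g" and e: "e > 0"
  obtains d where "d > 0"
    "\<And>p. \<lbrakk>p tagged_partial_division_of {a..b}; (\<Sum>(x,K)\<in>p. measure lborel K) < d\<rbrakk>
       \<Longrightarrow> (\<Sum>(x,K)\<in>p. norm (g (Sup K) - g (Inf K))) < e"
proof -
  obtain d where d: "d > 0" and D: "\<And>(N::nat) (u::nat \<Rightarrow> real) v.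
        (\<forall>i<N. a \<le> u i \<and> u i \<le> v i \<and> v i \<le> b) \<Longrightarrow>
        (\<forall>i<N. \<forall>j<N. i \<noteq> j \<longrightarrow> v i \<le> u j \<or> v j \<le> u i) \<Longrightarrow>
        (\<Sum>i<N. v i - u i) < d \<Longrightarrow>
        (\<Sum>i<N. norm (g (v i) - g (u i))) < e"
    using ac e unfolding abs_cont_on_def by blast
  show ?thesis
  proof (rule that[OF d])
    fix p assume p: "p tagged_partial_division_of {a..b}" and small: "(\<Sum>(x,K)\<in>p. measure lborel K) < d"
    note pD = tagged_partial_division_ofD[OF p]
    have K: "\<exists>u v. K = {u..v} \<and> u \<le> v \<and> a \<le> u \<and> v \<le> b" if xK: "(x,K) \<in> p" for x K
    proof -
      obtain u v where uv: "K = cbox u v" using pD(4)[OF xK] by blast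
      then show ?thesis using pD(2,3)[OF xK] by (intro exI[of _ u] exI[of _ v]) auto
    qed
    \<comment> \<open>A degenerate interval has empty interior and may therefore lie inside another
      member of the division, which violates the ordering clause of \<open>abs_cont_on\<close>. Such
      intervals contribute 0 to both sums and are dropped before enumerating.\<close>
    define q where "q = {(x,K) \<in> p. measure lborel K \<noteq> 0}"
    have qp: "q \<subseteq> p" by (auto simp: q_def)
    have fin: "finite q" using pD(1) qp finite_subset by blast
    obtain h where h: "bij_betw h {..<card q} q"
      using ex_bij_betw_nat_finite[OF fin] by (auto simp: atLeast0LessThan)
    define u v where "u = (\<lambda>i. Inf (snd (h i)))" and "v = (\<lambda>i. Sup (snd (h i)))"
    have hq: "h i \<in> q" if "i < card q" for i using h that by (auto simp: bij_betw_def)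
    have uv: "snd (h i) = {u i..v i} \<and> u i < v i \<and> a \<le> u i \<and> v i \<le> b" if "i < card q" for i
    proof -
      obtain x K where xK: "h i = (x,K)" by fastforce
      then have "(x,K) \<in> p" "measure lborel K \<noteq> 0" using hq[OF that] by (auto simp: q_def)
      then obtain u' v' where "K = {u'..v'}" "u' \<le> v'" "a \<le> u'" "v' \<le> b" "measure lborel {u'..v'} \<noteq> 0"
        using K by blast
      then show ?thesis using xK by (auto simp: u_def v_def)
    qed
    have 1: "\<forall>i<card q. a \<le> u i \<and> u i \<le> v i \<and> v i \<le> b"
      using uv by force
    have 2: "\<forall>i<card q. \<forall>j<card q. i \<noteq> j \<longrightarrow> v i \<le> u j \<or> v j \<le> u i"
    proof (intro allI impI)
      fix i j assume ij: "i < card q" "j < card q" "i \<noteq> j"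
      have "h i \<noteq> h j" using h ij by (auto simp: bij_betw_def inj_on_def)
      then have "interior (snd (h i)) \<inter> interior (snd (h j)) = {}"
        using pD(5)[of "fst (h i)" "snd (h i)" "fst (h j)" "snd (h j)"] hq ij qp by auto
      then have e: "{u i<..<v i} \<inter> {u j<..<v j} = {}"
        using uv[OF ij(1)] uv[OF ij(2)] by (metis interior_atLeastAtMost_real)
      show "v i \<le> u j \<or> v j \<le> u i"
      proof (rule ccontr)
        assume "\<not> ?thesis"
        then have "max (u i) (u j) < min (v i) (v j)"
          using uv[OF ij(1)] uv[OF ij(2)] by auto
        then obtain z where "max (u i) (u j) < z" "z < min (v i) (v j)" using dense by blast
        then have "z \<in> {u i<..<v i} \<inter> {u j<..<v j}" by auto
        then show False using e by blast
      qed
    qed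
    have re: "(\<Sum>i<card q. F (h i)) = (\<Sum>z\<in>q. F z)" for F :: "_ \<Rightarrow> real"
      by (rule sum.reindex_bij_betw[OF h])
    have "(\<Sum>i<card q. v i - u i) = (\<Sum>i<card q. measure lborel (snd (h i)))"
      by (rule sum.cong) (use uv in force)+
    also have "\<dots> = (\<Sum>z\<in>q. measure lborel (snd z))" by (rule re)
    also have "\<dots> = (\<Sum>z\<in>p. measure lborel (snd z))"
      by (rule sum.mono_neutral_left[OF pD(1) qp]) (auto simp: q_def)
    finally have 3: "(\<Sum>i<card q. v i - u i) < d" using small by (simp add: case_prod_unfold)
    have "(\<Sum>(x,K)\<in>p. norm (g (Sup K) - g (Inf K))) = (\<Sum>z\<in>p. norm (g (Sup (snd z)) - g (Inf (snd z))))"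
      by (simp add: case_prod_unfold)
    also have "\<dots> = (\<Sum>z\<in>q. norm (g (Sup (snd z)) - g (Inf (snd z))))"
    proof (rule sum.mono_neutral_right[OF pD(1) qp], safe)
      fix x L assume "(x,L) \<in> p" "(x,L) \<notin> q"
      moreover from this obtain u v where "L = {u..v}" "u \<le> v" using K by blast
      ultimately have "L = {u..u}" by (auto simp: q_def content_eq_0)
      then show "norm (g (Sup (snd (x,L))) - g (Inf (snd (x,L)))) = 0" by simp
    qed
    also have "\<dots> = (\<Sum>i<card q. norm (g (v i) - g (u i)))"
      unfolding u_def v_def by (rule re[symmetric])
    also have "\<dots> < e" by (rule D[OF 1 2 3])
    finally show "(\<Sum>(x,K)\<in>p. norm (g (Sup K) - g (Inf K))) < e" .
  qed
qed

text \<open>The tags in the exceptional null set are controlled by absolute continuity, all the others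
  by differentiability.\<close>

theorem has_integral_deriv_abs_cont:
  fixes g :: "real \<Rightarrow> 'v::banach"
  assumes ab: "a \<le> b" and ac: "abs_cont_on a b g"
    and der: "AE t in lebesgue. t \<in> {a<..<b} \<longrightarrow> (g has_vector_derivative h t) (at t)"
  shows "(h has_integral (g b - g a)) {a..b}"
proof -
  \<comment> \<open>The endpoints join the exceptional set because the derivative is only given
    inside the interval.\<close>
  define N where "N = {t. \<not> (t \<in> {a<..<b} \<longrightarrow> (g has_vector_derivative h t) (at t))} \<union> {a,b}"
  have N: "negligible N"
    using der unfolding AE_lebesgue_iff_negligible N_def by (intro negligible_Un) auto
  define h' where "h' = (\<lambda>t. if t \<in> N then 0 else h t)"
  have "(h' has_integral (g b - g a)) {a..b}"
    unfolding has_integral_real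
  proof (intro allI impI)
    fix e :: real assume e: "e > 0"
    \<comment> \<open>Half of \<open>e\<close> is reserved for the exceptional tags, the other half
      is spread over the length of the interval. The summand 1 keeps the quotient meaningful for
      \<open>a = b\<close>.\<close>
    define \<eta> where "\<eta> = e / (2 * (b - a + 1))"
    have \<eta>: "\<eta> > 0" using e ab by (simp add: \<eta>_def)
    have \<eta>e: "\<eta> * (b - a) < e / 2" using e ab by (simp add: \<eta>_def field_simps)
    obtain d where d: "d > 0" and D: "\<And>p. \<lbrakk>p tagged_partial_division_of {a..b}; (\<Sum>(x,K)\<in>p. measure lborel K) < d\<rbrakk>
       \<Longrightarrow> (\<Sum>(x,K)\<in>p. norm (g (Sup K) - g (Inf K))) < e/2"
      using abs_cont_on_tagged_sum_small[OF ac, of "e/2"] e by auto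
    obtain U where U: "open U" "N \<subseteq> U" "U \<in> lmeasurable" "measure lebesgue U < d"
      using negligible_subset_open_small[OF N d] by blast
    have "\<exists>\<delta>>0. \<forall>y. \<bar>y - x\<bar> < \<delta> \<longrightarrow> norm (g y - g x - (y - x) *\<^sub>R h x) \<le> \<eta> * \<bar>y - x\<bar>"
      if "x \<in> {a..b} - N" for x
    proof -
      have "(g has_vector_derivative h x) (at x)" using that by (auto simp: N_def)
      then show ?thesis
        using \<eta> unfolding has_vector_derivative_def has_derivative_at_alt by auto
    qed
    then obtain \<delta> where \<delta>: "\<And>x. x \<in> {a..b} - N \<Longrightarrow> \<delta> x > 0"
      "\<And>x y. x \<in> {a..b} - N \<Longrightarrow> \<bar>y - x\<bar> < \<delta> x \<Longrightarrow> norm (g y - g x - (y - x) *\<^sub>R h x) \<le> \<eta> * \<bar>y - x\<bar>"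
      by metis
    \<comment> \<open>Intervals tagged in \<open>N\<close> stay inside \<open>U\<close>, so their
      total length is below \<open>d\<close>; at the other tags of \<open>{a..b}\<close> the ball
      enforces the linear approximation.\<close>
    define \<gamma> where "\<gamma> = (\<lambda>x. if x \<in> N then U else if x \<in> {a..b} then ball x (\<delta> x) else ball x 1)"
    have g: "gauge \<gamma>" unfolding gauge_def
    proof safe
      fix x show "x \<in> \<gamma> x" using U \<delta>(1)[of x] by (auto simp: \<gamma>_def)
      show "open (\<gamma> x)" using U by (auto simp: \<gamma>_def)
    qed
    have main: "norm ((\<Sum>(x,K)\<in>p. measure lborel K *\<^sub>R h' x) - (g b - g a)) < e"
      if p: "p tagged_division_of {a..b}" and fine: "\<gamma> fine p" for p
    proof -
      have pp: "p tagged_partial_division_of {a..b}" using p by (auto simp: tagged_division_of_def)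
      note pD = tagged_partial_division_ofD[OF pp]
      let ?T = "\<lambda>z. measure lborel (snd z) *\<^sub>R h' (fst z) - (g (Sup (snd z)) - g (Inf (snd z)))"
      define q where "q = {z \<in> p. fst z \<in> N}"
      have qp: "q \<subseteq> p" by (auto simp: q_def)
      have tq: "q tagged_partial_division_of {a..b}" by (rule tagged_partial_division_subset[OF pp qp])
      have K: "\<exists>u v. K = {u..v} \<and> u \<le> x \<and> x \<le> v \<and> a \<le> u \<and> v \<le> b" if xK: "(x,K) \<in> p" for x K
      proof -
        obtain u v where uv: "K = cbox u v" using pD(4)[OF xK] by blast
        then show ?thesis using pD(2,3)[OF xK] by (intro exI[of _ u] exI[of _ v]) auto
      qed
      \<comment> \<open>Two tags can share an interval only if its content is 0, so the sum over
        tagged pairs is a sum over the underlying intervals.\<close>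
      have content0: "(\<Sum>(x,K)\<in>s. measure lborel K) = sum (measure lborel) (snd ` s)" if "s tagged_partial_division_of {a..b}" for s
        by (rule sum.over_tagged_division_lemma[OF tagged_partial_division_of_Union_self[OF that]])
           (simp add: content_eq_0_interior)
      have "(\<Sum>(x,K)\<in>q. measure lborel K) = sum (measure lborel) (snd ` q)" by (rule content0[OF tq])
      also have "\<dots> = sum (measure lebesgue) (snd ` q)"
        by (rule sum.cong) (use K qp in \<open>force\<close>)+
      also have "\<dots> = measure lebesgue (\<Union>(snd ` q))"
        by (rule content_division[OF division_of_tagged_division[OF tagged_partial_division_of_Union_self[OF tq]]])
      also have "\<dots> \<le> measure lebesgue U"
      proof (rule measure_mono_fmeasurable)
        show "\<Union>(snd ` q) \<subseteq> U" using fine by (force simp: fine_def q_def \<gamma>_def)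
        show "\<Union>(snd ` q) \<in> sets lebesgue"
          using qp K finite_subset[OF qp pD(1)] by (intro sets.finite_Union) (force+)
      qed (rule U)
      finally have "(\<Sum>(x,K)\<in>q. measure lborel K) < d" using U by simp
      from D[OF tq this] have q: "(\<Sum>z\<in>q. norm (g (Sup (snd z)) - g (Inf (snd z)))) < e/2"
        by (simp add: case_prod_unfold)
      \<comment> \<open>Since \<open>h'\<close> vanishes at exceptional tags, only the increment of
        \<open>g\<close> is left there, and absolute continuity bounds the sum of these.\<close>
      have T1: "norm (?T z) = norm (g (Sup (snd z)) - g (Inf (snd z)))" if "z \<in> q" for z
        using that by (simp add: q_def h'_def norm_minus_commute)
      have T2: "norm (?T z) \<le> \<eta> * measure lborel (snd z)" if z: "z \<in> p - q" for z
      proof -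
        obtain x L where xL: "z = (x,L)" by fastforce
        then have xp: "(x,L) \<in> p" and xN: "x \<notin> N" using z by (auto simp: q_def)
        obtain u v where uv: "L = {u..v}" "u \<le> x" "x \<le> v" "a \<le> u" "v \<le> b" using K[OF xp] by blast
        have xab: "x \<in> {a..b} - N" using uv xN by auto
        have "L \<subseteq> \<gamma> x" using fineD[OF fine xp] .
        then have "L \<subseteq> ball x (\<delta> x)" using xab by (simp add: \<gamma>_def)
        moreover have "u \<in> L" "v \<in> L" using uv by auto
        ultimately have "\<bar>u - x\<bar> < \<delta> x" "\<bar>v - x\<bar> < \<delta> x" by (auto simp: dist_real_def)
        from \<delta>(2)[OF xab this(1)] \<delta>(2)[OF xab this(2)]
        have *: "norm (g u - g x - (u - x) *\<^sub>R h x) \<le> \<eta> * (x - u)"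
          "norm (g v - g x - (v - x) *\<^sub>R h x) \<le> \<eta> * (v - x)" using uv by auto
        \<comment> \<open>The increment is split at the tag, so that the linear approximation is
          used from \<open>x\<close> to each endpoint.\<close>
        have eq: "?T z = (g u - g x - (u - x) *\<^sub>R h x) - (g v - g x - (v - x) *\<^sub>R h x)"
          using xL uv xN by (simp add: h'_def scaleR_left_diff_distrib)
        have "norm (?T z) \<le> norm (g u - g x - (u - x) *\<^sub>R h x) + norm (g v - g x - (v - x) *\<^sub>R h x)"
          unfolding eq by (rule norm_triangle_ineq4)
        also have "\<dots> \<le> \<eta> * (x - u) + \<eta> * (v - x)" by (rule add_mono[OF *])
        also have "\<dots> = \<eta> * measure lborel (snd z)" using xL uv by (simp add: algebra_simps)
        finally show ?thesis .
      qed
      have "(\<Sum>(x,K)\<in>p. measure lborel K *\<^sub>R h' x) - (g b - g a) = (\<Sum>z\<in>p. ?T z)"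
        using additive_tagged_division_1[OF ab p, of g]
        by (simp add: sum_subtractf case_prod_unfold)
      also have "norm \<dots> \<le> (\<Sum>z\<in>p. norm (?T z))" by (rule norm_sum)
      also have "\<dots> = (\<Sum>z\<in>p - q. norm (?T z)) + (\<Sum>z\<in>q. norm (?T z))"
        by (rule sum.subset_diff[OF qp pD(1)])
      also have "(\<Sum>z\<in>q. norm (?T z)) = (\<Sum>z\<in>q. norm (g (Sup (snd z)) - g (Inf (snd z))))"
        by (rule sum.cong[OF refl T1])
      also have "(\<Sum>z\<in>p - q. norm (?T z)) \<le> (\<Sum>z\<in>p-q. \<eta> * measure lborel (snd z))"
        by (rule sum_mono[OF T2])
      also have "\<dots> \<le> (\<Sum>z\<in>p. \<eta> * measure lborel (snd z))"
        by (rule sum_mono2[OF pD(1)]) (use \<eta> in auto)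
      also have "\<dots> = \<eta> * (\<Sum>(x,K)\<in>p. measure lborel K)" by (simp add: sum_distrib_left case_prod_unfold)
      also have "\<dots> = \<eta> * (b - a)"
        using additive_content_tagged_division[of p a b] p ab by (simp add: box_real)
      finally show ?thesis using q \<eta>e by linarith
    qed
    show "\<exists>\<gamma>. gauge \<gamma> \<and> (\<forall>\<D>. \<D> tagged_division_of {a..b} \<and> \<gamma> fine \<D> \<longrightarrow>
       norm ((\<Sum>(x,k)\<in>\<D>. measure lborel k *\<^sub>R h' x) - (g b - g a)) < e)"
      using g main by (intro exI[of _ \<gamma>]) simp
  qed
  then show ?thesis
    by (rule has_integral_spike[OF N, rotated]) (simp add: h'_def)
qed


text \<open>A tag at which the difference quotient stays away from the integrand is covered by arbitrarily
  short intervals that are fine for a Henstock gauge; disjoint families of those are short in total.\<close>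

lemma negligible_bad_difference_quotient:
  fixes h :: "real \<Rightarrow> 'v::euclidean_space"
  assumes int: "h integrable_on {a..b}" and \<eta>: "\<eta> > 0"
  shows "negligible {x. \<forall>d>0. \<exists>u v. u < v \<and> a \<le> u \<and> v \<le> b \<and> v - u < d \<and> (x = u \<or> x = v) \<and>
           norm ((v - u) *\<^sub>R h x - integral {u..v} h) > \<eta> * (v - u)}" (is "negligible ?E")
  unfolding negligible_outer_le
proof (intro allI impI)
  fix e :: real assume e: "e > 0"
  \<comment> \<open>Each bad interval has an error above \<open>\<eta>\<close> times its length.
    Asking for a total error of \<open>e * \<eta>\<close> thus bounds the total length by
    \<open>e\<close>.\<close>
  obtain \<gamma> where g: "gauge \<gamma>" and H: "\<And>p. \<lbrakk>p tagged_partial_division_of (cbox a b); \<gamma> fine p\<rbrakk> \<Longrightarrow>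
             (\<Sum>(x,k)\<in>p. norm (measure lborel k *\<^sub>R h x - integral k h)) < e * \<eta>"
    using Henstock_lemma[of h a b "e * \<eta>"] int e \<eta> by (auto simp: box_real)
  define K where "K = {(x,u,v). u < v \<and> a \<le> u \<and> v \<le> b \<and> (x = u \<or> x = v) \<and> {u..v} \<subseteq> \<gamma> x \<and>
           norm ((v - u) *\<^sub>R h x - integral {u..v} h) > \<eta> * (v - u)}"
  \<comment> \<open>Midpoint and radius put the intervals into the form of balls that the covering
    theorem expects.\<close>
  define c r where "c = (\<lambda>(x::real,u::real,v::real). (u + v) / 2)" and "r = (\<lambda>(x::real,u::real,v::real). (v - u) / 2)"
  have cb: "cball (c (x,u,v)) (r (x,u,v)) = {u..v}" for x u v
    by (simp add: c_def r_def cball_eq_atLeastAtMost field_simps)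
  have r0: "\<And>i. i \<in> K \<Longrightarrow> 0 < r i" by (auto simp: K_def r_def)
  have cover: "\<exists>i. i \<in> K \<and> x \<in> cball (c i) (r i) \<and> r i < d" if x: "x \<in> ?E" and d: "d > 0" for x d
  proof -
    obtain d' where d': "d' > 0" "ball x d' \<subseteq> \<gamma> x"
      using g by (meson gauge_def openE)
    obtain u v where uv: "u < v" "a \<le> u" "v \<le> b" "v - u < min d d'" "x = u \<or> x = v"
        "norm ((v - u) *\<^sub>R h x - integral {u..v} h) > \<eta> * (v - u)"
      using x[unfolded mem_Collect_eq, rule_format, of "min d d'"] d d'(1) by auto
    have "{u..v} \<subseteq> ball x d'" using uv by (auto simp: dist_real_def)
    then have "(x,u,v) \<in> K" using uv d' by (auto simp: K_def)
    moreover have "x \<in> {u..v}" using uv by auto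
    moreover have "r (x,u,v) < d" using uv by (simp add: r_def)
    ultimately show ?thesis by (intro exI[of _ "(x,u,v)"]) (simp only: cb simp_thms)
  qed
  \<comment> \<open>The disjoint subfamily covers the bad set up to a null set, and disjointness
    turns its finite parts into tagged partial divisions.\<close>
  obtain C where C: "countable C" "C \<subseteq> K"
     "pairwise (\<lambda>i j. disjnt (cball (c i) (r i)) (cball (c j) (r j))) C"
     "negligible (?E - (\<Union>i\<in>C. cball (c i) (r i)))"
    by (rule Vitali_covering_theorem_cballs[of K r ?E c, OF r0 cover])
  have bound: "measure lebesgue (\<Union>((\<lambda>i. cball (c i) (r i)) ` I)) \<le> e" if I: "I \<subseteq> C" "finite I" for I
  proof -
    define \<tau> where "\<tau> = (\<lambda>i. (fst i, cball (c i) (r i)))"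
    have IK: "i \<in> K" if "i \<in> I" for i using that I C by auto
    have Kc: "\<exists>x u v. i = (x,u,v) \<and> cball (c i) (r i) = {u..v} \<and> u < v \<and> a \<le> u \<and> v \<le> b \<and> (x = u \<or> x = v)
        \<and> {u..v} \<subseteq> \<gamma> x \<and> norm ((v - u) *\<^sub>R h x - integral {u..v} h) > \<eta> * (v - u)" if "i \<in> I" for i
    proof -
      obtain x u v where i: "i = (x,u,v)" by (cases i)
      have "u < v \<and> a \<le> u \<and> v \<le> b \<and> (x = u \<or> x = v) \<and> {u..v} \<subseteq> \<gamma> x
          \<and> norm ((v - u) *\<^sub>R h x - integral {u..v} h) > \<eta> * (v - u)"
        using IK[OF that] unfolding i K_def mem_Collect_eq prod.case .
      then show ?thesis using cb[of x u v] unfolding i by (intro exI[of _ x] exI[of _ u] exI[of _ v]) simp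
    qed
    have dis: "cball (c i) (r i) \<inter> cball (c j) (r j) = {}" if "i \<in> I" "j \<in> I" "i \<noteq> j" for i j
      using C(3) that I by (auto simp: pairwise_def disjnt_def)
    have inj: "inj_on \<tau> I"
    proof (rule inj_onI, rule ccontr)
      fix i j assume ij: "i \<in> I" "j \<in> I" "\<tau> i = \<tau> j" "i \<noteq> j"
      then have "cball (c i) (r i) = {}" using dis[OF ij(1,2,4)] by (auto simp: \<tau>_def)
      then show False using Kc[OF ij(1)] by auto
    qed
    have tag: "\<tau> ` I tagged_partial_division_of (cbox a b)"
      unfolding tagged_partial_division_of_def
    proof (intro conjI allI impI)
      show "finite (\<tau> ` I)" using I by auto
    next
      fix x k assume "(x,k) \<in> \<tau> ` I"
      then obtain i where i: "i \<in> I" "x = fst i" "k = cball (c i) (r i)" by (auto simp: \<tau>_def)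
      obtain y u v where i': "i = (y,u,v)" "cball (c i) (r i) = {u..v}" "u < v" "a \<le> u" "v \<le> b" "y = u \<or> y = v"
        using Kc[OF i(1)] by blast
      show "x \<in> k" "k \<subseteq> cbox a b" using i i' by auto
      show "\<exists>a b. k = cbox a b" using i i' by (metis box_real(2))
    next
      fix x1 k1 x2 k2 assume a: "(x1,k1) \<in> \<tau> ` I \<and> (x2,k2) \<in> \<tau> ` I \<and> (x1,k1) \<noteq> (x2,k2)"
      then obtain i j where "i \<in> I" "j \<in> I" "(x1,k1) = \<tau> i" "(x2,k2) = \<tau> j" by blast
      then have "k1 \<inter> k2 = {}" using dis[of i j] a by (auto simp: \<tau>_def)
      then show "interior k1 \<inter> interior k2 = {}" using interior_subset by blast
    qed
    have fine: "\<gamma> fine (\<tau> ` I)"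
      unfolding fine_def \<tau>_def using Kc by fastforce
    have "measure lebesgue (\<Union>((\<lambda>i. cball (c i) (r i)) ` I)) \<le> (\<Sum>i\<in>I. measure lebesgue (cball (c i) (r i)))"
      by (rule measure_UNION_le) (use I in auto)
    also have "\<dots> = (1 / \<eta>) * (\<Sum>i\<in>I. \<eta> * measure lborel (cball (c i) (r i)))"
      using \<eta> by (simp add: sum_distrib_left)
    also have "\<dots> \<le> (1 / \<eta>) * (\<Sum>i\<in>I. norm (measure lborel (cball (c i) (r i)) *\<^sub>R h (fst i) - integral (cball (c i) (r i)) h))"
    proof (intro mult_left_mono sum_mono)
      fix i assume "i \<in> I"
      then obtain x u v where i': "i = (x,u,v)" "cball (c i) (r i) = {u..v}" "u < v"
        "norm ((v - u) *\<^sub>R h x - integral {u..v} h) > \<eta> * (v - u)" using Kc by blast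
      show "\<eta> * measure lborel (cball (c i) (r i)) \<le> norm (measure lborel (cball (c i) (r i)) *\<^sub>R h (fst i) - integral (cball (c i) (r i)) h)"
        unfolding i'(2) using i'(1,3,4) by simp
    qed (use \<eta> in auto)
    also have "(\<Sum>i\<in>I. norm (measure lborel (cball (c i) (r i)) *\<^sub>R h (fst i) - integral (cball (c i) (r i)) h))
        = (\<Sum>(x,k)\<in>\<tau> ` I. norm (measure lborel k *\<^sub>R h x - integral k h))"
      by (subst sum.reindex[OF inj]) (simp add: \<tau>_def)
    also have "(1 / \<eta>) * \<dots> \<le> (1 / \<eta>) * (e * \<eta>)"
      using H[OF tag fine] \<eta> by (intro mult_left_mono) auto
    finally show ?thesis using \<eta> by simp
  qed
  \<comment> \<open>The bound is uniform over finite subfamilies and hence passes to the countable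
    union.\<close>
  let ?U = "\<Union>((\<lambda>i. cball (c i) (r i)) ` C)"
  have U: "?U \<in> lmeasurable" "measure lebesgue ?U \<le> e"
    using fmeasurable_UN_bound[OF C(1) _ bound] measure_UN_bound[OF C(1) _ bound] by auto
  let ?T = "(?E - ?U) \<union> ?U"
  have N: "?E - ?U \<in> lmeasurable" "measure lebesgue (?E - ?U) = 0"
    using C(4) by (auto simp: negligible_imp_measurable negligible_imp_measure0)
  have "measure lebesgue ?T \<le> measure lebesgue (?E - ?U) + measure lebesgue ?U"
    by (rule measure_Un_le) (use N U in \<open>auto simp: fmeasurableD\<close>)
  then have "measure lebesgue ?T \<le> e" using N U by simp
  moreover have "?T \<in> lmeasurable" by (rule fmeasurable.Un[OF N(1) U(1)])
  ultimately show "\<exists>T. ?E \<subseteq> T \<and> T \<in> lmeasurable \<and> measure lebesgue T \<le> e"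
    by (intro exI[of _ ?T] conjI) (simp_all only: Un_Diff_cancel2 Un_upper1)
qed

text \<open>Lebesgue's differentiation theorem for the gauge integral. The bad sets for the
  tolerances 1/(n+1) have a null union; off it, intervals with \<open>t\<close> as an endpoint
  control the difference quotients from both sides.\<close>

theorem integral_has_vector_derivative_AE:
  fixes h :: "real \<Rightarrow> 'v::euclidean_space"
  assumes int: "h integrable_on {a..b}"
  shows "AE t in lebesgue. t \<in> {a<..<b} \<longrightarrow>
           ((\<lambda>u. integral {a..u} h) has_vector_derivative h t) (at t)"
proof -
  define E where "E = (\<lambda>n::nat. {x. \<forall>d>0. \<exists>u v. u < v \<and> a \<le> u \<and> v \<le> b \<and> v - u < d \<and> (x = u \<or> x = v) \<and>
           norm ((v - u) *\<^sub>R h x - integral {u..v} h) > (1 / real (Suc n)) * (v - u)})"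
  have "negligible (\<Union>n. E n)"
  proof (rule negligible_Union_nat)
    show "negligible (E n)" for n
      unfolding E_def by (rule negligible_bad_difference_quotient[OF int]) simp
  qed
  moreover have "((\<lambda>u. integral {a..u} h) has_vector_derivative h t) (at t)"
    if t: "t \<in> {a<..<b}" and tE: "t \<notin> (\<Union>n. E n)" for t
    unfolding has_vector_derivative_def has_derivative_at_alt
  proof (intro conjI allI impI)
    show "bounded_linear (\<lambda>x. x *\<^sub>R h t)" by (rule bounded_linear_scaleR_left)
    fix e :: real assume e: "e > 0"
    obtain n :: nat where n: "1 / real (Suc n) < e" using e nat_approx_posE by blast
    obtain d where d: "d > 0" and D: "\<And>u v. u < v \<Longrightarrow> a \<le> u \<Longrightarrow> v \<le> b \<Longrightarrow> v - u < d \<Longrightarrow> (t = u \<or> t = v) \<Longrightarrow>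
           norm ((v - u) *\<^sub>R h t - integral {u..v} h) \<le> (1 / real (Suc n)) * (v - u)"
    proof -
      define P where "P = (\<lambda>d. \<exists>u v. u < v \<and> a \<le> u \<and> v \<le> b \<and> v - u < d \<and> (t = u \<or> t = v) \<and>
           norm ((v - u) *\<^sub>R h t - integral {u..v} h) > (1 / real (Suc n)) * (v - u))"
      have "t \<notin> E n" using tE by blast
      then have "\<not> (\<forall>d>0. P d)" unfolding E_def P_def mem_Collect_eq .
      then obtain d where d: "d > 0" and nd: "\<not> P d" by blast
      show ?thesis
      proof (rule that[OF d], rule leI, rule notI)
        fix u v assume "u < v" "a \<le> u" "v \<le> b" "v - u < d" "t = u \<or> t = v"
          "(1 / real (Suc n)) * (v - u) < norm ((v - u) *\<^sub>R h t - integral {u..v} h)"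
        then have "P d" unfolding P_def by (intro exI[of _ u] exI[of _ v] conjI)
        with nd show False ..
      qed
    qed
    have D': "norm ((v - u) *\<^sub>R h t - integral {u..v} h) \<le> e * (v - u)"
      if uv: "u < v" "a \<le> u" "v \<le> b" "v - u < d" "t = u \<or> t = v" for u v
    proof -
      have "(1 / real (Suc n)) * (v - u) \<le> e * (v - u)"
        using uv n by (intro mult_right_mono) simp_all
      then show ?thesis by (rule order_trans[OF D[OF uv]])
    qed
    have ac: "integral {a..u} h + integral {u..v} h = integral {a..v} h" if uv: "a \<le> u" "u \<le> v" "v \<le> b" for u v
    proof (rule Henstock_Kurzweil_Integration.integral_combine[OF uv(1,2)])
      show "h integrable_on {a..v}"
        by (rule integrable_on_subinterval[OF int]) (use uv in simp)
    qed
    show "\<exists>d>0. \<forall>y. norm (y - t) < d \<longrightarrow>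
       norm (integral {a..y} h - integral {a..t} h - (y - t) *\<^sub>R h t) \<le> e * norm (y - t)"
    proof (intro exI[of _ "min d (min (t - a) (b - t))"] conjI allI impI)
      show "0 < min d (min (t - a) (b - t))" using d t by auto
      fix y assume y: "norm (y - t) < min d (min (t - a) (b - t))"
      consider "y = t" | "y < t" | "y > t" by linarith
      then show "norm (integral {a..y} h - integral {a..t} h - (y - t) *\<^sub>R h t) \<le> e * norm (y - t)"
      proof cases
        case 2
        then have "integral {a..y} h - integral {a..t} h - (y - t) *\<^sub>R h t = (t - y) *\<^sub>R h t - integral {y..t} h"
          using ac[of y t] y t by (simp add: algebra_simps)
        then show ?thesis using D'[of y t] 2 y t by auto
      next
        case 3
        then have "integral {a..y} h - integral {a..t} h - (y - t) *\<^sub>R h t = - ((y - t) *\<^sub>R h t - integral {t..y} h)"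
          using ac[of t y] y t by (simp add: algebra_simps)
        then show ?thesis using D'[of t y] 3 y t by (simp only: norm_minus_cancel) auto
      qed simp
    qed
  qed
  ultimately show ?thesis
    unfolding AE_lebesgue_iff_negligible by (elim negligible_subset) auto
qed

section \<open>Criteria for absolute continuity and passage from almost everywhere to
  everywhere\<close>

lemma abs_cont_on_lipschitz:
  fixes g :: "real \<Rightarrow> 'v::real_normed_vector"
  assumes lip: "\<And>u v. a \<le> u \<Longrightarrow> u \<le> v \<Longrightarrow> v \<le> b \<Longrightarrow> norm (g v - g u) \<le> M * (v - u)"
  shows "abs_cont_on a b g"
  unfolding abs_cont_on_def
proof (intro allI impI)
  fix e :: real assume e: "e > 0"
  \<comment> \<open>A positive constant in place of \<open>M\<close> allows the division
    \<open>e / M'\<close>.\<close>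
  define M' where "M' = \<bar>M\<bar> + 1"
  have M': "M' > 0" "M \<le> M'" by (auto simp: M'_def)
  show "\<exists>d>0. \<forall>(N::nat) u v. (\<forall>i<N. a \<le> u i \<and> u i \<le> v i \<and> v i \<le> b) \<longrightarrow>
        (\<forall>i<N. \<forall>j<N. i \<noteq> j \<longrightarrow> v i \<le> u j \<or> v j \<le> u i) \<longrightarrow>
        (\<Sum>i<N. v i - u i) < d \<longrightarrow> (\<Sum>i<N. norm (g (v i) - g (u i))) < e"
  proof (intro exI[of _ "e / M'"] conjI allI impI)
    show "e / M' > 0" using e M' by simp
    fix N :: nat and u v assume *: "\<forall>i<N. a \<le> u i \<and> u i \<le> v i \<and> v i \<le> b"
      and small: "(\<Sum>i<N. v i - u i) < e / M'"
    have "(\<Sum>i<N. norm (g (v i) - g (u i))) \<le> (\<Sum>i<N. M' * (v i - u i))"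
    proof (rule sum_mono)
      fix i assume "i \<in> {..<N}"
      then have "norm (g (v i) - g (u i)) \<le> M * (v i - u i)" "u i \<le> v i" using * lip by auto
      moreover have "M * (v i - u i) \<le> M' * (v i - u i)"
        using M' \<open>u i \<le> v i\<close> by (intro mult_right_mono) auto
      ultimately show "norm (g (v i) - g (u i)) \<le> M' * (v i - u i)" by simp
    qed
    also have "\<dots> = M' * (\<Sum>i<N. v i - u i)" by (simp add: sum_distrib_left)
    also have "\<dots> < e" using small M' by (simp add: field_simps)
    finally show "(\<Sum>i<N. norm (g (v i) - g (u i))) < e" .
  qed
qed

lemma abs_cont_on_continuous_on:
  fixes g :: "real \<Rightarrow> 'v::real_normed_vector"
  assumes ac: "abs_cont_on a b g"
  shows "continuous_on {a..b} g"
  unfolding continuous_on_iff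
proof (intro ballI allI impI)
  fix x e :: real assume x: "x \<in> {a..b}" and e: "e > 0"
  then obtain d where d: "d > 0" and D: "\<And>(N::nat) (u::nat \<Rightarrow> real) v.
        (\<forall>i<N. a \<le> u i \<and> u i \<le> v i \<and> v i \<le> b) \<Longrightarrow>
        (\<forall>i<N. \<forall>j<N. i \<noteq> j \<longrightarrow> v i \<le> u j \<or> v j \<le> u i) \<Longrightarrow>
        (\<Sum>i<N. v i - u i) < d \<Longrightarrow>
        (\<Sum>i<N. norm (g (v i) - g (u i))) < e"
    using ac unfolding abs_cont_on_def by blast
  show "\<exists>d>0. \<forall>x'\<in>{a..b}. dist x' x < d \<longrightarrow> dist (g x') (g x) < e"
  proof (intro exI[of _ d] conjI ballI impI d)
    fix y assume y: "y \<in> {a..b}" "dist y x < d"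
    \<comment> \<open>A family consisting of the single interval between \<open>x\<close> and
      \<open>y\<close> is enough.\<close>
    have "(\<Sum>i<Suc 0. norm (g (max x y) - g (min x y))) < e"
      by (rule D) (use x y in \<open>auto simp: dist_real_def\<close>)
    then show "dist (g y) (g x) < e"
      by (cases "x \<le> y") (auto simp: dist_norm max_def min_def norm_minus_commute)
  qed
qed

text \<open>Serves two purposes: restriction to \<open>{a..t}\<close>, for integrating a derivative
  up to \<open>t\<close>, and exchange of functions that agree on the interval, whatever their
  values outside.\<close>

lemma abs_cont_on_subinterval_cong:
  assumes ac: "abs_cont_on a b f" and sub: "a \<le> a'" "b' \<le> b" and eq: "\<And>t. t \<in> {a'..b'} \<Longrightarrow> f t = g t"
  shows "abs_cont_on a' b' g"
  unfolding abs_cont_on_def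
proof (intro allI impI)
  fix e :: real assume "e > 0"
  then obtain d where d: "d > 0" and D: "\<And>(N::nat) (u::nat \<Rightarrow> real) v.
        (\<forall>i<N. a \<le> u i \<and> u i \<le> v i \<and> v i \<le> b) \<Longrightarrow>
        (\<forall>i<N. \<forall>j<N. i \<noteq> j \<longrightarrow> v i \<le> u j \<or> v j \<le> u i) \<Longrightarrow>
        (\<Sum>i<N. v i - u i) < d \<Longrightarrow>
        (\<Sum>i<N. norm (f (v i) - f (u i))) < e"
    using ac unfolding abs_cont_on_def by blast
  show "\<exists>d>0. \<forall>(N::nat) u v. (\<forall>i<N. a' \<le> u i \<and> u i \<le> v i \<and> v i \<le> b') \<longrightarrow>
        (\<forall>i<N. \<forall>j<N. i \<noteq> j \<longrightarrow> v i \<le> u j \<or> v j \<le> u i) \<longrightarrow>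
        (\<Sum>i<N. v i - u i) < d \<longrightarrow> (\<Sum>i<N. norm (g (v i) - g (u i))) < e"
  proof (intro exI[of _ d] conjI allI impI d)
    fix N :: nat and u v
    assume *: "\<forall>i<N. a' \<le> u i \<and> u i \<le> v i \<and> v i \<le> b'"
        "\<forall>i<N. \<forall>j<N. i \<noteq> j \<longrightarrow> v i \<le> u j \<or> v j \<le> u i" "(\<Sum>i<N. v i - u i) < d"
    have "(\<Sum>i<N. norm (g (v i) - g (u i))) = (\<Sum>i<N. norm (f (v i) - f (u i)))"
    proof (rule sum.cong[OF refl])
      fix i assume "i \<in> {..<N}"
      then have "u i \<in> {a'..b'}" "v i \<in> {a'..b'}" using *(1) by force+
      then show "norm (g (v i) - g (u i)) = norm (f (v i) - f (u i))" by (simp only: eq)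
    qed
    then show "(\<Sum>i<N. norm (g (v i) - g (u i))) < e" using D[OF _ *(2,3)] *(1) sub by fastforce
  qed
qed

lemmas abs_cont_on_cong = abs_cont_on_subinterval_cong[OF _ order_refl order_refl]

lemma has_vector_derivative_cong_interval:
  fixes f g :: "real \<Rightarrow> 'v::real_normed_vector"
  assumes "t \<in> {a<..<b}" "\<And>s. s \<in> {a..b} \<Longrightarrow> f s = g s"
  shows "(f has_vector_derivative D) (at t) \<longleftrightarrow> (g has_vector_derivative D) (at t)"
proof -
  have "(g has_vector_derivative D) (at t)"
    if fg: "\<And>s. s \<in> {a..b} \<Longrightarrow> f s = g s" "(f has_vector_derivative D) (at t)" for f g :: "real \<Rightarrow> 'v"
    by (rule has_vector_derivative_transform_within_open[of f D t "{a<..<b}"]) (use fg assms(1) in auto)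
  from this[of f g] this[of g f] assms(2) show ?thesis by auto
qed

text \<open>The points of the open interval where the bound fails form an open null set, hence the
  empty set; the endpoints follow by continuity.\<close>

lemma norm_le_from_AE:
  fixes f :: "real \<Rightarrow> 'v::real_normed_vector"
  assumes ab: "a < b" and cont: "continuous_on {a..b} f"
    and ae: "AE t in lebesgue. t \<in> {a..b} \<longrightarrow> norm (f t) \<le> M" and t: "t \<in> {a..b}"
  shows "norm (f t) \<le> M"
proof -
  let ?S = "{t \<in> {a<..<b}. norm (f t) > M}"
  have "open ?S"
  proof -
    have "continuous_on {a<..<b} (\<lambda>s. norm (f s))"
      by (intro continuous_intros continuous_on_subset[OF cont]) auto
    then have "open ({a<..<b} \<inter> (\<lambda>s. norm (f s)) -` {M<..})"
      by (rule continuous_open_preimage) auto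
    also have "{a<..<b} \<inter> (\<lambda>s. norm (f s)) -` {M<..} = ?S" by auto
    finally show ?thesis .
  qed
  moreover have "negligible ?S"
    using ae unfolding AE_lebesgue_iff_negligible by (rule negligible_subset) auto
  ultimately have "?S = {}" using open_not_negligible by blast
  then have le: "norm (f s) \<le> M" if "s \<in> {a<..<b}" for s using that by force
  show ?thesis
    by (rule continuous_le_on_closure[of "{a<..<b}" "\<lambda>s. norm (f s)"])
       (use ab cont t le in \<open>auto intro!: continuous_intros\<close>)
qed

text \<open>Both functions are set to 0 on the exceptional null set, which changes neither
  integral.\<close>

lemma integral_norm_bound_AE:
  fixes g :: "real \<Rightarrow> 'v::euclidean_space"
  assumes g: "g integrable_on S" and \<phi>: "\<phi> integrable_on S"
    and ae: "AE t in lebesgue. t \<in> S \<longrightarrow> norm (g t) \<le> \<phi> t"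
  shows "norm (integral S g) \<le> integral S \<phi>"
proof -
  define N where "N = {t. \<not> (t \<in> S \<longrightarrow> norm (g t) \<le> \<phi> t)}"
  have N: "negligible N" using ae unfolding AE_lebesgue_iff_negligible N_def .
  let ?g = "\<lambda>t. if t \<in> N then 0 else g t" and ?\<phi> = "\<lambda>t. if t \<in> N then 0 else \<phi> t"
  have "norm (integral S ?g) \<le> integral S ?\<phi>"
  proof (rule integral_norm_bound_integral)
    show "?g integrable_on S" by (rule integrable_spike[OF g N]) simp
    show "?\<phi> integrable_on S" by (rule integrable_spike[OF \<phi> N]) simp
    show "norm (?g t) \<le> ?\<phi> t" if "t \<in> S" for t using that by (auto simp: N_def)
  qed
  also have "integral S ?g = integral S g" by (rule integral_spike[OF N]) simp
  also have "integral S ?\<phi> = integral S \<phi>" by (rule integral_spike[OF N]) simp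
  finally show ?thesis .
qed

subsection \<open>Essentially bounded functions\<close>

lemma ne_emptyI: "x \<in> A \<Longrightarrow> A \<noteq> {}" by blast

lemma Linf_norm_nonneg:
  assumes "Linf a b g"
  shows "Linf_norm a b g \<ge> 0"
proof -
  obtain C where C: "AE t in lebesgue. t \<in> {a..b} \<longrightarrow> norm (g t) \<le> C"
    using assms by (auto simp: Linf_def)
  have "AE t in lebesgue. t \<in> {a..b} \<longrightarrow> norm (g t) \<le> \<bar>C\<bar>"
    using C by eventually_elim auto
  then have "\<bar>C\<bar> \<in> {C. C \<ge> 0 \<and> (AE t in lebesgue. t \<in> {a..b} \<longrightarrow> norm (g t) \<le> C)}" (is "_ \<in> ?S")
    by simp
  then have "?S \<noteq> {}" by (rule ne_emptyI)
  then show ?thesis unfolding Linf_norm_def by (rule cInf_greatest) auto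
qed

lemma Linf_norm_le:
  assumes "C \<ge> 0" "AE t in lebesgue. t \<in> {a..b} \<longrightarrow> norm (g t) \<le> C"
  shows "Linf_norm a b g \<le> C"
  unfolding Linf_norm_def by (rule cInf_lower) (use assms in \<open>auto intro!: bdd_belowI[of _ 0]\<close>)

text \<open>The infimum that defines the essential supremum is attained: the bounds exceeding it by
  1/(n+1) fail on null sets only, and their countable union is null.\<close>

lemma Linf_norm_AE:
  assumes "Linf a b g"
  shows "AE t in lebesgue. t \<in> {a..b} \<longrightarrow> norm (g t) \<le> Linf_norm a b g"
proof -
  let ?S = "{C. C \<ge> 0 \<and> (AE t in lebesgue. t \<in> {a..b} \<longrightarrow> norm (g t) \<le> C)}"
  obtain C where C: "AE t in lebesgue. t \<in> {a..b} \<longrightarrow> norm (g t) \<le> C"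
    using assms by (auto simp: Linf_def)
  have "AE t in lebesgue. t \<in> {a..b} \<longrightarrow> norm (g t) \<le> \<bar>C\<bar>"
    using C by eventually_elim auto
  then have "\<bar>C\<bar> \<in> ?S" by simp
  then have ne: "?S \<noteq> {}" by (rule ne_emptyI)
  have "AE t in lebesgue. t \<in> {a..b} \<longrightarrow> norm (g t) \<le> Linf_norm a b g + 1 / real (Suc n)" for n
  proof -
    have "Inf ?S < Linf_norm a b g + 1 / real (Suc n)" by (simp add: Linf_norm_def)
    then obtain C where "C \<in> ?S" "C < Linf_norm a b g + 1 / real (Suc n)"
      using cInf_lessD[OF ne] by blast
    then show ?thesis by auto
  qed
  then have "AE t in lebesgue. \<forall>n. t \<in> {a..b} \<longrightarrow> norm (g t) \<le> Linf_norm a b g + 1 / real (Suc n)"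
    by (subst AE_all_countable) (rule allI)
  then show ?thesis
  proof eventually_elim
    case (elim t)
    show ?case
    proof (rule impI, rule field_le_epsilon)
      fix e :: real assume "t \<in> {a..b}" "e > 0"
      moreover obtain n where "1 / real (Suc n) < e" using \<open>e > 0\<close> nat_approx_posE by blast
      ultimately show "norm (g t) \<le> Linf_norm a b g + e" using elim[rule_format, of n] by linarith
    qed
  qed
qed

lemma LinfI:
  assumes "set_borel_measurable lebesgue {a..b} g" "AE t in lebesgue. t \<in> {a..b} \<longrightarrow> norm (g t) \<le> C"
  shows "Linf a b g"
  using assms unfolding Linf_def by blast

lemma Linf_norm_cong_AE:
  assumes "AE t in lebesgue. t \<in> {a..b} \<longrightarrow> f t = g t"
  shows "Linf_norm a b f = Linf_norm a b g"
proof -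
  have "(AE t in lebesgue. t \<in> {a..b} \<longrightarrow> norm (f t) \<le> C) \<longleftrightarrow> (AE t in lebesgue. t \<in> {a..b} \<longrightarrow> norm (g t) \<le> C)" for C
  proof
    assume "AE t in lebesgue. t \<in> {a..b} \<longrightarrow> norm (f t) \<le> C"
    with assms show "AE t in lebesgue. t \<in> {a..b} \<longrightarrow> norm (g t) \<le> C" by eventually_elim auto
  next
    assume "AE t in lebesgue. t \<in> {a..b} \<longrightarrow> norm (g t) \<le> C"
    with assms show "AE t in lebesgue. t \<in> {a..b} \<longrightarrow> norm (f t) \<le> C" by eventually_elim auto
  qed
  then show ?thesis unfolding Linf_norm_def by simp
qed

lemma Linf_cong:
  assumes "\<And>t. t \<in> {a..b} \<Longrightarrow> f t = g t"
  shows "Linf a b f \<longleftrightarrow> Linf a b g"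
proof -
  have "(\<lambda>x. indicat_real {a..b} x *\<^sub>R f x) = (\<lambda>x. indicat_real {a..b} x *\<^sub>R g x)"
    by (rule ext) (use assms in \<open>auto simp: indicator_def\<close>)
  moreover have "(t \<in> {a..b} \<longrightarrow> norm (f t) \<le> C) = (t \<in> {a..b} \<longrightarrow> norm (g t) \<le> C)" for t C
    using assms by auto
  ultimately show ?thesis unfolding Linf_def set_borel_measurable_def by simp
qed

lemma Linf_absolutely_integrable:
  assumes "Linf a b g"
  shows "g absolutely_integrable_on {a..b}"
proof -
  have "integrable lebesgue (\<lambda>t. indicat_real {a..b} t *\<^sub>R g t)"
  proof (rule Bochner_Integration.integrable_bound[of _ "\<lambda>t. indicat_real {a..b} t *\<^sub>R Linf_norm a b g"])
    show "integrable lebesgue (\<lambda>t. indicat_real {a..b} t *\<^sub>R Linf_norm a b g)"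
      by (intro integrable_scaleR_left) (simp flip: lmeasurable_iff_integrable)
    show "(\<lambda>t. indicat_real {a..b} t *\<^sub>R g t) \<in> borel_measurable lebesgue"
      using assms by (simp add: Linf_def set_borel_measurable_def)
    show "AE x in lebesgue. norm (indicat_real {a..b} x *\<^sub>R g x) \<le> norm (indicat_real {a..b} x *\<^sub>R Linf_norm a b g)"
      using Linf_norm_AE[OF assms] by eventually_elim (auto simp: indicator_def Linf_norm_nonneg[OF assms])
  qed
  then show ?thesis by (simp add: set_integrable_def)
qed

lemma Linf_integrable:
  assumes "Linf a b g" "a \<le> u" "v \<le> b"
  shows "g integrable_on {u..v}"
proof -
  have "g integrable_on {a..b}"
    using Linf_absolutely_integrable[OF assms(1)] absolutely_integrable_on_def by blast
  then show ?thesis by (rule integrable_on_subinterval) (use assms in auto)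
qed

lemma continuous_on_imp_Linf:
  assumes "continuous_on {a..b} g"
  shows "Linf a b g"
proof -
  obtain C where "\<forall>x\<in>g ` {a..b}. norm x \<le> C"
    using compact_imp_bounded[OF compact_continuous_image[OF assms]] unfolding bounded_iff by auto
  then have "\<And>t. t \<in> {a..b} \<Longrightarrow> norm (g t) \<le> C" by blast
  moreover have "set_borel_measurable lebesgue {a..b} g"
    unfolding set_borel_measurable_def
    using borel_measurable_continuous_on_indicator[OF _ assms] by (auto simp: measurable_completion)
  ultimately show ?thesis unfolding Linf_def by auto
qed

lemma Linf_const: "Linf a b (\<lambda>t. c)"
  by (rule continuous_on_imp_Linf) simp

lemma Linf_add:
  assumes "Linf a b f" "Linf a b g"
  shows "Linf a b (\<lambda>t. f t + g t)" "Linf_norm a b (\<lambda>t. f t + g t) \<le> Linf_norm a b f + Linf_norm a b g"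
proof -
  have ae: "AE t in lebesgue. t \<in> {a..b} \<longrightarrow> norm (f t + g t) \<le> Linf_norm a b f + Linf_norm a b g"
    using Linf_norm_AE[OF assms(1)] Linf_norm_AE[OF assms(2)]
    by eventually_elim (auto intro: order_trans[OF norm_triangle_ineq])
  show "Linf a b (\<lambda>t. f t + g t)"
    by (rule LinfI[OF _ ae]) (use assms in \<open>auto simp: Linf_def set_borel_measurable_def scaleR_add_right\<close>)
  show "Linf_norm a b (\<lambda>t. f t + g t) \<le> Linf_norm a b f + Linf_norm a b g"
    by (rule Linf_norm_le[OF _ ae]) (simp add: Linf_norm_nonneg assms)
qed

lemma Linf_mult:
  assumes "Linf a b f" "Linf a b g"
  shows "Linf a b (\<lambda>t. f t * g t)" "Linf_norm a b (\<lambda>t. f t * g t) \<le> Linf_norm a b f * Linf_norm a b g"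
proof -
  have ae: "AE t in lebesgue. t \<in> {a..b} \<longrightarrow> norm (f t * g t) \<le> Linf_norm a b f * Linf_norm a b g"
    using Linf_norm_AE[OF assms(1)] Linf_norm_AE[OF assms(2)]
    by eventually_elim (auto simp: norm_mult Linf_norm_nonneg assms intro!: mult_mono)
  have "(\<lambda>t. indicat_real {a..b} t *\<^sub>R (f t * g t)) = (\<lambda>t. (indicat_real {a..b} t *\<^sub>R f t) * (indicat_real {a..b} t *\<^sub>R g t))"
    by (auto simp: indicator_def)
  moreover have "(\<lambda>t. (indicat_real {a..b} t *\<^sub>R f t) * (indicat_real {a..b} t *\<^sub>R g t)) \<in> borel_measurable lebesgue"
    using assms unfolding Linf_def set_borel_measurable_def by (intro borel_measurable_times) blast+
  ultimately show "Linf a b (\<lambda>t. f t * g t)"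
    by (intro LinfI[OF _ ae]) (simp only: set_borel_measurable_def)
  show "Linf_norm a b (\<lambda>t. f t * g t) \<le> Linf_norm a b f * Linf_norm a b g"
    by (rule Linf_norm_le[OF _ ae]) (simp add: Linf_norm_nonneg assms)
qed

lemma Linf_norm_const_le: "Linf_norm a b (\<lambda>t. c) \<le> norm c"
  by (rule Linf_norm_le) auto

lemma Linf_cmult:
  assumes "Linf a b f"
  shows "Linf a b (\<lambda>t. c * f t)" "Linf_norm a b (\<lambda>t. c * f t) \<le> norm c * Linf_norm a b f"
  using Linf_mult[OF Linf_const[of a b c] assms]
    mult_right_mono[OF Linf_norm_const_le[of a b c] Linf_norm_nonneg[OF assms]] by auto

lemma Linf_integral_bound:
  assumes "Linf a b z" "a \<le> u" "u \<le> v" "v \<le> b"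
  shows "norm (integral {u..v} z) \<le> Linf_norm a b z * (v - u)"
proof -
  have "norm (integral {u..v} z) \<le> integral {u..v} (\<lambda>t. Linf_norm a b z)"
    by (rule integral_norm_bound_AE)
       (use assms Linf_norm_AE[OF assms(1)] in \<open>auto intro: Linf_integrable\<close>)
  then show ?thesis using assms by (simp add: mult.commute)
qed

text \<open>An essentially bounded integrand makes the primitive Lipschitz, hence absolutely
  continuous; the derivative comes from Lebesgue differentiation.\<close>

lemma Linf_antiderivative:
  assumes z: "Linf a b z" and ab: "a \<le> b"
  shows "abs_cont_on a b (\<lambda>t. integral {a..t} z)"
    "AE t in lebesgue. t \<in> {a<..<b} \<longrightarrow> ((\<lambda>t. integral {a..t} z) has_vector_derivative z t) (at t)"
proof -
  have "norm (integral {a..v} z - integral {a..u} z) \<le> Linf_norm a b z * (v - u)"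
    if "a \<le> u" "u \<le> v" "v \<le> b" for u v
  proof -
    have "integral {a..u} z + integral {u..v} z = integral {a..v} z"
      by (rule Henstock_Kurzweil_Integration.integral_combine) (use that z Linf_integrable in auto)
    then have "integral {a..v} z - integral {a..u} z = integral {u..v} z" by (simp add: algebra_simps)
    then show ?thesis using Linf_integral_bound[OF z that] by simp
  qed
  then show "abs_cont_on a b (\<lambda>t. integral {a..t} z)" by (rule abs_cont_on_lipschitz)
  show "AE t in lebesgue. t \<in> {a<..<b} \<longrightarrow> ((\<lambda>t. integral {a..t} z) has_vector_derivative z t) (at t)"
    by (rule integral_has_vector_derivative_AE) (rule Linf_integrable[OF z], auto)
qed

subsection \<open>Sobolev spaces on an interval\<close>

locale interval =
  fixes a b :: real
  assumes ab: "a < b"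
begin

text \<open>Derivatives of order below \<open>k\<close> are continuous, so agreement almost
  everywhere improves to agreement on the whole interval, and this passes to the next derivative
  almost everywhere.\<close>

lemma W_derivs_unique:
  assumes D: "W_derivs a b k y D" and E: "W_derivs a b k y E" and j: "j \<le> k"
  shows "AE t in lebesgue. t \<in> {a..b} \<longrightarrow> D j t = E j t"
proof -
  have ends: "AE t in lebesgue. t \<noteq> a \<and> t \<noteq> b"
    unfolding AE_lebesgue_iff_negligible by (rule negligible_subset[of "{a,b}"]) auto
  have all: "AE t in lebesgue. t \<in> {a..b} \<longrightarrow> D j t = E j t \<Longrightarrow> j < k \<Longrightarrow> \<forall>t\<in>{a..b}. D j t = E j t" for j
  proof
    fix t assume ae: "AE t in lebesgue. t \<in> {a..b} \<longrightarrow> D j t = E j t" and j: "j < k" and t: "t \<in> {a..b}"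
    have "abs_cont_on a b (D j)" "abs_cont_on a b (E j)" using D E j by (auto simp: W_derivs_def)
    then have "continuous_on {a..b} (\<lambda>t. D j t - E j t)"
      by (intro continuous_intros abs_cont_on_continuous_on)
    moreover have "AE t in lebesgue. t \<in> {a..b} \<longrightarrow> norm (D j t - E j t) \<le> 0"
      using ae by eventually_elim auto
    ultimately have "norm (D j t - E j t) \<le> 0" using norm_le_from_AE[OF ab _ _ t] by blast
    then show "D j t = E j t" by simp
  qed
  show ?thesis using j
  proof (induction j)
    case 0
    have "\<forall>t\<in>{a..b}. D 0 t = E 0 t" using D E by (auto simp: W_derivs_def)
    then show ?case by (intro AE_I2) blast
  next
    case (Suc j)
    have "j < k" using Suc.prems by simp
    have "AE t in lebesgue. t \<in> {a..b} \<longrightarrow> D j t = E j t"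
      by (rule Suc.IH) (use \<open>j < k\<close> in simp)
    then have "\<forall>t\<in>{a..b}. D j t = E j t" using \<open>j < k\<close> by (rule all)
    then have eq: "\<And>t. t \<in> {a..b} \<Longrightarrow> D j t = E j t" by (rule bspec)
    have "AE t in lebesgue. t \<in> {a<..<b} \<longrightarrow> (D j has_vector_derivative D (Suc j) t) (at t)"
         "AE t in lebesgue. t \<in> {a<..<b} \<longrightarrow> (E j has_vector_derivative E (Suc j) t) (at t)"
      using D E Suc.prems by (auto simp: W_derivs_def)
    with ends show ?case
    proof eventually_elim
      case (elim t)
      show ?case
      proof
        assume "t \<in> {a..b}"
        then have t: "t \<in> {a<..<b}" using elim by auto
        then have "(D j has_vector_derivative D (Suc j) t) (at t)" "(D j has_vector_derivative E (Suc j) t) (at t)"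
          using elim has_vector_derivative_cong_interval[OF t eq] by auto
        then show "D (Suc j) t = E (Suc j) t" by (rule vector_derivative_unique_at)
      qed
    qed
  qed
qed

text \<open>\<open>Wk_norm\<close> picks a derivative family by \<open>SOME\<close>. Two families
  differ on null sets only, which the essential supremum ignores, so any family computes the
  norm.\<close>

lemma Wk_norm_eq:
  assumes D: "W_derivs a b k y D"
  shows "Wk_norm a b k y = (\<Sum>j\<le>k. Linf_norm a b (D j))"
proof -
  define E where "E = (SOME D. W_derivs a b k y D)"
  have E: "W_derivs a b k y E" unfolding E_def by (rule someI[of _ D]) (rule D)
  have "Linf_norm a b (E j) = Linf_norm a b (D j)" if "j \<le> k" for j
    by (rule Linf_norm_cong_AE, rule W_derivs_unique[OF E D that])
  then show ?thesis unfolding Wk_norm_def Let_def E_def[symmetric] by simp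
qed

lemma Wk_0_iff: "Wk a b 0 y \<longleftrightarrow> Linf a b y"
proof
  assume "Wk a b 0 y"
  then obtain D where "\<forall>t\<in>{a..b}. D 0 t = y t" "Linf a b (D 0)" by (auto simp: Wk_def W_derivs_def)
  then show "Linf a b y" using Linf_cong[of a b "D 0" y] by blast
next
  assume "Linf a b y"
  then show "Wk a b 0 y" unfolding Wk_def W_derivs_def by (intro exI[of _ "\<lambda>_. y"]) simp
qed

lemma Wk_norm_0:
  assumes "Linf a b y"
  shows "Wk_norm a b 0 y = Linf_norm a b y"
proof -
  have "W_derivs a b 0 y (\<lambda>_. y)" unfolding W_derivs_def using assms by simp
  from Wk_norm_eq[OF this] show ?thesis by simp
qed

lemma Wk_cong:
  assumes "\<And>t. t \<in> {a..b} \<Longrightarrow> y t = z t"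
  shows "Wk a b k y \<longleftrightarrow> Wk a b k z" "Wk_norm a b k y = Wk_norm a b k z"
proof -
  have eq: "W_derivs a b k y = W_derivs a b k z"
    using assms unfolding W_derivs_def by (intro ext) auto
  show "Wk a b k y \<longleftrightarrow> Wk a b k z" "Wk_norm a b k y = Wk_norm a b k z"
    unfolding Wk_def Wk_norm_def eq by (rule refl)+
qed

text \<open>Prepending \<open>y\<close> to a derivative family of \<open>z\<close> gives one of
  \<open>y\<close>. The norm splits exactly into the supremum of \<open>y\<close> and the norm of
  its derivative, which drives the inductions on the order.\<close>

lemma
  assumes ac: "abs_cont_on a b y" and z: "Wk a b k z"
    and der: "AE t in lebesgue. t \<in> {a<..<b} \<longrightarrow> (y has_vector_derivative z t) (at t)"
  shows Wk_SucI_deriv: "Wk a b (Suc k) y"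
    and Wk_norm_Suc_deriv: "Wk_norm a b (Suc k) y = Linf_norm a b y + Wk_norm a b k z"
proof -
  obtain D where D: "W_derivs a b k z D" using z by (auto simp: Wk_def)
  define E where "E = (\<lambda>j. case j of 0 \<Rightarrow> y | Suc i \<Rightarrow> D i)"
  have E: "W_derivs a b (Suc k) y E"
    unfolding W_derivs_def
  proof (intro conjI allI impI ballI)
    show "Linf a b (E (Suc k))" using D by (simp add: E_def W_derivs_def)
    show "E 0 t = y t" for t by (simp add: E_def)
    fix j assume j: "j < Suc k"
    show "abs_cont_on a b (E j)" using ac D j by (cases j) (auto simp: E_def W_derivs_def)
    show "AE t in lebesgue. t \<in> {a<..<b} \<longrightarrow> (E j has_vector_derivative E (Suc j) t) (at t)"
    proof (cases j)
      case 0
      show ?thesis using der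
      proof eventually_elim
        case (elim t)
        have "t \<in> {a<..<b} \<Longrightarrow> D 0 t = z t" using D by (auto simp: W_derivs_def)
        then show ?case using elim 0 by (simp add: E_def)
      qed
    next
      case (Suc i)
      then show ?thesis using D j by (auto simp: E_def W_derivs_def)
    qed
  qed
  then show "Wk a b (Suc k) y" by (auto simp: Wk_def)
  show "Wk_norm a b (Suc k) y = Linf_norm a b y + Wk_norm a b k z"
    unfolding Wk_norm_eq[OF E] Wk_norm_eq[OF D] by (subst sum.atMost_Suc_shift) (simp add: E_def)
qed

lemma Wk_SucE_deriv:
  assumes "Wk a b (Suc k) y"
  obtains z where "Wk a b k z" "abs_cont_on a b y"
    "AE t in lebesgue. t \<in> {a<..<b} \<longrightarrow> (y has_vector_derivative z t) (at t)"
proof -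
  obtain D where D: "W_derivs a b (Suc k) y D" using assms by (auto simp: Wk_def)
  then have eq: "\<And>t. t \<in> {a..b} \<Longrightarrow> D 0 t = y t" by (auto simp: W_derivs_def)
  show ?thesis
  proof (rule that[of "D 1"])
    have "W_derivs a b k (D 1) (\<lambda>j. D (Suc j))" using D by (auto simp: W_derivs_def)
    then show "Wk a b k (D 1)" by (auto simp: Wk_def)
    have ac0: "abs_cont_on a b (D 0)" using D by (auto simp: W_derivs_def)
    show "abs_cont_on a b y" by (rule abs_cont_on_cong[OF ac0 eq])
    have "AE t in lebesgue. t \<in> {a<..<b} \<longrightarrow> (D 0 has_vector_derivative D 1 t) (at t)"
      using D by (auto simp: W_derivs_def)
    then show "AE t in lebesgue. t \<in> {a<..<b} \<longrightarrow> (y has_vector_derivative D 1 t) (at t)"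
      by eventually_elim (use has_vector_derivative_cong_interval[OF _ eq] in auto)
  qed
qed

lemma Wk_Linf: "Wk a b k y \<Longrightarrow> Linf a b y"
proof (cases k)
  case (Suc i)
  assume "Wk a b k y"
  then have "abs_cont_on a b y" using Wk_SucE_deriv[of i y] Suc by metis
  then show ?thesis by (intro continuous_on_imp_Linf abs_cont_on_continuous_on)
qed (simp add: Wk_0_iff)

text \<open>Together with \<open>Wk_SucE\<close> this identifies W^(k+1) with the primitives, up to
  constants, of functions in W^k. The integral form replaces statements almost everywhere by
  identities on all of \<open>{a..b}\<close>.\<close>

lemma
  assumes z: "Wk a b k z" and y: "\<forall>t\<in>{a..b}. y t = c + integral {a..t} z"
  shows Wk_SucI: "Wk a b (Suc k) y"
    and Wk_norm_Suc: "Wk_norm a b (Suc k) y = Linf_norm a b y + Wk_norm a b k z"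
    and Wk_Suc_has_derivative: "AE t in lebesgue. t \<in> {a<..<b} \<longrightarrow> (y has_vector_derivative z t) (at t)"
proof -
  note anti = Linf_antiderivative[OF Wk_Linf[OF z] less_imp_le[OF ab]]
  let ?F = "\<lambda>t. c + integral {a..t} z"
  have "abs_cont_on a b ?F"
    using anti(1) unfolding abs_cont_on_def by simp
  then have ac: "abs_cont_on a b y" by (rule abs_cont_on_cong) (simp add: y)
  show der: "AE t in lebesgue. t \<in> {a<..<b} \<longrightarrow> (y has_vector_derivative z t) (at t)"
    using anti(2)
  proof eventually_elim
    case (elim t)
    show ?case
    proof
      assume t: "t \<in> {a<..<b}"
      have "(?F has_vector_derivative 0 + z t) (at t)"
        using elim t by (intro has_vector_derivative_add has_vector_derivative_const) simp
      then show "(y has_vector_derivative z t) (at t)"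
        using has_vector_derivative_cong_interval[OF t, of y ?F] y by simp
    qed
  qed
  show "Wk a b (Suc k) y" "Wk_norm a b (Suc k) y = Linf_norm a b y + Wk_norm a b k z"
    by (rule Wk_SucI_deriv[OF ac z der] Wk_norm_Suc_deriv[OF ac z der])+
qed

lemma abs_cont_eq_integral:
  fixes y z :: "real \<Rightarrow> complex"
  assumes ac: "abs_cont_on a b y"
    and der: "AE t in lebesgue. t \<in> {a<..<b} \<longrightarrow> (y has_vector_derivative z t) (at t)"
    and t: "t \<in> {a..b}"
  shows "y t = y a + integral {a..t} z"
proof -
  have "(z has_integral y t - y a) {a..t}"
  proof (rule has_integral_deriv_abs_cont)
    show "a \<le> t" using t by simp
    show "abs_cont_on a t y" by (rule abs_cont_on_subinterval_cong[OF ac]) (use t in simp_all)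
    show "AE s in lebesgue. s \<in> {a<..<t} \<longrightarrow> (y has_vector_derivative z s) (at s)"
      using der by eventually_elim (use t in auto)
  qed
  then show ?thesis by (simp add: integral_unique)
qed

lemma Wk_SucE:
  assumes "Wk a b (Suc k) y"
  obtains z where "Wk a b k z" "\<forall>t\<in>{a..b}. y t = y a + integral {a..t} z"
proof -
  obtain z where z: "Wk a b k z" "abs_cont_on a b y"
    "AE t in lebesgue. t \<in> {a<..<b} \<longrightarrow> (y has_vector_derivative z t) (at t)"
    by (rule Wk_SucE_deriv[OF assms])
  show ?thesis by (rule that[OF z(1)]) (intro ballI abs_cont_eq_integral[OF z(2,3)])
qed

lemma Wk_norm_nonneg: "Wk a b k y \<Longrightarrow> Wk_norm a b k y \<ge> 0"
proof (induction k arbitrary: y)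
  case 0
  then show ?case by (simp add: Wk_norm_0 Wk_0_iff Linf_norm_nonneg)
next
  case (Suc k)
  obtain z where z: "Wk a b k z" "\<forall>t\<in>{a..b}. y t = y a + integral {a..t} z"
    by (rule Wk_SucE[OF Suc.prems])
  show ?case using Wk_norm_Suc[OF z] Suc.IH[OF z(1)] Linf_norm_nonneg[OF Wk_Linf[OF Suc.prems]] by simp
qed

section \<open>Vector space operations and norm inequalities\<close>

lemma Wk_const: "Wk a b k (\<lambda>t. c)"
proof (induction k arbitrary: c)
  case (Suc k)
  show ?case by (rule Wk_SucI[OF Suc[of 0], of _ c]) simp
qed (simp add: Wk_0_iff Linf_const)

lemma Wk_norm_const: "Wk_norm a b k (\<lambda>t. c) \<le> norm c"
proof (induction k arbitrary: c)
  case 0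
  show ?case by (simp add: Wk_norm_0 Linf_const Linf_norm_const_le)
next
  case (Suc k)
  have "Wk_norm a b (Suc k) (\<lambda>t. c) = Linf_norm a b (\<lambda>t. c) + Wk_norm a b k (\<lambda>t. 0)"
    by (rule Wk_norm_Suc[OF Wk_const, of _ c]) simp
  then show ?case using Suc[of 0] Linf_norm_const_le[of a b c] by simp
qed

lemma Wk_norm_zero: "Wk_norm a b k (\<lambda>t. 0) = 0"
proof (rule antisym)
  show "Wk_norm a b k (\<lambda>t. 0) \<le> 0" using Wk_norm_const[of k 0] unfolding norm_zero .
qed (rule Wk_norm_nonneg[OF Wk_const])

lemma integral_add_Wk:
  assumes "Wk a b k y" "Wk a b k z" "t \<in> {a..b}"
  shows "integral {a..t} (\<lambda>s. y s + z s) = integral {a..t} y + integral {a..t} z"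
  using Linf_integrable[OF Wk_Linf[OF assms(1)], of a t] Linf_integrable[OF Wk_Linf[OF assms(2)], of a t] assms(3)
  by (intro integral_add) simp_all

lemma Wk_add:
  assumes "Wk a b k y" "Wk a b k z"
  shows "Wk a b k (\<lambda>t. y t + z t) \<and> Wk_norm a b k (\<lambda>t. y t + z t) \<le> Wk_norm a b k y + Wk_norm a b k z"
  using assms
proof (induction k arbitrary: y z)
  case 0
  then show ?case by (simp add: Wk_0_iff Wk_norm_0 Linf_add)
next
  case (Suc k)
  obtain y' where y': "Wk a b k y'" "\<forall>t\<in>{a..b}. y t = y a + integral {a..t} y'"
    by (rule Wk_SucE[OF Suc.prems(1)])
  obtain z' where z': "Wk a b k z'" "\<forall>t\<in>{a..b}. z t = z a + integral {a..t} z'"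
    by (rule Wk_SucE[OF Suc.prems(2)])
  note IH = Suc.IH[OF y'(1) z'(1)]
  have eq: "\<forall>t\<in>{a..b}. y t + z t = (y a + z a) + integral {a..t} (\<lambda>t. y' t + z' t)"
  proof
    fix t assume t: "t \<in> {a..b}"
    have "y t = y a + integral {a..t} y'" "z t = z a + integral {a..t} z'" using y'(2) z'(2) t by blast+
    then show "y t + z t = (y a + z a) + integral {a..t} (\<lambda>t. y' t + z' t)"
      unfolding integral_add_Wk[OF y'(1) z'(1) t] by (metis add.assoc add.commute)
  qed
  show ?case
    using Wk_SucI[OF conjunct1[OF IH] eq] Wk_norm_Suc[OF conjunct1[OF IH] eq] Wk_norm_Suc[OF y'] Wk_norm_Suc[OF z']
      IH Linf_add(2)[OF Wk_Linf[OF Suc.prems(1)] Wk_Linf[OF Suc.prems(2)]] by simp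
qed

lemma Wk_cmult:
  assumes "Wk a b k y"
  shows "Wk a b k (\<lambda>t. c * y t) \<and> Wk_norm a b k (\<lambda>t. c * y t) \<le> norm c * Wk_norm a b k y"
  using assms
proof (induction k arbitrary: y)
  case 0
  then show ?case by (simp add: Wk_0_iff Wk_norm_0 Linf_cmult)
next
  case (Suc k)
  obtain y' where y': "Wk a b k y'" "\<forall>t\<in>{a..b}. y t = y a + integral {a..t} y'"
    by (rule Wk_SucE[OF Suc.prems(1)])
  note IH = Suc.IH[OF y'(1)]
  have eq: "\<forall>t\<in>{a..b}. c * y t = c * y a + integral {a..t} (\<lambda>t. c * y' t)"
  proof
    fix t assume t: "t \<in> {a..b}"
    have "y t = y a + integral {a..t} y'" using y'(2) t by blast
    then show "c * y t = c * y a + integral {a..t} (\<lambda>t. c * y' t)"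
      by (metis distrib_left integral_mult_right)
  qed
  show ?case
    using Wk_SucI[OF conjunct1[OF IH] eq] Wk_norm_Suc[OF conjunct1[OF IH] eq] Wk_norm_Suc[OF y']
      IH Linf_cmult(2)[OF Wk_Linf[OF Suc.prems(1)], of c] by (simp add: distrib_left)
qed

lemmas Wk_add' = conjunct1[OF Wk_add] and Wk_norm_add = conjunct2[OF Wk_add]
lemmas Wk_cmult' = conjunct1[OF Wk_cmult] and Wk_norm_cmult = conjunct2[OF Wk_cmult]

lemma Wk_minus: "Wk a b k y \<Longrightarrow> Wk a b k (\<lambda>t. - y t)"
  using Wk_cmult'[of k y "-1"] by simp

lemma Wk_norm_minus: "Wk a b k y \<Longrightarrow> Wk_norm a b k (\<lambda>t. - y t) \<le> Wk_norm a b k y"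
  using Wk_norm_cmult[of k y "-1"] by simp

lemma Wk_diff: "Wk a b k y \<Longrightarrow> Wk a b k z \<Longrightarrow> Wk a b k (\<lambda>t. y t - z t)"
  using Wk_add'[OF _ Wk_minus, of k y z] by simp

lemma Wk_norm_diff: "Wk a b k y \<Longrightarrow> Wk a b k z \<Longrightarrow> Wk_norm a b k (\<lambda>t. y t - z t) \<le> Wk_norm a b k y + Wk_norm a b k z"
  using Wk_norm_add[OF _ Wk_minus, of k y z] Wk_norm_minus[of k z] by simp

lemma Wk_sum:
  assumes "\<And>i. i \<in> I \<Longrightarrow> Wk a b k (f i)"
  shows "Wk a b k (\<lambda>t. \<Sum>i\<in>I. f i t)" "Wk_norm a b k (\<lambda>t. \<Sum>i\<in>I. f i t) \<le> (\<Sum>i\<in>I. Wk_norm a b k (f i))"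
proof -
  have "Wk a b k (\<lambda>t. \<Sum>i\<in>I. f i t) \<and> Wk_norm a b k (\<lambda>t. \<Sum>i\<in>I. f i t) \<le> (\<Sum>i\<in>I. Wk_norm a b k (f i))"
    using assms
  proof (induction I rule: infinite_finite_induct)
    case (insert i I)
    then show ?case using Wk_add[of k "f i" "\<lambda>t. \<Sum>i\<in>I. f i t"] by fastforce
  qed (simp_all add: Wk_const Wk_norm_zero)
  then show "Wk a b k (\<lambda>t. \<Sum>i\<in>I. f i t)" "Wk_norm a b k (\<lambda>t. \<Sum>i\<in>I. f i t) \<le> (\<Sum>i\<in>I. Wk_norm a b k (f i))"
    by auto
qed

lemma Linf_norm_le_Wk_norm: "Wk a b k y \<Longrightarrow> Linf_norm a b y \<le> Wk_norm a b k y"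
proof (cases k)
  case 0
  assume "Wk a b k y"
  then show ?thesis using 0 by (simp add: Wk_norm_0 Wk_0_iff)
next
  case (Suc i)
  assume y: "Wk a b k y"
  obtain z where z: "Wk a b i z" "\<forall>t\<in>{a..b}. y t = y a + integral {a..t} z"
    using Wk_SucE y Suc by blast
  show ?thesis using Wk_norm_Suc[OF z] Wk_norm_nonneg[OF z(1)] Suc by simp
qed

lemma Wk_Suc_mono:
  assumes "Wk a b (Suc k) y"
  shows "Wk a b k y \<and> Wk_norm a b k y \<le> Wk_norm a b (Suc k) y"
  using assms
proof (induction k arbitrary: y)
  case 0
  then show ?case using Wk_Linf Linf_norm_le_Wk_norm by (auto simp: Wk_0_iff Wk_norm_0)
next
  case (Suc k)
  obtain z where z: "Wk a b (Suc k) z" "\<forall>t\<in>{a..b}. y t = y a + integral {a..t} z"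
    by (rule Wk_SucE[OF Suc.prems])
  note IH = Suc.IH[OF z(1)]
  show ?case
    using Wk_SucI[OF conjunct1[OF IH] z(2)] Wk_norm_Suc[OF conjunct1[OF IH] z(2)] Wk_norm_Suc[OF z] IH
    by simp
qed

lemma Wk_continuous_on:
  assumes "Wk a b (Suc k) y"
  shows "continuous_on {a..b} y"
  by (rule Wk_SucE_deriv[OF assms]) (rule abs_cont_on_continuous_on)

text \<open>From order 1 on the functions are continuous, so the essential bound holds at every
  point, in particular at the initial point \<open>a\<close>.\<close>

lemma norm_le_Wk_norm:
  assumes y: "Wk a b (Suc k) y" and t: "t \<in> {a..b}"
  shows "norm (y t) \<le> Wk_norm a b (Suc k) y"
  using norm_le_from_AE[OF ab Wk_continuous_on[OF y] Linf_norm_AE[OF Wk_Linf[OF y]] t]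
    Linf_norm_le_Wk_norm[OF y] by simp

end

section \<open>Lipschitz bounds, products and completeness\<close>

context interval begin

lemma Wk_Suc_lipschitz:
  assumes y: "Wk a b (Suc k) y" and uv: "a \<le> u" "u \<le> v" "v \<le> b"
  shows "norm (y v - y u) \<le> Wk_norm a b (Suc k) y * (v - u)"
proof -
  obtain z where z: "Wk a b k z" "\<forall>t\<in>{a..b}. y t = y a + integral {a..t} z" by (rule Wk_SucE[OF y])
  note zL = Wk_Linf[OF z(1)]
  have "y v = y a + integral {a..v} z" by (rule bspec[OF z(2)]) (use uv in simp)
  moreover have "y u = y a + integral {a..u} z" by (rule bspec[OF z(2)]) (use uv in simp)
  moreover have "integral {a..u} z + integral {u..v} z = integral {a..v} z"
    using Linf_integrable[OF zL, of a v] uv by (intro Henstock_Kurzweil_Integration.integral_combine) auto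
  ultimately have "y v - y u = integral {u..v} z" by (simp add: algebra_simps)
  then have "norm (y v - y u) \<le> Linf_norm a b z * (v - u)" using Linf_integral_bound[OF zL uv] by simp
  also have "\<dots> \<le> Wk_norm a b (Suc k) y * (v - u)"
    using Wk_norm_Suc[OF z] Linf_norm_le_Wk_norm[OF z(1)] Linf_norm_nonneg[OF Wk_Linf[OF y]] uv
    by (intro mult_right_mono) auto
  finally show ?thesis .
qed

text \<open>By Leibniz the derivative of the product is a sum of two products of order
  \<open>k\<close>, each with the constant \<open>3 ^ k\<close>. The supremum of the product adds 1,
  and 1 + 2 * 3^k is at most 3^(k+1).\<close>

lemma Wk_mult:
  assumes "Wk a b k y" "Wk a b k z"
  shows "Wk a b k (\<lambda>t. y t * z t) \<and> Wk_norm a b k (\<lambda>t. y t * z t) \<le> 3 ^ k * Wk_norm a b k y * Wk_norm a b k z"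
  using assms
proof (induction k arbitrary: y z)
  case 0
  then show ?case by (simp add: Wk_0_iff Wk_norm_0 Linf_mult)
next
  case (Suc k)
  define Y Z where "Y = Wk_norm a b (Suc k) y" and "Z = Wk_norm a b (Suc k) z"
  have YZ: "Y \<ge> 0" "Z \<ge> 0" using Wk_norm_nonneg Suc.prems by (auto simp: Y_def Z_def)
  obtain y' where y': "Wk a b k y'" "abs_cont_on a b y"
    "AE t in lebesgue. t \<in> {a<..<b} \<longrightarrow> (y has_vector_derivative y' t) (at t)"
    by (rule Wk_SucE_deriv[OF Suc.prems(1)])
  obtain z' where z': "Wk a b k z'" "abs_cont_on a b z"
    "AE t in lebesgue. t \<in> {a<..<b} \<longrightarrow> (z has_vector_derivative z' t) (at t)"
    by (rule Wk_SucE_deriv[OF Suc.prems(2)])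
  have y0: "Wk a b k y" "Wk_norm a b k y \<le> Y" and z0: "Wk a b k z" "Wk_norm a b k z \<le> Z"
    using Wk_Suc_mono[OF Suc.prems(1)] Wk_Suc_mono[OF Suc.prems(2)] by (auto simp: Y_def Z_def)
  have y1: "Wk_norm a b k y' \<le> Y"
    using Wk_norm_Suc_deriv[OF y'(2,1,3)] Linf_norm_nonneg[OF Wk_Linf[OF y0(1)]] by (simp add: Y_def)
  have z1: "Wk_norm a b k z' \<le> Z"
    using Wk_norm_Suc_deriv[OF z'(2,1,3)] Linf_norm_nonneg[OF Wk_Linf[OF z0(1)]] by (simp add: Z_def)
  \<comment> \<open>Both factors are bounded and Lipschitz, so the product is Lipschitz too, with
    constant \<open>2 * Y * Z\<close>.\<close>
  have ac: "abs_cont_on a b (\<lambda>t. y t * z t)"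
  proof (rule abs_cont_on_lipschitz)
    fix u v assume uv: "a \<le> u" "u \<le> v" "v \<le> b"
    have "y v * z v - y u * z u = y v * (z v - z u) + (y v - y u) * z u" by (simp add: algebra_simps)
    also have "norm \<dots> \<le> norm (y v) * norm (z v - z u) + norm (y v - y u) * norm (z u)"
      by (rule order_trans[OF norm_triangle_ineq]) (simp add: norm_mult)
    also have "\<dots> \<le> Y * (Z * (v - u)) + (Y * (v - u)) * Z"
      using norm_le_Wk_norm[OF Suc.prems(1), of v] norm_le_Wk_norm[OF Suc.prems(2), of u]
        Wk_Suc_lipschitz[OF Suc.prems(1) uv] Wk_Suc_lipschitz[OF Suc.prems(2) uv] uv YZ
      unfolding Y_def Z_def by (intro add_mono mult_mono) auto
    finally show "norm (y v * z v - y u * z u) \<le> (2 * Y * Z) * (v - u)" by (simp add: algebra_simps)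
  qed
  have der: "AE t in lebesgue. t \<in> {a<..<b} \<longrightarrow> ((\<lambda>t. y t * z t) has_vector_derivative y t * z' t + y' t * z t) (at t)"
    using y'(3) z'(3) by eventually_elim (auto intro: has_vector_derivative_mult)
  note IH1 = Suc.IH[OF y0(1) z'(1)] and IH2 = Suc.IH[OF y'(1) z0(1)]
  have w: "Wk a b k (\<lambda>t. y t * z' t + y' t * z t)" using IH1 IH2 by (intro Wk_add') auto
  have "Wk_norm a b (Suc k) (\<lambda>t. y t * z t) = Linf_norm a b (\<lambda>t. y t * z t) + Wk_norm a b k (\<lambda>t. y t * z' t + y' t * z t)"
    by (rule Wk_norm_Suc_deriv[OF ac w der])
  also have "Wk_norm a b k (\<lambda>t. y t * z' t + y' t * z t) \<le> Wk_norm a b k (\<lambda>t. y t * z' t) + Wk_norm a b k (\<lambda>t. y' t * z t)"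
    using IH1 IH2 by (intro Wk_norm_add) auto
  also have "Wk_norm a b k (\<lambda>t. y t * z' t) \<le> 3 ^ k * Wk_norm a b k y * Wk_norm a b k z'" using IH1 by simp
  also have "\<dots> \<le> 3 ^ k * Y * Z"
    using y0 z1 YZ Wk_norm_nonneg[OF z'(1)] Wk_norm_nonneg[OF y0(1)] by (intro mult_mono) auto
  also have "Wk_norm a b k (\<lambda>t. y' t * z t) \<le> 3 ^ k * Wk_norm a b k y' * Wk_norm a b k z" using IH2 by simp
  also have "\<dots> \<le> 3 ^ k * Y * Z"
    using z0 y1 YZ Wk_norm_nonneg[OF z0(1)] Wk_norm_nonneg[OF y'(1)] by (intro mult_mono) auto
  also have "Linf_norm a b (\<lambda>t. y t * z t) \<le> Linf_norm a b y * Linf_norm a b z"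
    by (rule Linf_mult(2)[OF Wk_Linf[OF y0(1)] Wk_Linf[OF z0(1)]])
  also have "\<dots> \<le> Y * Z"
    using Linf_norm_le_Wk_norm[OF Suc.prems(1)] Linf_norm_le_Wk_norm[OF Suc.prems(2)] YZ
      Linf_norm_nonneg[OF Wk_Linf[OF z0(1)]]
    unfolding Y_def Z_def by (intro mult_mono) auto
  finally have "Wk_norm a b (Suc k) (\<lambda>t. y t * z t) \<le> Y * Z + (3 ^ k * Y * Z + 3 ^ k * Y * Z)" by simp
  also have "\<dots> = (1 + 2 * 3 ^ k) * (Y * Z)" by (simp add: algebra_simps)
  also have "\<dots> \<le> 3 ^ Suc k * (Y * Z)"
    using YZ one_le_power[of "3::real" k] by (intro mult_right_mono) auto
  finally show ?case using Wk_SucI_deriv[OF ac w der] by (simp add: Y_def Z_def mult.assoc)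
qed

lemmas Wk_mult' = conjunct1[OF Wk_mult] and Wk_norm_mult = conjunct2[OF Wk_mult]

text \<open>In the factor \<open>1 + (b - a)\<close> the 1 counts the derivative itself and the
  length of the interval counts the supremum of its primitive.\<close>

lemma Wk_norm_Suc_le:
  assumes z: "Wk a b k z" and y: "\<forall>t\<in>{a..b}. y t = c + integral {a..t} z"
  shows "Wk_norm a b (Suc k) y \<le> norm c + (1 + (b - a)) * Wk_norm a b k z"
proof -
  have "Linf_norm a b y \<le> norm c + (b - a) * Wk_norm a b k z"
  proof (rule Linf_norm_le)
    show "0 \<le> norm c + (b - a) * Wk_norm a b k z" using ab Wk_norm_nonneg[OF z] by simp
    have "norm (y t) \<le> norm c + (b - a) * Wk_norm a b k z" if t: "t \<in> {a..b}" for t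
    proof -
      have "norm (integral {a..t} z) \<le> Linf_norm a b z * (t - a)"
        using Linf_integral_bound[OF Wk_Linf[OF z], of a t] t by simp
      also have "\<dots> \<le> Wk_norm a b k z * (b - a)"
        using t Linf_norm_le_Wk_norm[OF z] Wk_norm_nonneg[OF z] by (intro mult_mono) auto
      finally have *: "norm (integral {a..t} z) \<le> (b - a) * Wk_norm a b k z" by (simp add: mult.commute)
      have "y t = c + integral {a..t} z" using y t by blast
      then have "norm (y t) \<le> norm c + norm (integral {a..t} z)" using norm_triangle_ineq by metis
      then show ?thesis using * by simp
    qed
    then show "AE t in lebesgue. t \<in> {a..b} \<longrightarrow> norm (y t) \<le> norm c + (b - a) * Wk_norm a b k z" by auto
  qed
  then show ?thesis using Wk_norm_Suc[OF z y] by (simp add: algebra_simps)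
qed

text \<open>Completeness in the form that absolutely convergent series converge. Off a null set the
  series converges absolutely at each point, with an error at most the tail of the series of
  norms.\<close>

lemma Linf_complete:
  assumes f: "\<And>i. Linf a b (f i)" and sum: "summable (\<lambda>i. Linf_norm a b (f i))"
  shows "\<exists>x. Linf a b x \<and> (\<lambda>N. Linf_norm a b (\<lambda>t. x t - (\<Sum>i<N. f i t))) \<longlonglongrightarrow> 0"
proof -
  let ?M = "\<lambda>i. Linf_norm a b (f i)"
  \<comment> \<open>The indicator makes each summand measurable on the whole line, and with it the
    sum.\<close>
  define x where "x = (\<lambda>t. \<Sum>i. indicat_real {a..b} t *\<^sub>R f i t)"
  have tail: "AE t in lebesgue. t \<in> {a..b} \<longrightarrow> norm (x t - (\<Sum>i<N. f i t)) \<le> (\<Sum>i. ?M (i + N))" for N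
  proof -
    have "AE t in lebesgue. \<forall>i. t \<in> {a..b} \<longrightarrow> norm (f i t) \<le> ?M i"
      by (subst AE_all_countable) (intro allI Linf_norm_AE f)
    then show ?thesis
    proof eventually_elim
      case (elim t)
      show ?case
      proof
        assume t: "t \<in> {a..b}"
        then have le: "norm (f i t) \<le> ?M i" for i using elim by blast
        have s: "summable (\<lambda>i. f i t)" by (rule summable_comparison_test'[OF sum, of 0]) (rule le)
        have "x t - (\<Sum>i<N. f i t) = (\<Sum>i. f (i + N) t)"
          using suminf_minus_initial_segment[OF s, of N] t by (simp add: x_def)
        also have "norm \<dots> \<le> (\<Sum>i. ?M (i + N))"
          by (rule norm_suminf_le[OF le summable_ignore_initial_segment[OF sum]])
        finally show "norm (x t - (\<Sum>i<N. f i t)) \<le> (\<Sum>i. ?M (i + N))" .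
      qed
    qed
  qed
  have nn: "(\<Sum>i. ?M (i + N)) \<ge> 0" for N
    by (rule suminf_nonneg[OF summable_ignore_initial_segment[OF sum]]) (rule Linf_norm_nonneg[OF f])
  have "x \<in> borel_measurable lebesgue" unfolding x_def
    by (rule borel_measurable_suminf) (use f in \<open>simp add: Linf_def set_borel_measurable_def\<close>)
  then have "set_borel_measurable lebesgue {a..b} x"
    unfolding set_borel_measurable_def by (intro borel_measurable_scaleR borel_measurable_indicator) auto
  then have "Linf a b x" using tail[of 0] by (intro LinfI) auto
  moreover have "(\<lambda>N. Linf_norm a b (\<lambda>t. x t - (\<Sum>i<N. f i t))) \<longlonglongrightarrow> 0"
  proof (rule Lim_null_comparison[OF _ suminf_exist_split2[OF sum]], intro always_eventually allI)
    fix N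
    have S: "Linf a b (\<lambda>t. x t - (\<Sum>i<N. f i t))"
      using Wk_diff[of 0 x "\<lambda>t. \<Sum>i<N. f i t"] Wk_sum(1)[of "{..<N}" 0 f] \<open>Linf a b x\<close> f by (simp add: Wk_0_iff)
    show "norm (Linf_norm a b (\<lambda>t. x t - (\<Sum>i<N. f i t))) \<le> (\<Sum>k. ?M (k + N))"
      using Linf_norm_le[OF nn tail] Linf_norm_nonneg[OF S] by simp
  qed
  ultimately show ?thesis by blast
qed

text \<open>The derivatives form an absolutely convergent series in W^k, the values at
  \<open>a\<close> one in the complex numbers. The limit is the primitive of the first sum with the
  second sum as initial value.\<close>

lemma Wk_complete:
  assumes "\<And>i. Wk a b k (f i)" "summable (\<lambda>i. Wk_norm a b k (f i))"
  shows "\<exists>x. Wk a b k x \<and> (\<lambda>N. Wk_norm a b k (\<lambda>t. x t - (\<Sum>i<N. f i t))) \<longlonglongrightarrow> 0"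
  using assms
proof (induction k arbitrary: f)
  case 0
  have f: "Linf a b (f i)" for i using 0(1) by (simp add: Wk_0_iff)
  have "summable (\<lambda>i. Linf_norm a b (f i))" using 0(2) unfolding Wk_norm_0[OF f] .
  from Linf_complete[OF f this]
  obtain x where x: "Linf a b x" "(\<lambda>N. Linf_norm a b (\<lambda>t. x t - (\<Sum>i<N. f i t))) \<longlonglongrightarrow> 0"
    by blast
  have "Linf a b (\<lambda>t. x t - (\<Sum>i<N. f i t))" for N
    using Wk_diff[of 0 x "\<lambda>t. \<Sum>i<N. f i t"] Wk_sum(1)[of "{..<N}" 0 f] x(1) f by (simp add: Wk_0_iff)
  from Wk_norm_0[OF this] show ?case using x by (intro exI[of _ x]) (simp add: Wk_0_iff)
next
  case (Suc k)
  have "\<exists>z. Wk a b k z \<and> (\<forall>t\<in>{a..b}. f i t = f i a + integral {a..t} z)" for i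
    by (rule Wk_SucE[OF Suc.prems(1)[of i]]) blast
  then obtain z where z: "\<And>i. Wk a b k (z i)" "\<And>i. \<forall>t\<in>{a..b}. f i t = f i a + integral {a..t} (z i)"
    by metis
  have "Wk_norm a b k (z i) \<le> Wk_norm a b (Suc k) (f i)" for i
    using Wk_norm_Suc[OF z] Linf_norm_nonneg[OF Wk_Linf[OF Suc.prems(1)]] by simp
  then have sz: "summable (\<lambda>i. Wk_norm a b k (z i))"
    using Wk_norm_nonneg[OF z(1)] by (intro summable_comparison_test'[OF Suc.prems(2), of 0]) simp
  obtain w where w: "Wk a b k w" "(\<lambda>N. Wk_norm a b k (\<lambda>t. w t - (\<Sum>i<N. z i t))) \<longlonglongrightarrow> 0"
    using Suc.IH[OF z(1) sz] by blast
  have sc: "summable (\<lambda>i. f i a)"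
    by (rule summable_comparison_test'[OF Suc.prems(2), of 0]) (use norm_le_Wk_norm[OF Suc.prems(1)] ab in auto)
  define c where "c = (\<Sum>i. f i a)"
  define x where "x = (\<lambda>t. c + integral {a..t} w)"
  have x: "Wk a b (Suc k) x" by (rule Wk_SucI[OF w(1), of _ c]) (simp add: x_def)
  have wz: "Wk a b k (\<lambda>t. w t - (\<Sum>i<N. z i t))" for N by (intro Wk_diff w Wk_sum z)
  have eq: "\<forall>t\<in>{a..b}. x t - (\<Sum>i<N. f i t) = (c - (\<Sum>i<N. f i a)) + integral {a..t} (\<lambda>t. w t - (\<Sum>i<N. z i t))" for N
  proof
    fix t assume t: "t \<in> {a..b}"
    have int: "z i integrable_on {a..t}" "w integrable_on {a..t}" for i
      using Linf_integrable[OF Wk_Linf[OF z(1)]] Linf_integrable[OF Wk_Linf[OF w(1)]] t by auto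
    have "(\<Sum>i<N. f i t) = (\<Sum>i<N. f i a + integral {a..t} (z i))"
      by (rule sum.cong[OF refl]) (use z(2) t in blast)
    then show "x t - (\<Sum>i<N. f i t) = (c - (\<Sum>i<N. f i a)) + integral {a..t} (\<lambda>t. w t - (\<Sum>i<N. z i t))"
      using int by (simp add: x_def sum.distrib integral_diff integral_sum integrable_sum)
  qed
  have "(\<lambda>N. Wk_norm a b (Suc k) (\<lambda>t. x t - (\<Sum>i<N. f i t))) \<longlonglongrightarrow> 0"
  proof (rule Lim_null_comparison)
    show "\<forall>\<^sub>F N in sequentially. norm (Wk_norm a b (Suc k) (\<lambda>t. x t - (\<Sum>i<N. f i t)))
        \<le> norm (c - (\<Sum>i<N. f i a)) + (1 + (b - a)) * Wk_norm a b k (\<lambda>t. w t - (\<Sum>i<N. z i t))"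
      using Wk_norm_Suc_le[OF wz eq] Wk_norm_nonneg[OF Wk_SucI[OF wz eq]] by (intro always_eventually allI) simp
    have "(\<lambda>N. norm (c - (\<Sum>i<N. f i a)) + (1 + (b - a)) * Wk_norm a b k (\<lambda>t. w t - (\<Sum>i<N. z i t))) \<longlonglongrightarrow>
        norm (c - c) + (1 + (b - a)) * 0"
      using summable_LIMSEQ[OF sc] w(2) unfolding c_def by (intro tendsto_intros)
    then show "(\<lambda>N. norm (c - (\<Sum>i<N. f i a)) + (1 + (b - a)) * Wk_norm a b k (\<lambda>t. w t - (\<Sum>i<N. z i t))) \<longlonglongrightarrow> 0"
      by simp
  qed
  then show ?case using x by blast
qed

end

subsection \<open>Vector functions and uniform boundedness\<close>

context interval begin

lemma WvecI: "(\<And>i. Wk a b k (\<lambda>t. y t $ i)) \<Longrightarrow> Wvec a b k y"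
  by (simp add: Wvec_def)

lemma WvecD: "Wvec a b k y \<Longrightarrow> Wk a b k (\<lambda>t. y t $ i)"
  by (simp add: Wvec_def)

lemma Wvec_norm_nonneg: "Wvec a b k y \<Longrightarrow> Wvec_norm a b k y \<ge> 0"
  unfolding Wvec_norm_def by (rule sum_nonneg, rule Wk_norm_nonneg, rule WvecD)

lemma Wvec_add: "Wvec a b k y \<Longrightarrow> Wvec a b k z \<Longrightarrow> Wvec a b k (\<lambda>t. y t + z t)"
  by (rule WvecI) (simp add: Wk_add' WvecD)

lemma Wvec_diff: "Wvec a b k y \<Longrightarrow> Wvec a b k z \<Longrightarrow> Wvec a b k (\<lambda>t. y t - z t)"
  by (rule WvecI) (simp add: Wk_diff WvecD)

lemma Wvec_scale: "Wvec a b k y \<Longrightarrow> Wvec a b k (\<lambda>t. c *s y t)"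
  by (rule WvecI) (simp add: Wk_cmult' WvecD)

lemma Wvec_zero: "Wvec a b k (\<lambda>t. 0)"
  by (rule WvecI) (simp add: Wk_const)

lemma Wvec_norm_zero: "Wvec_norm a b k (\<lambda>t. 0 :: complex ^ 'm::finite) = 0"
  unfolding Wvec_norm_def by (simp add: Wk_norm_zero)

lemma Wvec_sum: "(\<And>i. i \<in> I \<Longrightarrow> Wvec a b k (f i)) \<Longrightarrow> Wvec a b k (\<lambda>t. \<Sum>i\<in>I. f i t)"
  by (rule WvecI) (simp add: Wk_sum(1) WvecD)

lemma Wvec_norm_add:
  assumes "Wvec a b k y" "Wvec a b k z"
  shows "Wvec_norm a b k (\<lambda>t. y t + z t) \<le> Wvec_norm a b k y + Wvec_norm a b k z"
  unfolding Wvec_norm_def sum.distrib[symmetric] vector_add_component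
  by (rule sum_mono, rule Wk_norm_add) (rule WvecD, rule assms)+

lemma Wvec_norm_scale:
  assumes "Wvec a b k y"
  shows "Wvec_norm a b k (\<lambda>t. c *s y t) \<le> norm c * Wvec_norm a b k y"
  unfolding Wvec_norm_def sum_distrib_left vector_smult_component
  by (rule sum_mono, rule Wk_norm_cmult) (rule WvecD, rule assms)+

lemma Wk_norm_le_Wvec_norm:
  assumes "Wvec a b k (y :: real \<Rightarrow> complex ^ 'm::finite)"
  shows "Wk_norm a b k (\<lambda>t. y t $ i) \<le> Wvec_norm a b k y"
  unfolding Wvec_norm_def
  by (rule member_le_sum[of i UNIV "\<lambda>i. Wk_norm a b k (\<lambda>t. y t $ i)"]) (simp_all add: Wk_norm_nonneg WvecD[OF assms])

lemma Wvec_cong: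
  assumes "\<And>t. t \<in> {a..b} \<Longrightarrow> y t = z t"
  shows "Wvec a b k y \<longleftrightarrow> Wvec a b k z" "Wvec_norm a b k y = Wvec_norm a b k z"
proof -
  have "Wk a b k (\<lambda>t. y t $ i) \<longleftrightarrow> Wk a b k (\<lambda>t. z t $ i)" "Wk_norm a b k (\<lambda>t. y t $ i) = Wk_norm a b k (\<lambda>t. z t $ i)" for i
    using assms by (intro Wk_cong; simp)+
  then show "Wvec a b k y \<longleftrightarrow> Wvec a b k z" "Wvec_norm a b k y = Wvec_norm a b k z"
    by (auto simp: Wvec_def Wvec_norm_def)
qed

lemma Wvec_complete:
  fixes f :: "nat \<Rightarrow> real \<Rightarrow> complex ^ 'm::finite"
  assumes f: "\<And>i. Wvec a b k (f i)" and sum: "summable (\<lambda>i. Wvec_norm a b k (f i))"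
  shows "\<exists>x. Wvec a b k x \<and> (\<lambda>N. Wvec_norm a b k (\<lambda>t. x t - (\<Sum>i<N. f i t))) \<longlonglongrightarrow> 0"
proof -
  have "\<exists>x. Wk a b k x \<and> (\<lambda>N. Wk_norm a b k (\<lambda>t. x t - (\<Sum>i<N. f i t $ j))) \<longlonglongrightarrow> 0" for j
  proof (rule Wk_complete)
    show fj: "Wk a b k (\<lambda>t. f i t $ j)" for i by (rule WvecD[OF f])
    show "summable (\<lambda>i. Wk_norm a b k (\<lambda>t. f i t $ j))"
      by (rule summable_comparison_test'[OF sum, of 0])
         (use Wk_norm_le_Wvec_norm[OF f] Wk_norm_nonneg[OF fj] in auto)
  qed
  then have "\<forall>j. \<exists>x. Wk a b k x \<and> (\<lambda>N. Wk_norm a b k (\<lambda>t. x t - (\<Sum>i<N. f i t $ j))) \<longlonglongrightarrow> 0" by (rule allI)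
  from choice[OF this] obtain x where
    "\<forall>j. Wk a b k (x j) \<and> (\<lambda>N. Wk_norm a b k (\<lambda>t. x j t - (\<Sum>i<N. f i t $ j))) \<longlonglongrightarrow> 0" by (rule exE)
  then have x: "\<And>j. Wk a b k (x j)"
      "\<And>j. (\<lambda>N. Wk_norm a b k (\<lambda>t. x j t - (\<Sum>i<N. f i t $ j))) \<longlonglongrightarrow> 0" by simp_all
  have "(\<lambda>N. Wvec_norm a b k (\<lambda>t. (\<chi> j. x j t) - (\<Sum>i<N. f i t))) \<longlonglongrightarrow> (\<Sum>j\<in>(UNIV::'m set). 0)"
    unfolding Wvec_norm_def vector_minus_component sum_component vec_lambda_beta
    by (intro tendsto_sum x(2))
  then show ?thesis using x(1) by (intro exI[of _ "\<lambda>t. \<chi> j. x j t"]) (simp add: Wvec_def)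
qed

section \<open>Operator norm and the uniform boundedness principle\<close>

context
  fixes L :: "(real \<Rightarrow> complex ^ 'm::finite) \<Rightarrow> complex ^ 'm" and n :: nat
  assumes L: "bounded_lin_op a b n L"
begin

lemma bounded_lin_op_add: "Wvec a b n y \<Longrightarrow> Wvec a b n z \<Longrightarrow> L (\<lambda>t. y t + z t) = L y + L z"
  using L by (auto simp: bounded_lin_op_def)

lemma bounded_lin_op_scale: "Wvec a b n y \<Longrightarrow> L (\<lambda>t. c *s y t) = c *s L y"
  using L by (auto simp: bounded_lin_op_def)

lemma bounded_lin_op_zero: "L (\<lambda>t. 0) = 0"
  using bounded_lin_op_scale[OF Wvec_zero, of 0] by simp

lemma bounded_lin_op_diff:
  assumes "Wvec a b n y" "Wvec a b n z"
  shows "L (\<lambda>t. y t - z t) = L y - L z"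
  using bounded_lin_op_add[OF assms(1) Wvec_scale[OF assms(2), of "-1"]] bounded_lin_op_scale[OF assms(2), of "-1"]
  by (simp add: vector_sneg_minus1[symmetric])

text \<open>\<open>K\<close> is the operator norm, described as a least bound: every smaller
  nonnegative constant is beaten by some function. The second half supplies the humps in the uniform
  boundedness argument.\<close>

lemma bounded_lin_op_best_constant:
  "\<exists>K\<ge>0. (\<forall>y. Wvec a b n y \<longrightarrow> norm (L y) \<le> K * Wvec_norm a b n y) \<and>
    (\<forall>K'. 0 \<le> K' \<longrightarrow> K' < K \<longrightarrow> (\<exists>y. Wvec a b n y \<and> norm (L y) > K' * Wvec_norm a b n y))"
proof -
  define S where "S = {C. C \<ge> 0 \<and> (\<forall>y. Wvec a b n y \<longrightarrow> norm (L y) \<le> C * Wvec_norm a b n y)}"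
  obtain C where C: "\<And>y. Wvec a b n y \<Longrightarrow> norm (L y) \<le> C * Wvec_norm a b n y"
    using L by (auto simp: bounded_lin_op_def)
  have "norm (L y) \<le> \<bar>C\<bar> * Wvec_norm a b n y" if y: "Wvec a b n y" for y
    by (rule order_trans[OF C[OF y]]) (intro mult_right_mono Wvec_norm_nonneg y, simp)
  then have CS: "\<bar>C\<bar> \<in> S" by (simp add: S_def)
  then have ne: "S \<noteq> {}" by blast
  have bdd: "bdd_below S" by (rule bdd_belowI[of _ 0]) (simp add: S_def)
  show ?thesis
  proof (intro exI[of _ "Inf S"] conjI allI impI)
    show "Inf S \<ge> 0" by (rule cInf_greatest[OF ne]) (simp add: S_def)
    show "norm (L y) \<le> Inf S * Wvec_norm a b n y" if y: "Wvec a b n y" for y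
    \<comment> \<open>Division is impossible for a function of norm 0; there boundedness forces
      \<open>L y = 0\<close>.\<close>
    proof (cases "Wvec_norm a b n y = 0")
      case True
      then show ?thesis using C[OF y] by simp
    next
      case False
      then have pos: "Wvec_norm a b n y > 0" using Wvec_norm_nonneg[OF y] by simp
      have "norm (L y) / Wvec_norm a b n y \<le> Inf S"
        by (rule cInf_greatest[OF ne]) (use y pos in \<open>simp add: S_def divide_le_eq\<close>)
      then show ?thesis using pos by (simp add: field_simps)
    qed
    show "\<exists>y. Wvec a b n y \<and> norm (L y) > K' * Wvec_norm a b n y" if K': "K' \<ge> 0" "K' < Inf S" for K'
    proof -
      have "K' \<notin> S" using cInf_lower[OF _ bdd, of K'] K'(2) by force
      then show ?thesis using K'(1) by (auto simp: S_def not_le)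
    qed
  qed
qed

end

text \<open>Banach--Steinhaus by a gliding hump: a vector d on which some operator nearly attains its
  large norm is added to or subtracted from the current partial sum, whichever keeps the image large.\<close>

lemma uniform_boundedness:
  fixes T :: "nat \<Rightarrow> (real \<Rightarrow> complex ^ 'm::finite) \<Rightarrow> complex ^ 'm"
  assumes T: "\<And>i. bounded_lin_op a b n (T i)"
    and pw: "\<And>y. Wvec a b n y \<Longrightarrow> \<exists>K. \<forall>i. norm (T i y) \<le> K"
  shows "\<exists>K. \<forall>i y. Wvec a b n y \<longrightarrow> norm (T i y) \<le> K * Wvec_norm a b n y"
proof (rule ccontr)
  assume unb: "\<not> ?thesis"
  \<comment> \<open>The constants fit together as follows: the k-th hump has size at most 3^-k and
    an image of at least 2/3 of K * 3^-k; all later humps together have size at most half of 3^-k;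
    the surplus 1/6 of K * 3^-k is at least 2^k / 6 because K is at least 6^k.\<close>
  have step: "\<exists>i d K. Wvec a b n d \<and> Wvec_norm a b n d \<le> (1/3)^k \<and> K \<ge> 6^k \<and>
      (\<forall>y. Wvec a b n y \<longrightarrow> norm (T i y) \<le> K * Wvec_norm a b n y) \<and>
      norm (T i d) \<ge> (2/3) * K * (1/3)^k" for k :: nat
  proof -
    obtain i y where y: "Wvec a b n y" "norm (T i y) > 6^k * Wvec_norm a b n y"
      using unb by (meson not_le)
    obtain K where K: "K \<ge> 0" "\<forall>y. Wvec a b n y \<longrightarrow> norm (T i y) \<le> K * Wvec_norm a b n y"
      "\<forall>K'. 0 \<le> K' \<longrightarrow> K' < K \<longrightarrow> (\<exists>y. Wvec a b n y \<and> norm (T i y) > K' * Wvec_norm a b n y)"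
      using bounded_lin_op_best_constant[OF T[of i]] by blast
    note K2 = K(2)[rule_format]
    have "6^k * Wvec_norm a b n y < K * Wvec_norm a b n y" using K2[OF y(1)] y(2) by simp
    then have K6: "K > 6^k" using Wvec_norm_nonneg[OF y(1)] mult_right_mono[of K "6^k" "Wvec_norm a b n y"] by force
    then have Kpos: "K > 0" using zero_less_power[of "6::real" k] by linarith
    obtain z where z: "Wvec a b n z" "norm (T i z) > (2/3 * K) * Wvec_norm a b n z"
      using K(3)[rule_format, of "2/3*K"] Kpos by auto
    have "Wvec_norm a b n z \<noteq> 0" using z(2) K2[OF z(1)] by auto
    then have pos: "Wvec_norm a b n z > 0" using Wvec_norm_nonneg[OF z(1)] by simp
    define c where "c = complex_of_real ((1/3)^k / Wvec_norm a b n z)"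
    have nc: "norm c = (1/3)^k / Wvec_norm a b n z" using pos by (simp add: c_def norm_divide norm_power)
    define d where "d = (\<lambda>t. c *s z t)"
    have "Wvec a b n d" unfolding d_def by (rule Wvec_scale[OF z(1)])
    moreover have "Wvec_norm a b n d \<le> (1/3)^k"
      using Wvec_norm_scale[OF z(1), of c] pos unfolding d_def nc by simp
    moreover have "norm (T i d) \<ge> (2/3) * K * (1/3)^k"
    proof -
      have "T i d = c *s T i z" unfolding d_def by (rule bounded_lin_op_scale[OF T z(1)])
      then have "norm (T i d) = norm c * norm (T i z)" by (simp add: norm_vec_def L2_set_right_distrib norm_mult)
      also have "\<dots> \<ge> norm c * ((2/3 * K) * Wvec_norm a b n z)"
        using z(2) by (intro mult_left_mono) auto
      finally show ?thesis using pos by (simp add: nc field_simps)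
    qed
    ultimately show ?thesis using K6 K(2) by (metis less_imp_le)
  qed
  then obtain i d K where d: "\<And>k. Wvec a b n (d k)" "\<And>k. Wvec_norm a b n (d k) \<le> (1/3)^k"
    and K: "\<And>k. K k \<ge> 6^k" "\<And>k y. Wvec a b n y \<Longrightarrow> norm (T (i k) y) \<le> K k * Wvec_norm a b n y"
    and Td: "\<And>k. norm (T (i k) (d k)) \<ge> (2/3) * K k * (1/3)^k"
    by metis
  define x where "x = rec_nat (\<lambda>t. 0) (\<lambda>k x. if norm (T (i k) (\<lambda>t. x t + d k t)) \<ge> norm (T (i k) (d k))
      then (\<lambda>t. x t + d k t) else (\<lambda>t. x t - d k t))"
  have x0: "x 0 = (\<lambda>t. 0)" by (simp add: x_def)
  have xS: "x (Suc k) = (if norm (T (i k) (\<lambda>t. x k t + d k t)) \<ge> norm (T (i k) (d k))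
      then (\<lambda>t. x k t + d k t) else (\<lambda>t. x k t - d k t))" for k
    unfolding x_def by simp
  have Wx: "Wvec a b n (x k)" for k
    by (induction k) (auto simp: x0 xS intro!: Wvec_zero Wvec_add Wvec_diff d(1))
  \<comment> \<open>The images of \<open>x + d\<close> and \<open>x - d\<close> differ by twice the
    image of \<open>d\<close>, so one of them is at least as large as the image of \<open>d\<close>;
    the recursion picks that one.\<close>
  have big: "norm (T (i k) (x (Suc k))) \<ge> norm (T (i k) (d k))" for k
  proof (cases "norm (T (i k) (\<lambda>t. x k t + d k t)) \<ge> norm (T (i k) (d k))")
    case False
    have "2 * norm (T (i k) (d k)) = norm (2 *\<^sub>R T (i k) (d k))" by simp
    also have "2 *\<^sub>R T (i k) (d k) = T (i k) (\<lambda>t. x k t + d k t) - T (i k) (\<lambda>t. x k t - d k t)"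
      by (simp add: bounded_lin_op_add[OF T Wx d(1)] bounded_lin_op_diff[OF T Wx d(1)] scaleR_2)
    also have "norm \<dots> \<le> norm (T (i k) (\<lambda>t. x k t + d k t)) + norm (T (i k) (\<lambda>t. x k t - d k t))"
      by (rule norm_triangle_ineq4)
    finally show ?thesis using False by (simp add: xS)
  qed (simp add: xS)
  \<comment> \<open>The increments are \<open>d\<close> or its negative and telescope to
    \<open>x\<close>, which brings completeness in series form into play.\<close>
  define e where "e = (\<lambda>k t. x (Suc k) t - x k t)"
  have We: "Wvec a b n (e k)" for k unfolding e_def by (rule Wvec_diff[OF Wx Wx])
  have Ne: "Wvec_norm a b n (e k) \<le> (1/3)^k" for k
  proof -
    have "e k = d k \<or> e k = (\<lambda>t. (-1) *s d k t)" unfolding e_def by (auto simp: xS vector_sneg_minus1[symmetric])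
    then show ?thesis using d(2)[of k] Wvec_norm_scale[OF d(1)[of k], of "-1"] by auto
  qed
  have esum: "(\<Sum>k<N. e k t) = x N t" for N t
    by (induction N) (simp_all add: x0 e_def)
  have "summable (\<lambda>k. Wvec_norm a b n (e k))"
    by (rule summable_comparison_test'[of "\<lambda>k. (1/3)^k" 0])
       (use Ne Wvec_norm_nonneg[OF We] in \<open>simp_all add: summable_geometric\<close>)
  from Wvec_complete[OF We this] obtain X where X: "Wvec a b n X"
    "(\<lambda>N. Wvec_norm a b n (\<lambda>t. X t - (\<Sum>k<N. e k t))) \<longlonglongrightarrow> 0"
    by (elim exE conjE)
  note X = X(1) X(2)[unfolded esum]
  \<comment> \<open>Finite geometric sums bound the distance between two partial sums; the limit
    then bounds the distance of \<open>X\<close> from each of them.\<close>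
  have fin: "Wvec_norm a b n (\<lambda>t. x (N + m) t - x N t) \<le> (3/2) * (1/3)^N * (1 - (1/3)^m)" for N m
  proof (induction m)
    case 0
    then show ?case by (simp add: Wvec_norm_zero)
  next
    case (Suc m)
    have "(\<lambda>t. x (N + Suc m) t - x N t) = (\<lambda>t. (x (N + m) t - x N t) + e (N + m) t)" by (simp add: e_def)
    then have "Wvec_norm a b n (\<lambda>t. x (N + Suc m) t - x N t)
        \<le> Wvec_norm a b n (\<lambda>t. x (N + m) t - x N t) + Wvec_norm a b n (e (N + m))"
      using Wvec_norm_add[OF Wvec_diff[OF Wx Wx] We] by simp
    also have "\<dots> \<le> (3/2) * (1/3)^N * (1 - (1/3)^m) + (1/3)^(N + m)" using Suc Ne add_mono by blast
    also have "\<dots> = (3/2) * (1/3)^N * (1 - (1/3)^Suc m)" by (simp add: power_add field_simps)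
    finally show ?case .
  qed
  have tail: "Wvec_norm a b n (\<lambda>t. X t - x N t) \<le> (3/2) * (1/3)^N" for N
  proof (rule LIMSEQ_le_const)
    show "(\<lambda>m. Wvec_norm a b n (\<lambda>t. X t - x (m + N) t) + (3/2) * (1/3)^N) \<longlonglongrightarrow> (3/2) * (1/3)^N"
      using tendsto_add[OF LIMSEQ_ignore_initial_segment[OF X(2), of N] tendsto_const[of "(3/2) * (1/3)^N"]] by simp
    show "\<exists>M. \<forall>m\<ge>M. Wvec_norm a b n (\<lambda>t. X t - x N t) \<le> Wvec_norm a b n (\<lambda>t. X t - x (m + N) t) + (3/2) * (1/3)^N"
    proof (intro exI[of _ 0] allI impI)
      fix m
      have "Wvec_norm a b n (\<lambda>t. (X t - x (m + N) t) + (x (N + m) t - x N t))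
          \<le> Wvec_norm a b n (\<lambda>t. X t - x (m + N) t) + Wvec_norm a b n (\<lambda>t. x (N + m) t - x N t)"
        by (intro Wvec_norm_add Wvec_diff X Wx)
      also have "Wvec_norm a b n (\<lambda>t. x (N + m) t - x N t) \<le> (3/2) * (1/3)^N"
        by (rule order_trans[OF fin]) (simp add: mult_left_le)
      finally show "Wvec_norm a b n (\<lambda>t. X t - x N t) \<le> Wvec_norm a b n (\<lambda>t. X t - x (m + N) t) + (3/2) * (1/3)^N"
        by (simp add: add.commute)
    qed
  qed
  have grow: "norm (T (i k) X) \<ge> (1/6) * 2^k" for k
  proof -
    have "T (i k) (x (Suc k)) = T (i k) X - T (i k) (\<lambda>t. X t - x (Suc k) t)"
      by (simp add: bounded_lin_op_diff[OF T X(1) Wx])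
    then have "norm (T (i k) (x (Suc k))) \<le> norm (T (i k) X) + norm (T (i k) (\<lambda>t. X t - x (Suc k) t))"
      by (simp only: norm_triangle_ineq4)
    moreover have "norm (T (i k) (\<lambda>t. X t - x (Suc k) t)) \<le> K k * ((3/2) * (1/3)^Suc k)"
      by (rule order_trans[OF K(2)[OF Wvec_diff[OF X(1) Wx]]])
         (use K(1)[of k] zero_le_power[of "6::real" k] in \<open>intro mult_left_mono tail; linarith\<close>)
    moreover have "K k * ((3/2) * (1/3)^Suc k) = (1/2) * (K k * (1/3)^k)" by simp
    ultimately have "norm (T (i k) X) \<ge> (1/6) * (K k * (1/3)^k)" using big[of k] Td[of k] by linarith
    moreover have "K k * (1/3)^k \<ge> 6^k * (1/3)^k" using K(1) by (intro mult_right_mono) auto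
    moreover have "(6::real)^k * (1/3)^k = 2^k" by (simp add: power_mult_distrib[symmetric])
    ultimately show ?thesis by linarith
  qed
  obtain C where C: "\<And>j. norm (T j X) \<le> C" using pw[OF X(1)] by blast
  obtain k where "6 * C < 2^k" using real_arch_pow[of 2 "6*C"] by auto
  then show False using grow[of k] C[of "i k"] by linarith
qed

end

subsection \<open>The integral form of the initial value problem\<close>

definition Wmat_norm :: "real \<Rightarrow> real \<Rightarrow> nat \<Rightarrow> (real \<Rightarrow> complex ^ 'm ^ 'm::finite) \<Rightarrow> real" where
  "Wmat_norm a b k A = (\<Sum>i\<in>UNIV. \<Sum>j\<in>UNIV. Wk_norm a b k (\<lambda>t. A t $ i $ j))"

text \<open>Volterra form of y' + A y = f. The initial value is read off from \<open>y\<close>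
  itself, so that one predicate serves initial and boundary value problems; regularity of
  \<open>y\<close> is stated separately.\<close>

definition solves_int :: "real \<Rightarrow> real \<Rightarrow> (real \<Rightarrow> complex ^ 'm ^ 'm) \<Rightarrow> (real \<Rightarrow> complex ^ 'm) \<Rightarrow> (real \<Rightarrow> complex ^ 'm::finite) \<Rightarrow> bool" where
  "solves_int a b A f y \<longleftrightarrow>
     (\<forall>i. \<forall>t\<in>{a..b}. y t $ i = y a $ i + integral {a..t} (\<lambda>s. (f s - A s *v y s) $ i))"

lemma solves_intD:
  "solves_int a b A f y \<Longrightarrow> \<forall>t\<in>{a..b}. y t $ i = y a $ i + integral {a..t} (\<lambda>s. (f s - A s *v y s) $ i)"
  unfolding solves_int_def by (rule spec)

text \<open>The norm of the remainder is at most the sum of the norms of its finitely many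
  components, each of which is negligible against the increment.\<close>

lemma has_vector_derivative_vecI:
  fixes y :: "real \<Rightarrow> complex ^ 'm::finite"
  assumes "\<And>i. ((\<lambda>t. y t $ i) has_vector_derivative (y' $ i)) (at t)"
  shows "(y has_vector_derivative y') (at t)"
  unfolding has_vector_derivative_def has_derivative_at
proof (intro conjI vec_tendstoI)
  show "bounded_linear (\<lambda>x. x *\<^sub>R y')" by (rule bounded_linear_scaleR_left)
  have "((\<lambda>h. norm ((y (t + h) - y t - h *\<^sub>R y')) / norm h) \<longlongrightarrow> 0) (at 0)"
  proof -
    have c: "((\<lambda>h. norm (y (t + h) $ i - y t $ i - h *\<^sub>R (y' $ i)) / norm h) \<longlongrightarrow> 0) (at 0)" for i
      using assms[of i] unfolding has_vector_derivative_def has_derivative_at by blast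
    have "((\<lambda>h. \<Sum>i\<in>UNIV. norm (y (t + h) $ i - y t $ i - h *\<^sub>R (y' $ i)) / norm h) \<longlongrightarrow> (\<Sum>i\<in>(UNIV::'m set). 0)) (at 0)"
      by (intro tendsto_sum c)
    then have lim: "((\<lambda>h. \<Sum>i\<in>UNIV. norm (y (t + h) $ i - y t $ i - h *\<^sub>R (y' $ i)) / norm h) \<longlongrightarrow> 0) (at 0)" by simp
    show ?thesis
    proof (rule Lim_null_comparison[OF always_eventually lim], rule allI)
      fix h
      have "norm (y (t + h) - y t - h *\<^sub>R y') \<le> (\<Sum>i\<in>UNIV. norm ((y (t + h) - y t - h *\<^sub>R y') $ i))"
        unfolding norm_vec_def by (rule L2_set_le_sum) simp
      then show "norm (norm (y (t + h) - y t - h *\<^sub>R y') / norm h)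
          \<le> (\<Sum>i\<in>UNIV. norm (y (t + h) $ i - y t $ i - h *\<^sub>R (y' $ i)) / norm h)"
        by (simp add: divide_right_mono flip: sum_divide_distrib)
    qed
  qed
  then show "((\<lambda>h. norm (y (t + h) - y t - h *\<^sub>R y') / norm h) \<longlongrightarrow> 0) (at 0)" .
qed

context interval begin

lemma WmatD: "Wmat a b k A \<Longrightarrow> Wk a b k (\<lambda>t. A t $ i $ j)"
  by (simp add: Wmat_def)

lemma Wmat_norm_nonneg: "Wmat a b k A \<Longrightarrow> Wmat_norm a b k A \<ge> 0"
  unfolding Wmat_norm_def by (intro sum_nonneg Wk_norm_nonneg WmatD)

lemma Wmat_Suc_mono:
  assumes "Wmat a b (Suc k) A"
  shows "Wmat a b k A" "Wmat_norm a b k A \<le> Wmat_norm a b (Suc k) A"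
proof -
  show "Wmat a b k A" unfolding Wmat_def using Wk_Suc_mono[OF WmatD[OF assms]] by simp
  show "Wmat_norm a b k A \<le> Wmat_norm a b (Suc k) A"
    unfolding Wmat_norm_def using Wk_Suc_mono[OF WmatD[OF assms]] by (intro sum_mono) simp
qed

lemma Wvec_Suc_mono:
  assumes "Wvec a b (Suc k) (y :: real \<Rightarrow> complex ^ 'm::finite)"
  shows "Wvec a b k y" "Wvec_norm a b k y \<le> Wvec_norm a b (Suc k) y"
proof -
  show "Wvec a b k y" by (rule WvecI) (simp add: Wk_Suc_mono[OF WvecD[OF assms]])
  show "Wvec_norm a b k y \<le> Wvec_norm a b (Suc k) y"
    unfolding Wvec_norm_def by (rule sum_mono) (simp add: Wk_Suc_mono[OF WvecD[OF assms]])
qed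

lemma Wmat_mult_vec:
  fixes A :: "real \<Rightarrow> complex ^ 'm ^ 'm::finite"
  assumes A: "Wmat a b k A" and y: "Wvec a b k y"
  shows "Wvec a b k (\<lambda>t. A t *v y t)"
    "Wvec_norm a b k (\<lambda>t. A t *v y t) \<le> 3 ^ k * Wmat_norm a b k A * Wvec_norm a b k y"
proof -
  have W: "Wk a b k (\<lambda>t. A t $ i $ j * y t $ j)" for i j by (rule Wk_mult'[OF WmatD[OF A] WvecD[OF y]])
  show "Wvec a b k (\<lambda>t. A t *v y t)"
    by (rule WvecI) (simp add: matrix_vector_mult_def Wk_sum(1) W)
  have "Wvec_norm a b k (\<lambda>t. A t *v y t) = (\<Sum>i\<in>UNIV. Wk_norm a b k (\<lambda>t. \<Sum>j\<in>UNIV. A t $ i $ j * y t $ j))"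
    by (simp add: Wvec_norm_def matrix_vector_mult_def)
  also have "\<dots> \<le> (\<Sum>i\<in>UNIV. \<Sum>j\<in>UNIV. 3 ^ k * Wk_norm a b k (\<lambda>t. A t $ i $ j) * Wvec_norm a b k y)"
  proof (rule sum_mono)
    fix i :: 'm
    have "Wk_norm a b k (\<lambda>t. \<Sum>j\<in>UNIV. A t $ i $ j * y t $ j) \<le> (\<Sum>j\<in>UNIV. Wk_norm a b k (\<lambda>t. A t $ i $ j * y t $ j))"
      by (rule Wk_sum(2)) (rule W)
    also have "\<dots> \<le> (\<Sum>j\<in>UNIV. 3 ^ k * Wk_norm a b k (\<lambda>t. A t $ i $ j) * Wvec_norm a b k y)"
    proof (rule sum_mono)
      fix j :: 'm
      have "Wk_norm a b k (\<lambda>t. A t $ i $ j * y t $ j) \<le> 3 ^ k * Wk_norm a b k (\<lambda>t. A t $ i $ j) * Wk_norm a b k (\<lambda>t. y t $ j)"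
        by (rule Wk_norm_mult[OF WmatD[OF A] WvecD[OF y]])
      also have "\<dots> \<le> 3 ^ k * Wk_norm a b k (\<lambda>t. A t $ i $ j) * Wvec_norm a b k y"
        by (intro mult_left_mono Wk_norm_le_Wvec_norm y) (simp add: Wk_norm_nonneg WmatD[OF A])
      finally show "Wk_norm a b k (\<lambda>t. A t $ i $ j * y t $ j) \<le> 3 ^ k * Wk_norm a b k (\<lambda>t. A t $ i $ j) * Wvec_norm a b k y" .
    qed
    finally show "Wk_norm a b k (\<lambda>t. \<Sum>j\<in>UNIV. A t $ i $ j * y t $ j)
        \<le> (\<Sum>j\<in>UNIV. 3 ^ k * Wk_norm a b k (\<lambda>t. A t $ i $ j) * Wvec_norm a b k y)" .
  qed
  also have "\<dots> = 3 ^ k * Wmat_norm a b k A * Wvec_norm a b k y"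
    by (simp add: Wmat_norm_def sum_distrib_left sum_distrib_right)
  finally show "Wvec_norm a b k (\<lambda>t. A t *v y t) \<le> 3 ^ k * Wmat_norm a b k A * Wvec_norm a b k y" .
qed

lemma Wvec_norm_minus_le:
  assumes "Wvec a b k y" "Wvec a b k z"
  shows "Wvec_norm a b k (\<lambda>t. y t - z t) \<le> Wvec_norm a b k y + Wvec_norm a b k z"
  unfolding Wvec_norm_def sum.distrib[symmetric] vector_minus_component
  by (rule sum_mono, rule Wk_norm_diff) (rule WvecD, rule assms)+

lemma Wvec_SucI:
  fixes y z :: "real \<Rightarrow> complex ^ 'm::finite"
  assumes z: "Wvec a b k z" and y: "\<And>i. \<forall>t\<in>{a..b}. y t $ i = c $ i + integral {a..t} (\<lambda>s. z s $ i)"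
  shows "Wvec a b (Suc k) y"
    "Wvec_norm a b (Suc k) y \<le> (\<Sum>i\<in>UNIV. norm (c $ i)) + (1 + (b - a)) * Wvec_norm a b k z"
proof -
  show "Wvec a b (Suc k) y" by (rule WvecI, rule Wk_SucI[OF WvecD[OF z] y])
  show "Wvec_norm a b (Suc k) y \<le> (\<Sum>i\<in>UNIV. norm (c $ i)) + (1 + (b - a)) * Wvec_norm a b k z"
    unfolding Wvec_norm_def sum_distrib_left sum.distrib[symmetric]
    by (rule sum_mono, rule Wk_norm_Suc_le[OF WvecD[OF z] y])
qed

lemma Wvec_norm_0_le:
  fixes y :: "real \<Rightarrow> complex ^ 'm::finite"
  assumes y: "Wvec a b 0 y" and C: "C \<ge> 0" "\<And>i t. t \<in> {a..b} \<Longrightarrow> norm (y t $ i) \<le> C"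
  shows "Wvec_norm a b 0 y \<le> real CARD('m) * C"
proof -
  have "Wk_norm a b 0 (\<lambda>t. y t $ i) \<le> C" for i
  proof -
    have L: "Linf a b (\<lambda>t. y t $ i)" using WvecD[OF y] by (simp add: Wk_0_iff)
    have "AE t in lebesgue. t \<in> {a..b} \<longrightarrow> norm (y t $ i) \<le> C" by (rule AE_I2) (use C(2) in blast)
    from Linf_norm_le[OF C(1) this] show ?thesis unfolding Wk_norm_0[OF L] .
  qed
  then have "Wvec_norm a b 0 y \<le> (\<Sum>i\<in>(UNIV::'m set). C)" unfolding Wvec_norm_def by (rule sum_mono)
  then show ?thesis by simp
qed

text \<open>Each pass through the integral equation gains one order: if \<open>y\<close> is as
  smooth as \<open>A\<close> and \<open>f\<close>, so is the integrand f - A y, and \<open>y\<close>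
  is a primitive of it.\<close>

lemma solves_int_bootstrap:
  fixes y :: "real \<Rightarrow> complex ^ 'm::finite"
  assumes "solves_int a b A f y" "Wvec a b 0 y" "Wmat a b k A" "Wvec a b k f"
  shows "Wvec a b (Suc k) y"
  using assms(3,4)
proof (induction k)
  case 0
  have "Wvec a b 0 (\<lambda>s. f s - A s *v y s)" by (intro Wvec_diff Wmat_mult_vec(1) 0 assms)
  then show ?case by (rule Wvec_SucI(1)[OF _ solves_intD[OF assms(1)]])
next
  case (Suc k)
  have "Wvec a b (Suc k) y" by (rule Suc.IH[OF Wmat_Suc_mono(1)[OF Suc.prems(1)] Wvec_Suc_mono(1)[OF Suc.prems(2)]])
  then have "Wvec a b (Suc k) (\<lambda>s. f s - A s *v y s)" by (intro Wvec_diff Wmat_mult_vec(1) Suc.prems)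
  then show ?case by (rule Wvec_SucI(1)[OF _ solves_intD[OF assms(1)]])
qed

text \<open>Halving in the weighted norm with weight $e^{-2M(t-a)}$: it makes the Picard iteration
  contract on the whole interval.\<close>

lemma weighted_integral_bound:
  fixes A :: "real \<Rightarrow> complex ^ 'm ^ 'm::finite"
  assumes A: "Wmat a b 0 A" and y: "Wvec a b 0 y" and M: "M > 0" "Wmat_norm a b 0 A \<le> M"
    and C: "C \<ge> 0" "\<And>j s. s \<in> {a..b} \<Longrightarrow> norm (y s $ j) \<le> C * exp (2 * M * (s - a))" and t: "t \<in> {a..b}"
  shows "(\<Sum>i\<in>UNIV. norm (integral {a..t} (\<lambda>s. (A s *v y s) $ i))) \<le> C / 2 * exp (2 * M * (t - a))"
proof -
  define N where "N = (\<lambda>i. \<Sum>j\<in>UNIV. Wk_norm a b 0 (\<lambda>t. A t $ i $ j))"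
  have WN: "Wmat_norm a b 0 A = (\<Sum>i\<in>UNIV. N i)" by (simp add: Wmat_norm_def N_def)
  have Nn: "N i \<ge> 0" for i unfolding N_def by (intro sum_nonneg Wk_norm_nonneg WmatD A)
  \<comment> \<open>Integrating the weight gains 1 / (2 * M), the coefficient norm costs at most
    \<open>M\<close>; their product is the factor 1/2.\<close>
  have E: "((\<lambda>s. exp (2 * M * (s - a))) has_integral (exp (2 * M * (t - a)) / (2 * M) - exp (2 * M * (a - a)) / (2 * M))) {a..t}"
  proof (rule fundamental_theorem_of_calculus)
    show "a \<le> t" using t by simp
    fix x
    show "((\<lambda>s. exp (2 * M * (s - a)) / (2 * M)) has_vector_derivative exp (2 * M * (x - a))) (at x within {a..t})"
      unfolding has_real_derivative_iff_has_vector_derivative[symmetric]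
      by (auto intro!: derivative_eq_intros simp: M(1)[THEN less_imp_neq, symmetric])
  qed
  have "norm (integral {a..t} (\<lambda>s. (A s *v y s) $ i)) \<le> N i * C * (exp (2 * M * (t - a)) / (2 * M))" for i
  proof -
    have Ay: "Linf a b (\<lambda>s. (A s *v y s) $ i)" using WvecD[OF Wmat_mult_vec(1)[OF A y]] by (simp add: Wk_0_iff)
    have "norm (integral {a..t} (\<lambda>s. (A s *v y s) $ i)) \<le> integral {a..t} (\<lambda>s. N i * C * exp (2 * M * (s - a)))"
    proof (rule integral_norm_bound_AE)
      show "(\<lambda>s. (A s *v y s) $ i) integrable_on {a..t}" by (rule Linf_integrable[OF Ay]) (use t in simp_all)
      show "(\<lambda>s. N i * C * exp (2 * M * (s - a))) integrable_on {a..t}"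
        by (rule integrable_on_mult_right[OF has_integral_integrable[OF E]])
      have "AE s in lebesgue. s \<in> {a..b} \<longrightarrow> norm (A s $ i $ j) \<le> Wk_norm a b 0 (\<lambda>t. A t $ i $ j)" for j
        using Linf_norm_AE[of a b "\<lambda>t. A t $ i $ j"] WmatD[OF A, of i j] by (simp add: Wk_0_iff Wk_norm_0)
      then have "AE s in lebesgue. \<forall>j\<in>UNIV. s \<in> {a..b} \<longrightarrow> norm (A s $ i $ j) \<le> Wk_norm a b 0 (\<lambda>t. A t $ i $ j)"
        by (intro AE_finite_allI) auto
      then show "AE s in lebesgue. s \<in> {a..t} \<longrightarrow> norm ((A s *v y s) $ i) \<le> N i * C * exp (2 * M * (s - a))"
      proof eventually_elim
        case (elim s)
        show ?case
        proof
          assume "s \<in> {a..t}"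
          then have s: "s \<in> {a..b}" using t by auto
          have "norm ((A s *v y s) $ i) \<le> (\<Sum>j\<in>UNIV. norm (A s $ i $ j * y s $ j))"
            unfolding matrix_vector_mult_def vec_lambda_beta by (rule norm_sum)
          also have "\<dots> \<le> (\<Sum>j\<in>UNIV. Wk_norm a b 0 (\<lambda>t. A t $ i $ j) * (C * exp (2 * M * (s - a))))"
            unfolding norm_mult
            by (intro sum_mono mult_mono C(2) s) (use elim s in \<open>auto simp: Wk_norm_nonneg WmatD[OF A]\<close>)
          finally show "norm ((A s *v y s) $ i) \<le> N i * C * exp (2 * M * (s - a))"
            by (simp add: N_def sum_distrib_right mult.assoc)
        qed
      qed
    qed
    also have "\<dots> = N i * C * ((exp (2 * M * (t - a)) - 1) / (2 * M))"
      using integral_unique[OF E] by (simp add: diff_divide_distrib)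
    also have "\<dots> \<le> N i * C * (exp (2 * M * (t - a)) / (2 * M))"
      using Nn[of i] C(1) M(1) by (intro mult_left_mono divide_right_mono) auto
    finally show ?thesis .
  qed
  then have "(\<Sum>i\<in>UNIV. norm (integral {a..t} (\<lambda>s. (A s *v y s) $ i))) \<le> (\<Sum>i\<in>UNIV. N i * C * (exp (2 * M * (t - a)) / (2 * M)))"
    by (rule sum_mono)
  also have "\<dots> = Wmat_norm a b 0 A * (C * (exp (2 * M * (t - a)) / (2 * M)))"
    by (simp only: WN sum_distrib_right mult.assoc)
  also have "\<dots> \<le> M * (C * (exp (2 * M * (t - a)) / (2 * M)))"
    using M C(1) by (intro mult_right_mono) auto
  also have "\<dots> = C / 2 * exp (2 * M * (t - a))" using M by simp
  finally show ?thesis .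
qed

end

section \<open>A priori estimate and existence for the initial value problem\<close>

context interval begin

text \<open>Gronwall by maximum: at a point \<open>r\<close> where the weighted sum of moduli is
  largest, the term containing \<open>A\<close> is at most half of the left-hand side. Absorbing it
  doubles the constant.\<close>

lemma solves_int_weighted_bound:
  fixes A :: "real \<Rightarrow> complex ^ 'm ^ 'm::finite"
  assumes sol: "solves_int a b A g w" and A: "Wmat a b 0 A" and g: "Wvec a b 0 g" and w: "Wvec a b 1 w"
    and M: "M > 0" "Wmat_norm a b 0 A \<le> M" and t: "t \<in> {a..b}"
  shows "(\<Sum>i\<in>UNIV. norm (w t $ i)) \<le>
    2 * ((\<Sum>i\<in>UNIV. norm (w a $ i)) + (b - a) * Wvec_norm a b 0 g) * exp (2 * M * (t - a))"
proof -
  define \<alpha> where "\<alpha> = (\<Sum>i\<in>UNIV. norm (w a $ i)) + (b - a) * Wvec_norm a b 0 g"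
  define \<phi> where "\<phi> = (\<lambda>t. \<Sum>i\<in>UNIV. norm (w t $ i))"
  define \<psi> where "\<psi> = (\<lambda>t. \<phi> t * exp (- (2 * M * (t - a))))"
  have w0: "Wvec a b 0 w" using Wvec_Suc_mono(1)[of 0 w] w by simp
  have "continuous_on {a..b} (\<lambda>t. w t $ i)" for i
    using Wk_continuous_on[of 0] WvecD[OF w] by simp
  then have "continuous_on {a..b} \<phi>" unfolding \<phi>_def by (intro continuous_on_sum continuous_on_norm)
  then have "continuous_on {a..b} \<psi>" unfolding \<psi>_def by (rule continuous_on_mult) (intro continuous_intros)
  then obtain r where r: "r \<in> {a..b}" "\<And>s. s \<in> {a..b} \<Longrightarrow> \<psi> s \<le> \<psi> r"
    using continuous_attains_sup[of "{a..b}" \<psi>] ab by auto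
  have \<phi>0: "\<phi> s \<ge> 0" for s unfolding \<phi>_def by (intro sum_nonneg) simp
  have \<psi>0: "\<psi> r \<ge> 0" unfolding \<psi>_def using \<phi>0 by simp
  have \<phi>le: "\<phi> s \<le> \<psi> r * exp (2 * M * (s - a))" if s: "s \<in> {a..b}" for s
  proof -
    have "\<phi> s = \<psi> s * exp (2 * M * (s - a))" by (simp add: \<psi>_def mult.assoc flip: exp_add)
    also have "\<dots> \<le> \<psi> r * exp (2 * M * (s - a))" using r(2)[OF s] by (intro mult_right_mono) auto
    finally show ?thesis .
  qed
  have comp: "norm (w s $ j) \<le> \<psi> r * exp (2 * M * (s - a))" if s: "s \<in> {a..b}" for j s
  proof -
    have "norm (w s $ j) \<le> \<phi> s" unfolding \<phi>_def by (rule member_le_sum) auto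
    then show ?thesis using \<phi>le[OF s] by simp
  qed
  have Aw: "Wvec a b 0 (\<lambda>s. A s *v w s)" by (rule Wmat_mult_vec(1)[OF A w0])
  have int: "(\<lambda>s. g s $ i) integrable_on {a..r}" "(\<lambda>s. (A s *v w s) $ i) integrable_on {a..r}" for i
    using Linf_integrable[OF Wk_Linf[OF WvecD[OF g]], of a r i] Linf_integrable[OF Wk_Linf[OF WvecD[OF Aw]], of a r i] r(1)
    by simp_all
  have "norm (w r $ i) \<le> norm (w a $ i) + (b - a) * Wk_norm a b 0 (\<lambda>s. g s $ i) + norm (integral {a..r} (\<lambda>s. (A s *v w s) $ i))" for i
  proof -
    have "w r $ i = w a $ i + integral {a..r} (\<lambda>s. (g s - A s *v w s) $ i)"
      by (rule bspec[OF solves_intD[OF sol] r(1)])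
    also have "\<dots> = w a $ i + integral {a..r} (\<lambda>s. g s $ i) - integral {a..r} (\<lambda>s. (A s *v w s) $ i)"
      using int by (simp add: integral_diff)
    also have "norm \<dots> \<le> norm (w a $ i) + norm (integral {a..r} (\<lambda>s. g s $ i)) + norm (integral {a..r} (\<lambda>s. (A s *v w s) $ i))"
      by (rule order_trans[OF norm_triangle_ineq4 add_right_mono[OF norm_triangle_ineq]])
    also have "norm (integral {a..r} (\<lambda>s. g s $ i)) \<le> (b - a) * Wk_norm a b 0 (\<lambda>s. g s $ i)"
    proof -
      have "norm (integral {a..r} (\<lambda>s. g s $ i)) \<le> Linf_norm a b (\<lambda>s. g s $ i) * (r - a)"
        using Linf_integral_bound[OF Wk_Linf[OF WvecD[OF g]], of a r i] r(1) by simp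
      also have "\<dots> \<le> Wk_norm a b 0 (\<lambda>s. g s $ i) * (b - a)"
        using r(1) Linf_norm_le_Wk_norm[OF WvecD[OF g]] Wk_norm_nonneg[OF WvecD[OF g]] by (intro mult_mono) auto
      finally show ?thesis by (simp add: mult.commute)
    qed
    finally show ?thesis by simp
  qed
  then have "\<phi> r \<le> (\<Sum>i\<in>UNIV. norm (w a $ i) + (b - a) * Wk_norm a b 0 (\<lambda>s. g s $ i) + norm (integral {a..r} (\<lambda>s. (A s *v w s) $ i)))"
    unfolding \<phi>_def by (rule sum_mono)
  also have "\<dots> = \<alpha> + (\<Sum>i\<in>UNIV. norm (integral {a..r} (\<lambda>s. (A s *v w s) $ i)))"
    by (simp add: \<alpha>_def Wvec_norm_def sum.distrib sum_distrib_left)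
  also have "\<dots> \<le> \<alpha> + \<psi> r / 2 * exp (2 * M * (r - a))"
    using weighted_integral_bound[OF A w0 M \<psi>0 comp r(1)] by simp
  finally have 1: "\<phi> r \<le> \<alpha> + \<psi> r / 2 * exp (2 * M * (r - a))" .
  have \<alpha>0: "\<alpha> \<ge> 0" unfolding \<alpha>_def using ab Wvec_norm_nonneg[OF g] by (intro add_nonneg_nonneg sum_nonneg) auto
  have "\<phi> r = \<psi> r * exp (2 * M * (r - a))" by (simp add: \<psi>_def mult.assoc flip: exp_add)
  then have "\<psi> r * exp (2 * M * (r - a)) \<le> 2 * \<alpha>" using 1 by simp
  moreover have "\<psi> r * 1 \<le> \<psi> r * exp (2 * M * (r - a))"
    using \<psi>0 M(1) r(1) by (intro mult_left_mono) auto
  ultimately have "\<psi> r \<le> 2 * \<alpha>" by simp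
  then have "\<psi> r * exp (2 * M * (t - a)) \<le> 2 * \<alpha> * exp (2 * M * (t - a))" by (intro mult_right_mono) auto
  from order_trans[OF \<phi>le[OF t] this] show ?thesis unfolding \<phi>_def \<alpha>_def .
qed

text \<open>\<open>C\<close> is the same for all coefficients of norm at most \<open>M\<close>;
  continuity in the parameter rests on this uniformity. The Gronwall bound starts an induction in
  which the equation lifts a bound for \<open>w\<close> from order \<open>k\<close> to order
  \<open>k + 1\<close>.\<close>

theorem solves_int_estimate:
  assumes M: "M > 0"
  shows "\<exists>C\<ge>0. \<forall>(A :: real \<Rightarrow> complex ^ 'm ^ 'm::finite) g w.
     solves_int a b A g w \<longrightarrow> Wmat a b k A \<longrightarrow> Wmat_norm a b k A \<le> M \<longrightarrow> Wvec a b k g \<longrightarrow> Wvec a b (Suc k) w \<longrightarrow>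
     Wvec_norm a b (Suc k) w \<le> C * ((\<Sum>i\<in>UNIV. norm (w a $ i)) + Wvec_norm a b k g)"
proof -
  \<comment> \<open>The derivative g - A w is estimated with the product constant
    \<open>3 ^ k\<close>; the final summand 1 pays for the initial value.\<close>
  have step: "Wvec_norm a b (Suc k) w \<le> ((1 + (b - a)) * (1 + 3 ^ k * M * C) + 1) * ((\<Sum>i\<in>UNIV. norm (w a $ i)) + Wvec_norm a b k g)"
    if "solves_int a b A g w" and A: "Wmat a b k A" "Wmat_norm a b k A \<le> M" and g: "Wvec a b k g" and w: "Wvec a b (Suc k) w"
      and C: "C \<ge> 0" "Wvec_norm a b k w \<le> C * ((\<Sum>i\<in>UNIV. norm (w a $ i)) + Wvec_norm a b k g)"
    for A :: "real \<Rightarrow> complex ^ 'm ^ 'm" and g w k C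
  proof -
    define P where "P = (\<Sum>i\<in>UNIV. norm (w a $ i))"
    define X where "X = P + Wvec_norm a b k g"
    have P: "P \<ge> 0" unfolding P_def by (intro sum_nonneg) simp
    have g0: "Wvec_norm a b k g \<ge> 0" by (rule Wvec_norm_nonneg[OF g])
    note w' = Wvec_Suc_mono(1)[OF w]
    note Aw = Wmat_mult_vec[OF A(1) w']
    have "Wvec_norm a b (Suc k) w \<le> P + (1 + (b - a)) * Wvec_norm a b k (\<lambda>s. g s - A s *v w s)"
      unfolding P_def by (rule Wvec_SucI(2)[OF Wvec_diff[OF g Aw(1)] solves_intD[OF that(1)]])
    also have "Wvec_norm a b k (\<lambda>s. g s - A s *v w s) \<le> Wvec_norm a b k g + Wvec_norm a b k (\<lambda>s. A s *v w s)"
      by (rule Wvec_norm_minus_le[OF g Aw(1)])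
    also have "Wvec_norm a b k (\<lambda>s. A s *v w s) \<le> 3 ^ k * Wmat_norm a b k A * Wvec_norm a b k w" by (rule Aw(2))
    also have "\<dots> \<le> 3 ^ k * M * (C * X)"
      using A(2) C M Wmat_norm_nonneg[OF A(1)] Wvec_norm_nonneg[OF w'] unfolding X_def P_def
      by (intro mult_mono) auto
    also have "Wvec_norm a b k g \<le> X" using P by (simp add: X_def)
    also have "P \<le> X" using g0 by (simp add: X_def)
    finally have "Wvec_norm a b (Suc k) w \<le> X + (1 + (b - a)) * (X + 3 ^ k * M * (C * X))" using ab by simp
    also have "\<dots> = ((1 + (b - a)) * (1 + 3 ^ k * M * C) + 1) * X" by (simp add: algebra_simps)
    finally show ?thesis unfolding X_def P_def .
  qed
  show ?thesis
  proof (induction k)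
    case 0
    \<comment> \<open>The weighted bound taken with its largest weight, the one at \<open>b\<close>,
      and multiplied by the number of components.\<close>
    define C where "C = real CARD('m) * (2 * (1 + (b - a)) * exp (2 * M * (b - a)))"
    have C0: "C \<ge> 0" using ab by (simp add: C_def)
    show ?case
    proof (intro exI[of _ "(1 + (b - a)) * (1 + 3 ^ 0 * M * C) + 1"] conjI allI impI)
      show "(1 + (b - a)) * (1 + 3 ^ 0 * M * C) + 1 \<ge> 0" using ab M C0 by simp
      fix A :: "real \<Rightarrow> complex ^ 'm ^ 'm" and g w
      assume sol: "solves_int a b A g w" and A: "Wmat a b 0 A" "Wmat_norm a b 0 A \<le> M" and g: "Wvec a b 0 g" and w: "Wvec a b (Suc 0) w"
      define P where "P = (\<Sum>i\<in>UNIV. norm (w a $ i))"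
      have P: "P \<ge> 0" unfolding P_def by (intro sum_nonneg) simp
      have g0: "Wvec_norm a b 0 g \<ge> 0" by (rule Wvec_norm_nonneg[OF g])
      have "norm (w t $ i) \<le> 2 * ((1 + (b - a)) * (P + Wvec_norm a b 0 g)) * exp (2 * M * (b - a))" if t: "t \<in> {a..b}" for t i
      proof -
        have "norm (w t $ i) \<le> (\<Sum>i\<in>UNIV. norm (w t $ i))" by (rule member_le_sum) auto
        also have "\<dots> \<le> 2 * (P + (b - a) * Wvec_norm a b 0 g) * exp (2 * M * (t - a))"
          unfolding P_def by (rule solves_int_weighted_bound[OF sol A(1) g _ M A(2) t]) (use w in simp)
        also have "\<dots> \<le> 2 * ((1 + (b - a)) * (P + Wvec_norm a b 0 g)) * exp (2 * M * (b - a))"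
        proof (intro mult_mono)
          show "P + (b - a) * Wvec_norm a b 0 g \<le> (1 + (b - a)) * (P + Wvec_norm a b 0 g)"
            using g0 mult_nonneg_nonneg[of "b - a" P] P ab by (simp add: distrib_left distrib_right)
        qed (use P g0 ab M t in auto)
        finally show ?thesis .
      qed
      then have "Wvec_norm a b 0 w \<le> real CARD('m) * (2 * ((1 + (b - a)) * (P + Wvec_norm a b 0 g)) * exp (2 * M * (b - a)))"
        using P g0 ab by (intro Wvec_norm_0_le Wvec_Suc_mono(1)[OF w]) auto
      also have "\<dots> = C * (P + Wvec_norm a b 0 g)" by (simp add: C_def mult_ac)
      finally show "Wvec_norm a b (Suc 0) w \<le> ((1 + (b - a)) * (1 + 3 ^ 0 * M * C) + 1) * ((\<Sum>i\<in>UNIV. norm (w a $ i)) + Wvec_norm a b 0 g)"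
        unfolding P_def by (rule step[OF sol A g w C0])
    qed
  next
    case (Suc k)
    then obtain C where C: "C \<ge> 0" "\<And>(A :: real \<Rightarrow> complex ^ 'm ^ 'm) g w.
       solves_int a b A g w \<Longrightarrow> Wmat a b k A \<Longrightarrow> Wmat_norm a b k A \<le> M \<Longrightarrow> Wvec a b k g \<Longrightarrow> Wvec a b (Suc k) w \<Longrightarrow>
       Wvec_norm a b (Suc k) w \<le> C * ((\<Sum>i\<in>UNIV. norm (w a $ i)) + Wvec_norm a b k g)"
      by metis
    show ?case
    proof (intro exI[of _ "(1 + (b - a)) * (1 + 3 ^ Suc k * M * C) + 1"] conjI allI impI)
      show "(1 + (b - a)) * (1 + 3 ^ Suc k * M * C) + 1 \<ge> 0" using ab M C(1) by simp
      fix A :: "real \<Rightarrow> complex ^ 'm ^ 'm" and g w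
      assume sol: "solves_int a b A g w" and A: "Wmat a b (Suc k) A" "Wmat_norm a b (Suc k) A \<le> M"
        and g: "Wvec a b (Suc k) g" and w: "Wvec a b (Suc (Suc k)) w"
      have "Wvec_norm a b (Suc k) w \<le> C * ((\<Sum>i\<in>UNIV. norm (w a $ i)) + Wvec_norm a b k g)"
        by (rule C(2)[OF sol Wmat_Suc_mono(1)[OF A(1)] order_trans[OF Wmat_Suc_mono(2)[OF A(1)] A(2)]
              Wvec_Suc_mono(1)[OF g] Wvec_Suc_mono(1)[OF w]])
      also have "\<dots> \<le> C * ((\<Sum>i\<in>UNIV. norm (w a $ i)) + Wvec_norm a b (Suc k) g)"
        using Wvec_Suc_mono(2)[OF g] C(1) by (intro mult_left_mono) auto
      finally show "Wvec_norm a b (Suc (Suc k)) w \<le> ((1 + (b - a)) * (1 + 3 ^ Suc k * M * C) + 1) *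
          ((\<Sum>i\<in>UNIV. norm (w a $ i)) + Wvec_norm a b (Suc k) g)"
        by (rule step[OF sol A g w C(1)])
    qed
  qed
qed


lemma Wvec_imp_Wvec_0: "Wvec a b k y \<Longrightarrow> Wvec a b 0 y"
  by (rule WvecI) (simp add: Wk_0_iff Wk_Linf[OF WvecD])

lemma Wmat_imp_Wmat_0: "Wmat a b k A \<Longrightarrow> Wmat a b 0 A"
  unfolding Wmat_def by (auto simp: Wk_0_iff intro: Wk_Linf)

lemma norm_component_le_Wvec_norm:
  fixes y :: "real \<Rightarrow> complex ^ 'm::finite"
  assumes y: "Wvec a b (Suc k) y" and t: "t \<in> {a..b}"
  shows "norm (y t $ i) \<le> Wvec_norm a b (Suc k) y"
  by (rule order_trans[OF norm_le_Wk_norm[OF WvecD[OF y] t] Wk_norm_le_Wvec_norm[OF y]])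

lemma norm_integral_component_le:
  fixes z :: "real \<Rightarrow> complex ^ 'm::finite"
  assumes z: "Wvec a b 0 z" and t: "t \<in> {a..b}"
  shows "norm (integral {a..t} (\<lambda>s. z s $ i)) \<le> (b - a) * Wvec_norm a b 0 z"
proof -
  have "norm (integral {a..t} (\<lambda>s. z s $ i)) \<le> Linf_norm a b (\<lambda>s. z s $ i) * (t - a)"
    using Linf_integral_bound[OF Wk_Linf[OF WvecD[OF z]], of a t i] t by simp
  also have "\<dots> \<le> Wvec_norm a b 0 z * (b - a)"
    using t Linf_norm_le_Wk_norm[OF WvecD[OF z], of i] Wk_norm_le_Wvec_norm[OF z, of i] Wvec_norm_nonneg[OF z]
    by (intro mult_mono) auto
  finally show ?thesis by (simp add: mult.commute)
qed

lemma Wvec_component_integrable: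
  fixes z :: "real \<Rightarrow> complex ^ 'm::finite"
  assumes "Wvec a b 0 z" "t \<in> {a..b}"
  shows "(\<lambda>s. z s $ i) integrable_on {a..t}"
  by (rule Linf_integrable[OF Wk_Linf[OF WvecD[OF assms(1)]]]) (use assms(2) in simp_all)

text \<open>Picard iteration written as a series whose terms are halved in the weighted supremum
  norm. The limit is taken in order 1 only; the integral equation then raises its regularity to
  order \<open>Suc k\<close>.\<close>

theorem solves_int_exists:
  fixes A :: "real \<Rightarrow> complex ^ 'm ^ 'm::finite"
  assumes Ak: "Wmat a b k A" and fk: "Wvec a b k f"
  shows "\<exists>y. Wvec a b (Suc k) y \<and> solves_int a b A f y \<and> y a = q"
proof -
  note A = Wmat_imp_Wmat_0[OF Ak] and f = Wvec_imp_Wvec_0[OF fk]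
  define M where "M = Wmat_norm a b 0 A + 1"
  have M: "M > 0" "Wmat_norm a b 0 A \<le> M" using Wmat_norm_nonneg[OF A] by (auto simp: M_def)
  \<comment> \<open>These are the corrections, not the iterates: the zeroth term carries the initial
    value and the forcing, each further one is minus the integral of \<open>A\<close> times its
    predecessor.\<close>
  define Y where "Y = rec_nat (\<lambda>t. \<chi> i. q $ i + integral {a..t} (\<lambda>s. f s $ i))
      (\<lambda>_ y t. \<chi> i. integral {a..t} (\<lambda>s. (0 - A s *v y s) $ i))"
  have Y0: "Y 0 t $ i = q $ i + integral {a..t} (\<lambda>s. f s $ i)" for t i by (simp add: Y_def)
  have YS: "Y (Suc k) t $ i = integral {a..t} (\<lambda>s. (0 - A s *v Y k s) $ i)" for k t i by (simp add: Y_def)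
  have YS': "\<forall>t\<in>{a..b}. Y (Suc k) t $ i = 0 $ i + integral {a..t} (\<lambda>s. (0 - A s *v Y k s) $ i)" for k i
    by (simp add: YS)
  have W1: "Wvec a b (Suc 0) (Y k)" and W0: "Wvec a b 0 (Y k)" for k
  proof (induction k)
    case 0
    {
      case 1
      show ?case by (rule Wvec_SucI(1)[OF f, of _ q]) (simp add: Y0)
      then show "Wvec a b 0 (Y 0)" by (rule Wvec_Suc_mono(1))
    }
  next
    case (Suc k)
    {
      case 1
      show ?case by (rule Wvec_SucI(1)[OF _ YS']) (intro Wvec_diff Wvec_zero Wmat_mult_vec(1)[OF A] Suc)
      then show "Wvec a b 0 (Y (Suc k))" by (rule Wvec_Suc_mono(1))
    }
  qed
  define K where "K = Wvec_norm a b (Suc 0) (Y 0)"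
  have K0: "K \<ge> 0" unfolding K_def by (rule Wvec_norm_nonneg[OF W1])
  have bound: "norm (Y k t $ j) \<le> K / 2 ^ k * exp (2 * M * (t - a))" if "t \<in> {a..b}" for k t j
    using that
  proof (induction k arbitrary: t j)
    case 0
    have "norm (Y 0 t $ j) \<le> K * 1" unfolding K_def using norm_component_le_Wvec_norm[OF W1 0] by simp
    also have "\<dots> \<le> K * exp (2 * M * (t - a))" using K0 M(1) 0 by (intro mult_left_mono) auto
    finally show ?case by simp
  next
    case (Suc k)
    have "norm (Y (Suc k) t $ j) = norm (integral {a..t} (\<lambda>s. (A s *v Y k s) $ j))"
      by (simp add: YS)
    also have "\<dots> \<le> (\<Sum>i\<in>UNIV. norm (integral {a..t} (\<lambda>s. (A s *v Y k s) $ i)))"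
      by (rule member_le_sum) auto
    also have "\<dots> \<le> (K / 2 ^ k) / 2 * exp (2 * M * (t - a))"
      by (rule weighted_integral_bound[OF A W0 M _ Suc.IH Suc.prems]) (use K0 in auto)
    finally show ?case by (simp add: mult.commute)
  qed
  define E where "E = real CARD('m) * (K * exp (2 * M * (b - a)))"
  have N0: "Wvec_norm a b 0 (Y k) \<le> E * (1 / 2) ^ k" for k
  proof -
    have "Wvec_norm a b 0 (Y k) \<le> real CARD('m) * (K / 2 ^ k * exp (2 * M * (b - a)))"
    proof (rule Wvec_norm_0_le[OF W0])
      fix i t assume t: "t \<in> {a..b}"
      have "K / 2 ^ k * exp (2 * M * (t - a)) \<le> K / 2 ^ k * exp (2 * M * (b - a))"
        using t K0 M(1) by (intro mult_left_mono) auto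
      then show "norm (Y k t $ i) \<le> K / 2 ^ k * exp (2 * M * (b - a))" using bound[OF t, of k i] by linarith
    qed (use K0 in simp)
    then show ?thesis by (simp add: E_def power_divide)
  qed
  have AY: "Wvec_norm a b 0 (\<lambda>s. A s *v y s) \<le> M * Wvec_norm a b 0 y" if y: "Wvec a b 0 y" for y
  proof -
    have "Wvec_norm a b 0 (\<lambda>s. A s *v y s) \<le> Wmat_norm a b 0 A * Wvec_norm a b 0 y"
      using Wmat_mult_vec(2)[OF A y] by simp
    then show ?thesis using mult_right_mono[OF M(2) Wvec_norm_nonneg[OF y]] by simp
  qed
  \<comment> \<open>The recursion itself turns decay of the supremum into decay in order 1, and
    convergence in order 1 controls the values at every point.\<close>
  have N1: "Wvec_norm a b (Suc 0) (Y (Suc k)) \<le> (1 + (b - a)) * M * E * (1 / 2) ^ k" for k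
  proof -
    note AW = Wmat_mult_vec(1)[OF A W0[of k]]
    have "Wvec_norm a b (Suc 0) (Y (Suc k)) \<le> (\<Sum>i\<in>(UNIV::'m set). norm (0 $ i :: complex)) + (1 + (b - a)) * Wvec_norm a b 0 (\<lambda>s. 0 - A s *v Y k s)"
      by (rule Wvec_SucI(2)[OF Wvec_diff[OF Wvec_zero AW] YS'])
    also have "Wvec_norm a b 0 (\<lambda>s. 0 - A s *v Y k s) \<le> M * (E * (1 / 2) ^ k)"
      using Wvec_norm_minus_le[OF Wvec_zero AW] AY[OF W0[of k]] mult_left_mono[OF N0[of k] less_imp_le[OF M(1)]]
      unfolding Wvec_norm_zero by linarith
    finally show ?thesis using ab by (simp add: mult.assoc)
  qed
  have "summable (\<lambda>k. Wvec_norm a b (Suc 0) (Y (Suc k)))"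
    by (rule summable_comparison_test'[of "\<lambda>k. (1 + (b - a)) * M * E * (1 / 2) ^ k" 0])
       (use N1 Wvec_norm_nonneg[OF W1] in \<open>simp_all add: summable_mult summable_geometric\<close>)
  then have "summable (\<lambda>k. Wvec_norm a b (Suc 0) (Y k))" by (subst (asm) summable_Suc_iff)
  from Wvec_complete[OF W1 this] obtain X where X: "Wvec a b (Suc 0) X"
    "(\<lambda>N. Wvec_norm a b (Suc 0) (\<lambda>t. X t - (\<Sum>k<N. Y k t))) \<longlonglongrightarrow> 0"
    by (elim exE conjE)
  define S where "S = (\<lambda>N t. \<Sum>k<N. Y k t)"
  have SW1: "Wvec a b (Suc 0) (S N)" for N unfolding S_def by (intro Wvec_sum W1)
  have SW0: "Wvec a b 0 (S N)" for N by (rule Wvec_Suc_mono(1)[OF SW1])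
  have XW0: "Wvec a b 0 X" by (rule Wvec_Suc_mono(1)[OF X(1)])
  note AW = Wmat_mult_vec(1)[OF A]
  note int = Wvec_component_integrable
  \<comment> \<open>The partial sums are the usual Picard iterates.\<close>
  have S: "S (Suc N) t $ i = q $ i + integral {a..t} (\<lambda>s. (f s - A s *v S N s) $ i)" if t: "t \<in> {a..b}" for N t i
  proof (induction N)
    case 0
    show ?case by (simp add: S_def Y0)
  next
    case (Suc N)
    have eq: "(f s - A s *v S (Suc N) s) $ i = (f s - A s *v S N s) $ i + (0 - A s *v Y N s) $ i" for s
      by (simp add: S_def matrix_vector_right_distrib)
    have "integral {a..t} (\<lambda>s. (f s - A s *v S (Suc N) s) $ i)
        = integral {a..t} (\<lambda>s. (f s - A s *v S N s) $ i) + integral {a..t} (\<lambda>s. (0 - A s *v Y N s) $ i)"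
      unfolding eq by (intro integral_add int t Wvec_diff Wvec_zero AW SW0 W0 f)
    moreover have "S (Suc (Suc N)) t $ i = S (Suc N) t $ i + Y (Suc N) t $ i" by (simp add: S_def)
    ultimately show ?case using Suc by (simp add: YS)
  qed
  have sol: "X t $ i = q $ i + integral {a..t} (\<lambda>s. (f s - A s *v X s) $ i)" if t: "t \<in> {a..b}" for t i
  proof -
    let ?D = "\<lambda>N. Wvec_norm a b (Suc 0) (\<lambda>t. X t - S N t)"
    let ?R = "X t $ i - (q $ i + integral {a..t} (\<lambda>s. (f s - A s *v X s) $ i))"
    \<comment> \<open>The residual of the limit is controlled by its distances to two consecutive
      iterates, and these tend to 0.\<close>
    have le: "norm ?R \<le> ?D (Suc N) + (b - a) * (M * ?D N)" for N
    proof -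
      have XS: "Wvec a b 0 (\<lambda>t. X t - S N t)" by (intro Wvec_diff XW0 SW0)
      have "integral {a..t} (\<lambda>s. (f s - A s *v S N s) $ i) - integral {a..t} (\<lambda>s. (f s - A s *v X s) $ i)
          = integral {a..t} (\<lambda>s. (f s - A s *v S N s) $ i - (f s - A s *v X s) $ i)"
        by (intro integral_diff[symmetric] int t Wvec_diff AW SW0 XW0 f)
      also have "\<dots> = integral {a..t} (\<lambda>s. (A s *v (X s - S N s)) $ i)"
        by (simp add: matrix_vector_mult_diff_distrib)
      finally have "?R = (X t - S (Suc N) t) $ i + integral {a..t} (\<lambda>s. (A s *v (X s - S N s)) $ i)"
        using S[OF t, of N i] by (simp add: algebra_simps)
      then have "norm ?R \<le> norm ((X t - S (Suc N) t) $ i) + norm (integral {a..t} (\<lambda>s. (A s *v (X s - S N s)) $ i))"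
        by (simp only: norm_triangle_ineq)
      moreover have "norm ((X t - S (Suc N) t) $ i) \<le> ?D (Suc N)"
        by (rule norm_component_le_Wvec_norm[OF Wvec_diff[OF X(1) SW1] t])
      moreover have "norm (integral {a..t} (\<lambda>s. (A s *v (X s - S N s)) $ i)) \<le> (b - a) * (M * ?D N)"
      proof (rule order_trans[OF norm_integral_component_le[OF AW[OF XS] t]], intro mult_left_mono)
        show "Wvec_norm a b 0 (\<lambda>s. A s *v (X s - S N s)) \<le> M * ?D N"
          using AY[OF XS] mult_left_mono[OF Wvec_Suc_mono(2)[OF Wvec_diff[OF X(1) SW1[of N]]] less_imp_le[OF M(1)]] by linarith
      qed (use ab in simp)
      ultimately show ?thesis by linarith
    qed
    have lim: "(\<lambda>N. ?D (Suc N) + (b - a) * (M * ?D N)) \<longlonglongrightarrow> 0 + (b - a) * (M * 0)"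
      using X(2) unfolding S_def by (intro tendsto_intros LIMSEQ_Suc)
    have "norm ?R \<le> 0 + (b - a) * (M * 0)"
      by (rule LIMSEQ_le_const[OF lim], rule exI[of _ 0], intro allI impI, rule le)
    then show ?thesis by simp
  qed
  have Xa: "X a = q" unfolding vec_eq_iff using sol[of a] ab by simp
  have "solves_int a b A f X" unfolding solves_int_def Xa by (intro allI ballI sol)
  with Xa solves_int_bootstrap[OF this XW0 Ak fk] show ?thesis by (intro exI[of _ X] conjI)
qed

text \<open>In one direction the components are absolutely continuous and their derivatives can be
  integrated; in the other the integrand is essentially bounded and its primitive can be
  differentiated, with one null set discarded for each component.\<close>

theorem is_solution_iff:
  fixes A :: "real \<Rightarrow> complex ^ 'm ^ 'm::finite"
  assumes A: "Wmat a b k A" and f: "Wvec a b k f"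
  shows "is_solution a b (Suc k) A L f c y \<longleftrightarrow> Wvec a b (Suc k) y \<and> solves_int a b A f y \<and> L y = c"
proof (cases "Wvec a b (Suc k) y")
  case True
  note z = Wvec_diff[OF f Wmat_mult_vec(1)[OF A Wvec_Suc_mono(1)[OF True]]]
  have "(AE t in lebesgue. t \<in> {a<..<b} \<longrightarrow> (\<exists>y'. (y has_vector_derivative y') (at t) \<and> y' + A t *v y t = f t))
      \<longleftrightarrow> solves_int a b A f y"
  proof
    assume ae: "AE t in lebesgue. t \<in> {a<..<b} \<longrightarrow> (\<exists>y'. (y has_vector_derivative y') (at t) \<and> y' + A t *v y t = f t)"
    show "solves_int a b A f y" unfolding solves_int_def
    proof (intro allI ballI)
      fix i t assume t: "t \<in> {a..b}"
      have "AE t in lebesgue. t \<in> {a<..<b} \<longrightarrow> ((\<lambda>t. y t $ i) has_vector_derivative (f t - A t *v y t) $ i) (at t)"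
        using ae
      proof eventually_elim
        case (elim t)
        show ?case
        proof
          assume "t \<in> {a<..<b}"
          with elim obtain y' where y': "(y has_vector_derivative y') (at t)" "y' + A t *v y t = f t" by blast
          have "((\<lambda>t. y t $ i) has_vector_derivative y' $ i) (at t)"
            by (rule bounded_linear.has_vector_derivative[OF bounded_linear_vec_nth y'(1)])
          moreover have "y' = f t - A t *v y t" using y'(2) by (simp add: algebra_simps)
          ultimately show "((\<lambda>t. y t $ i) has_vector_derivative (f t - A t *v y t) $ i) (at t)" by simp
        qed
      qed
      moreover have "abs_cont_on a b (\<lambda>t. y t $ i)" by (rule Wk_SucE_deriv[OF WvecD[OF True]])
      ultimately show "y t $ i = y a $ i + integral {a..t} (\<lambda>s. (f s - A s *v y s) $ i)"
        by (intro abs_cont_eq_integral t)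
    qed
  next
    assume sol: "solves_int a b A f y"
    have "AE t in lebesgue. \<forall>i\<in>UNIV. t \<in> {a<..<b} \<longrightarrow> ((\<lambda>t. y t $ i) has_vector_derivative (f t - A t *v y t) $ i) (at t)"
      by (intro AE_finite_allI Wk_Suc_has_derivative[OF WvecD[OF z] solves_intD[OF sol]]) simp
    then show "AE t in lebesgue. t \<in> {a<..<b} \<longrightarrow> (\<exists>y'. (y has_vector_derivative y') (at t) \<and> y' + A t *v y t = f t)"
    proof eventually_elim
      case (elim t)
      show ?case
      proof
        assume "t \<in> {a<..<b}"
        then have "(y has_vector_derivative (f t - A t *v y t)) (at t)"
          using elim by (intro has_vector_derivative_vecI) blast
        then show "\<exists>y'. (y has_vector_derivative y') (at t) \<and> y' + A t *v y t = f t"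
          by (intro exI[of _ "f t - A t *v y t"]) simp
      qed
    qed
  qed
  then show ?thesis using True unfolding is_solution_def by simp
qed (simp add: is_solution_def)

end

section \<open>Parameter-dependent linear maps of a finite-dimensional space\<close>

text \<open>In finite dimension convergence on a basis is convergence in operator norm, so half of
  the lower bound \<open>\<beta>\<close> of the injective limit survives nearby.\<close>

lemma linear_family_bounded_below:
  fixes G :: "'e \<Rightarrow> 'v::euclidean_space \<Rightarrow> 'v"
  assumes lin: "\<forall>\<^sub>F e in F. linear (G e)" and lin0: "linear G0" and inj: "inj G0"
    and lim: "\<And>q. ((\<lambda>e. G e q) \<longlongrightarrow> G0 q) F"
  shows "\<exists>\<delta>>0. \<forall>\<^sub>F e in F. \<forall>q. \<delta> * norm q \<le> norm (G e q)"
proof -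
  obtain \<beta> where \<beta>: "\<beta> > 0" "\<And>q. \<beta> * norm q \<le> norm (G0 q)"
    using linear_inj_bounded_below_pos[OF lin0 inj] by blast
  have "((\<lambda>e. \<Sum>b\<in>Basis. norm (G e b - G0 b)) \<longlongrightarrow> (\<Sum>b\<in>(Basis::'v set). norm (G0 b - G0 b))) F"
    by (intro tendsto_intros lim)
  then have "((\<lambda>e. \<Sum>b\<in>Basis. norm (G e b - G0 b)) \<longlongrightarrow> 0) F" by simp
  then have ev: "\<forall>\<^sub>F e in F. (\<Sum>b\<in>Basis. norm (G e b - G0 b)) < \<beta> / 2"
    using \<beta>(1) by (intro order_tendstoD(2)) auto
  have "\<forall>\<^sub>F e in F. \<forall>q. (\<beta> / 2) * norm q \<le> norm (G e q)"
    using lin ev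
  proof eventually_elim
    case (elim e)
    show ?case
    proof
      fix q :: 'v
      define H where "H = (\<lambda>q. G e q - G0 q)"
      have H: "linear H" unfolding H_def using elim(1) lin0 by (rule linear_compose_sub)
      have "H q = H (\<Sum>b\<in>Basis. (q \<bullet> b) *\<^sub>R b)" by (simp only: euclidean_representation)
      also have "\<dots> = (\<Sum>b\<in>Basis. (q \<bullet> b) *\<^sub>R H b)" by (simp add: linear_sum[OF H] linear_scale[OF H])
      finally have "G e q - G0 q = (\<Sum>b\<in>Basis. (q \<bullet> b) *\<^sub>R (G e b - G0 b))" unfolding H_def .
      then have "norm (G e q - G0 q) \<le> (\<Sum>b\<in>Basis. norm ((q \<bullet> b) *\<^sub>R (G e b - G0 b)))"
        by (simp only: norm_sum)
      also have "\<dots> \<le> (\<Sum>b\<in>Basis. norm q * norm (G e b - G0 b))"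
        by (intro sum_mono) (simp add: Basis_le_norm mult_right_mono)
      also have "\<dots> = norm q * (\<Sum>b\<in>Basis. norm (G e b - G0 b))" by (simp add: sum_distrib_left)
      also have "\<dots> \<le> norm q * (\<beta> / 2)" using elim(2) by (intro mult_left_mono) auto
      finally have "norm (G e q - G0 q) \<le> norm q * (\<beta> / 2)" .
      moreover have "norm (G0 q) \<le> norm (G e q) + norm (G e q - G0 q)"
        by (metis norm_triangle_sub norm_minus_commute)
      ultimately show "(\<beta> / 2) * norm q \<le> norm (G e q)" using \<beta>(2)[of q] by (simp add: mult.commute)
    qed
  qed
  then show ?thesis using \<beta>(1) by (intro exI[of _ "\<beta> / 2"]) simp
qed

text \<open>The uniform lower bound turns closeness of images into closeness of preimages. One
  direction of the equivalence applies this to initial values, the other to boundary values.\<close>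

lemma linear_family_preimage_tendsto:
  fixes G :: "'e \<Rightarrow> 'v::euclidean_space \<Rightarrow> 'v"
  assumes lin: "\<forall>\<^sub>F e in F. linear (G e)" and lin0: "linear G0" and inj: "inj G0"
    and lim: "\<And>q. ((\<lambda>e. G e q) \<longlongrightarrow> G0 q) F" and img: "((\<lambda>e. G e (p e)) \<longlongrightarrow> G0 q) F"
  shows "(p \<longlongrightarrow> q) F"
proof -
  obtain \<delta> where \<delta>: "\<delta> > 0" "\<forall>\<^sub>F e in F. \<forall>q. \<delta> * norm q \<le> norm (G e q)"
    using linear_family_bounded_below[OF lin lin0 inj lim] by blast
  have "((\<lambda>e. p e - q) \<longlongrightarrow> 0) F"
  proof (rule Lim_null_comparison)
    show "\<forall>\<^sub>F e in F. norm (p e - q) \<le> norm (G e (p e) - G e q) / \<delta>"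
      using lin \<delta>(2)
    proof eventually_elim
      case (elim e)
      have "\<delta> * norm (p e - q) \<le> norm (G e (p e) - G e q)"
        using elim(2)[rule_format, of "p e - q"] linear_diff[OF elim(1)] by simp
      then show ?case using \<delta>(1) by (simp add: field_simps)
    qed
    have "((\<lambda>e. norm (G e (p e) - G e q) / \<delta>) \<longlongrightarrow> norm (G0 q - G0 q) / \<delta>) F"
      using \<delta>(1) by (intro tendsto_intros img lim) simp
    then show "((\<lambda>e. norm (G e (p e) - G e q) / \<delta>) \<longlongrightarrow> 0) F" by simp
  qed
  then show ?thesis by (simp add: LIM_zero_iff)
qed

section \<open>Dependence of solutions and of boundary values on the data\<close>

context interval begin

text \<open>Operators act on functions of the whole real line, although the space only sees
  \<open>{a..b}\<close>. Two representatives differ by a function of norm 0, which boundedness sends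
  to 0.\<close>

lemma bounded_lin_op_cong:
  fixes L :: "(real \<Rightarrow> complex ^ 'm::finite) \<Rightarrow> complex ^ 'm"
  assumes L: "bounded_lin_op a b n L" and y: "Wvec a b n y" and eq: "\<And>t. t \<in> {a..b} \<Longrightarrow> y t = z t"
  shows "L y = L z"
proof -
  have z: "Wvec a b n z" using Wvec_cong(1)[of y z n, OF eq] y by simp
  have "Wvec_norm a b n (\<lambda>t. y t - z t) = Wvec_norm a b n (\<lambda>t. 0 :: complex ^ 'm)"
    by (rule Wvec_cong(2)) (simp add: eq)
  then have 0: "Wvec_norm a b n (\<lambda>t. y t - z t) = 0" by (simp only: Wvec_norm_zero)
  obtain C where "\<And>y. Wvec a b n y \<Longrightarrow> norm (L y) \<le> C * Wvec_norm a b n y"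
    using L by (auto simp: bounded_lin_op_def)
  from this[OF Wvec_diff[OF y z]] have "L (\<lambda>t. y t - z t) = 0" unfolding 0 by simp
  then show ?thesis using bounded_lin_op_diff[OF L y z] by simp
qed

lemma bounded_lin_op_lincomb:
  fixes L :: "(real \<Rightarrow> complex ^ 'm::finite) \<Rightarrow> complex ^ 'm"
  assumes L: "bounded_lin_op a b n L" and "Wvec a b n y" "Wvec a b n z"
  shows "L (\<lambda>t. y t + c *s z t) = L y + c *s L z"
  using bounded_lin_op_add[OF L assms(2) Wvec_scale[OF assms(3)]] bounded_lin_op_scale[OF L assms(3)] by simp

lemma solves_int_lincomb:
  fixes y z :: "real \<Rightarrow> complex ^ 'm::finite"
  assumes sol: "solves_int a b A f y" "solves_int a b A g z"
    and W: "Wmat a b 0 A" "Wvec a b 0 f" "Wvec a b 0 g" "Wvec a b 0 y" "Wvec a b 0 z"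
  shows "solves_int a b A (\<lambda>t. f t + c *s g t) (\<lambda>t. y t + c *s z t)"
  unfolding solves_int_def
proof (intro allI ballI)
  fix i t assume t: "t \<in> {a..b}"
  let ?F = "\<lambda>s. (f s - A s *v y s) $ i" and ?G = "\<lambda>s. (g s - A s *v z s) $ i"
  have int: "?F integrable_on {a..t}" "?G integrable_on {a..t}"
    by (intro Wvec_component_integrable Wvec_diff Wmat_mult_vec(1) W t)+
  have eq: "(f s + c *s g s - A s *v (y s + c *s z s)) $ i = ?F s + c * ?G s" for s
    by (simp add: matrix_vector_right_distrib vector_scalar_commute algebra_simps)
  have lin: "integral {a..t} (\<lambda>s. ?F s + c * ?G s) = integral {a..t} ?F + c * integral {a..t} ?G"
    using int by (simp add: integral_add integrable_on_mult_right)
  have eqs: "y t $ i = y a $ i + integral {a..t} ?F" "z t $ i = z a $ i + integral {a..t} ?G"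
    using bspec[OF solves_intD[OF sol(1)] t] bspec[OF solves_intD[OF sol(2)] t] by blast+
  show "(y t + c *s z t) $ i = (y a + c *s z a) $ i +
      integral {a..t} (\<lambda>s. (f s + c *s g s - A s *v (y s + c *s z s)) $ i)"
    unfolding eq vector_add_component vector_smult_component lin
    by (subst eqs(1), subst eqs(2)) (simp add: distrib_left)
qed

text \<open>The change of coefficient is moved to the right-hand side, where it multiplies the
  reference solution \<open>z\<close>. The equation keeps the coefficient \<open>A\<close>, so the
  uniform estimate applies to the difference.\<close>

lemma solves_int_diff:
  fixes y z :: "real \<Rightarrow> complex ^ 'm::finite"
  assumes sol: "solves_int a b A f y" "solves_int a b A0 f0 z"
    and W: "Wmat a b 0 A" "Wmat a b 0 A0" "Wvec a b 0 f" "Wvec a b 0 f0" "Wvec a b 0 y" "Wvec a b 0 z"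
  shows "solves_int a b A (\<lambda>t. (f t - f0 t) - (A t - A0 t) *v z t) (\<lambda>t. y t - z t)"
  unfolding solves_int_def
proof (intro allI ballI)
  fix i t assume t: "t \<in> {a..b}"
  let ?F = "\<lambda>s. (f s - A s *v y s) $ i" and ?G = "\<lambda>s. (f0 s - A0 s *v z s) $ i"
  have int: "?F integrable_on {a..t}" "?G integrable_on {a..t}"
    by (intro Wvec_component_integrable Wvec_diff Wmat_mult_vec(1) W t)+
  have eq: "((f s - f0 s) - (A s - A0 s) *v z s - A s *v (y s - z s)) $ i = ?F s - ?G s" for s
    by (simp add: matrix_vector_mult_diff_distrib matrix_vector_mult_diff_rdistrib)
  have eqs: "y t $ i = y a $ i + integral {a..t} ?F" "z t $ i = z a $ i + integral {a..t} ?G"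
    using bspec[OF solves_intD[OF sol(1)] t] bspec[OF solves_intD[OF sol(2)] t] by blast+
  show "(y t - z t) $ i = (y a - z a) $ i +
      integral {a..t} (\<lambda>s. ((f s - f0 s) - (A s - A0 s) *v z s - A s *v (y s - z s)) $ i)"
    unfolding eq integral_diff[OF int]
    by (subst vector_minus_component, subst vector_minus_component, subst eqs(1), subst eqs(2)) simp
qed

text \<open>The difference solves the homogeneous equation with initial value 0, and the a priori
  estimate makes its norm 0.\<close>

lemma solves_int_unique:
  fixes y z :: "real \<Rightarrow> complex ^ 'm::finite"
  assumes sol: "solves_int a b A f y" "solves_int a b A f z"
    and W: "Wmat a b k A" "Wvec a b k f" "Wvec a b (Suc k) y" "Wvec a b (Suc k) z"
    and init: "y a = z a" and t: "t \<in> {a..b}"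
  shows "y t = z t"
proof -
  define M where "M = Wmat_norm a b k A + 1"
  have M: "M > 0" "Wmat_norm a b k A \<le> M" using Wmat_norm_nonneg[OF W(1)] by (auto simp: M_def)
  note W0 = Wmat_imp_Wmat_0[OF W(1)] Wvec_imp_Wvec_0[OF W(2)] Wvec_imp_Wvec_0[OF W(3)] Wvec_imp_Wvec_0[OF W(4)]
  obtain C where C: "\<forall>(A :: real \<Rightarrow> complex ^ 'm ^ 'm) g w.
     solves_int a b A g w \<longrightarrow> Wmat a b k A \<longrightarrow> Wmat_norm a b k A \<le> M \<longrightarrow> Wvec a b k g \<longrightarrow> Wvec a b (Suc k) w \<longrightarrow>
     Wvec_norm a b (Suc k) w \<le> C * ((\<Sum>i\<in>UNIV. norm (w a $ i)) + Wvec_norm a b k g)"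
    using solves_int_estimate[OF M(1), of k] by blast
  have "solves_int a b A (\<lambda>t. 0) (\<lambda>t. y t - z t)"
    using solves_int_diff[OF sol W0(1,1,2,2,3,4)] by simp
  from C[rule_format, OF this W(1) M(2) Wvec_zero Wvec_diff[OF W(3,4)]]
  have "Wvec_norm a b (Suc k) (\<lambda>t. y t - z t) \<le> 0" by (simp add: init Wvec_norm_zero)
  then have "norm ((y t - z t) $ i) \<le> 0" for i
    by (rule order_trans[OF norm_component_le_Wvec_norm[OF Wvec_diff[OF W(3,4)] t]])
  then show ?thesis by (simp add: vec_eq_iff)
qed

lemma Wmat_diff: "Wmat a b k A \<Longrightarrow> Wmat a b k A' \<Longrightarrow> Wmat a b k (\<lambda>t. A t - A' t)"
  unfolding Wmat_def by (simp add: Wk_diff)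

lemma Wmat_norm_triangle:
  assumes A: "Wmat a b k A" and A': "Wmat a b k A'"
  shows "Wmat_norm a b k A \<le> Wmat_norm a b k (\<lambda>t. A t - A' t) + Wmat_norm a b k A'"
  unfolding Wmat_norm_def sum.distrib[symmetric]
proof (intro sum_mono)
  fix i j
  show "Wk_norm a b k (\<lambda>t. A t $ i $ j) \<le> Wk_norm a b k (\<lambda>t. (A t - A' t) $ i $ j) + Wk_norm a b k (\<lambda>t. A' t $ i $ j)"
    using Wk_norm_add[OF WmatD[OF Wmat_diff[OF A A'], of i j] WmatD[OF A', of i j]] by simp
qed

text \<open>Convergence of the coefficients gives an eventual bound \<open>M\<close>, hence one
  constant \<open>C\<close> for all nearby parameters. The majorant \<open>r\<close> collects the
  errors in the initial value, the right-hand side and the coefficient.\<close>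

theorem solves_int_tendsto:
  fixes A :: "'e \<Rightarrow> real \<Rightarrow> complex ^ 'm ^ 'm::finite"
  assumes A: "\<forall>\<^sub>F e in F. Wmat a b k (A e)" and A0: "Wmat a b k A0"
    and Alim: "((\<lambda>e. Wmat_norm a b k (\<lambda>t. A e t - A0 t)) \<longlongrightarrow> 0) F"
    and f: "\<forall>\<^sub>F e in F. Wvec a b k (f e)" and f0: "Wvec a b k f0"
    and flim: "((\<lambda>e. Wvec_norm a b k (\<lambda>t. f e t - f0 t)) \<longlongrightarrow> 0) F"
    and y: "\<forall>\<^sub>F e in F. Wvec a b (Suc k) (y e)" and y0: "Wvec a b (Suc k) y0"
    and sol: "\<forall>\<^sub>F e in F. solves_int a b (A e) (f e) (y e)" and sol0: "solves_int a b A0 f0 y0"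
    and init: "((\<lambda>e. y e a) \<longlongrightarrow> y0 a) F"
  shows "((\<lambda>e. Wvec_norm a b (Suc k) (\<lambda>t. y e t - y0 t)) \<longlongrightarrow> 0) F"
proof -
  define M where "M = Wmat_norm a b k A0 + 1"
  have M: "M > 0" using Wmat_norm_nonneg[OF A0] by (auto simp: M_def)
  have "\<forall>\<^sub>F e in F. Wmat_norm a b k (\<lambda>t. A e t - A0 t) < 1" by (rule order_tendstoD(2)[OF Alim]) simp
  with A have AM: "\<forall>\<^sub>F e in F. Wmat_norm a b k (A e) \<le> M"
  proof eventually_elim
    case (elim e)
    show ?case using Wmat_norm_triangle[OF elim(1) A0] elim(2) by (simp add: M_def)
  qed
  obtain C where C: "C \<ge> 0" "\<forall>(A :: real \<Rightarrow> complex ^ 'm ^ 'm) g w.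
     solves_int a b A g w \<longrightarrow> Wmat a b k A \<longrightarrow> Wmat_norm a b k A \<le> M \<longrightarrow> Wvec a b k g \<longrightarrow> Wvec a b (Suc k) w \<longrightarrow>
     Wvec_norm a b (Suc k) w \<le> C * ((\<Sum>i\<in>UNIV. norm (w a $ i)) + Wvec_norm a b k g)"
    using solves_int_estimate[OF M, of k] by blast
  define r where "r = (\<lambda>e. C * ((\<Sum>i\<in>UNIV. norm ((y e a - y0 a) $ i)) + (Wvec_norm a b k (\<lambda>t. f e t - f0 t)
      + 3 ^ k * Wmat_norm a b k (\<lambda>t. A e t - A0 t) * Wvec_norm a b k y0)))"
  show ?thesis
  proof (rule Lim_null_comparison)
    show "\<forall>\<^sub>F e in F. norm (Wvec_norm a b (Suc k) (\<lambda>t. y e t - y0 t)) \<le> r e"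
      using A AM f y sol
    proof eventually_elim
      case (elim e)
      note W0 = Wmat_imp_Wmat_0[OF elim(1)] Wmat_imp_Wmat_0[OF A0] Wvec_imp_Wvec_0[OF elim(3)] Wvec_imp_Wvec_0[OF f0]
        Wvec_imp_Wvec_0[OF elim(4)] Wvec_imp_Wvec_0[OF y0]
      note W = Wvec_diff[OF elim(4) y0]
      note D = Wmat_mult_vec[OF Wmat_diff[OF elim(1) A0] Wvec_Suc_mono(1)[OF y0]]
      have g: "Wvec a b k (\<lambda>t. (f e t - f0 t) - (A e t - A0 t) *v y0 t)"
        by (intro Wvec_diff[OF Wvec_diff[OF elim(3) f0] D(1)])
      have "Wvec_norm a b (Suc k) (\<lambda>t. y e t - y0 t) \<le> C * ((\<Sum>i\<in>UNIV. norm ((y e a - y0 a) $ i)) +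
          Wvec_norm a b k (\<lambda>t. (f e t - f0 t) - (A e t - A0 t) *v y0 t))"
        by (rule C(2)[rule_format, OF solves_int_diff[OF elim(5) sol0 W0] elim(1,2) g W])
      also have "\<dots> \<le> r e"
        unfolding r_def using Wvec_norm_minus_le[OF Wvec_diff[OF elim(3) f0] D(1)] D(2) C(1)
        by (intro mult_left_mono add_left_mono) linarith+
      finally show ?case using Wvec_norm_nonneg[OF W] by simp
    qed
    have "(r \<longlongrightarrow> C * ((\<Sum>i\<in>(UNIV::'m set). norm ((y0 a - y0 a) $ i)) + (0 + 3 ^ k * 0 * Wvec_norm a b k y0))) F"
      unfolding r_def by (intro tendsto_intros init Alim flim)
    then show "(r \<longlongrightarrow> 0) F" by simp
  qed
qed

lemma Wvec_conv_iff:
  fixes f :: "real \<Rightarrow> real \<Rightarrow> complex ^ 'm::finite"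
  assumes f: "\<forall>\<^sub>F e in at_right 0. Wvec a b k (f e)" and f0: "Wvec a b k (f 0)"
  shows "Wvec_conv a b k f \<longleftrightarrow> ((\<lambda>e. Wvec_norm a b k (\<lambda>t. f e t - f 0 t)) \<longlongrightarrow> 0) (at_right 0)"
proof
  assume "Wvec_conv a b k f"
  then have "((\<lambda>e. Wvec_norm a b k (\<lambda>t. f e t - f 0 t)) \<longlongrightarrow> (\<Sum>i\<in>(UNIV::'m set). 0)) (at_right 0)"
    unfolding Wvec_conv_def Wvec_norm_def vector_minus_component by (intro tendsto_sum) blast
  then show "((\<lambda>e. Wvec_norm a b k (\<lambda>t. f e t - f 0 t)) \<longlongrightarrow> 0) (at_right 0)" by simp
next
  assume lim: "((\<lambda>e. Wvec_norm a b k (\<lambda>t. f e t - f 0 t)) \<longlongrightarrow> 0) (at_right 0)"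
  show "Wvec_conv a b k f" unfolding Wvec_conv_def
  proof
    fix i
    have "\<forall>\<^sub>F e in at_right 0. norm (Wk_norm a b k (\<lambda>t. f e t $ i - f 0 t $ i)) \<le> Wvec_norm a b k (\<lambda>t. f e t - f 0 t)"
      using f
    proof eventually_elim
      case (elim e)
      show ?case
        using Wk_norm_le_Wvec_norm[OF Wvec_diff[OF elim f0], of i] Wk_norm_nonneg[OF WvecD[OF Wvec_diff[OF elim f0]], of i]
        by simp
    qed
    then show "((\<lambda>e. Wk_norm a b k (\<lambda>t. f e t $ i - f 0 t $ i)) \<longlongrightarrow> 0) (at_right 0)"
      by (rule Lim_null_comparison[OF _ lim])
  qed
qed

lemma Wmat_conv_iff:
  fixes A :: "real \<Rightarrow> real \<Rightarrow> complex ^ 'm ^ 'm::finite"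
  assumes A: "\<forall>\<^sub>F e in at_right 0. Wmat a b k (A e)" and A0: "Wmat a b k (A 0)"
  shows "Wmat_conv a b k A \<longleftrightarrow> ((\<lambda>e. Wmat_norm a b k (\<lambda>t. A e t - A 0 t)) \<longlongrightarrow> 0) (at_right 0)"
proof
  assume "Wmat_conv a b k A"
  then have "((\<lambda>e. Wmat_norm a b k (\<lambda>t. A e t - A 0 t)) \<longlongrightarrow> (\<Sum>i\<in>(UNIV::'m set). \<Sum>j\<in>(UNIV::'m set). 0)) (at_right 0)"
    unfolding Wmat_conv_def Wmat_norm_def vector_minus_component by (intro tendsto_sum) blast
  then show "((\<lambda>e. Wmat_norm a b k (\<lambda>t. A e t - A 0 t)) \<longlongrightarrow> 0) (at_right 0)" by simp
next
  assume lim: "((\<lambda>e. Wmat_norm a b k (\<lambda>t. A e t - A 0 t)) \<longlongrightarrow> 0) (at_right 0)"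
  show "Wmat_conv a b k A" unfolding Wmat_conv_def
  proof (intro allI)
    fix i j
    have "\<forall>\<^sub>F e in at_right 0. norm (Wk_norm a b k (\<lambda>t. A e t $ i $ j - A 0 t $ i $ j)) \<le> Wmat_norm a b k (\<lambda>t. A e t - A 0 t)"
      using A
    proof eventually_elim
      case (elim e)
      note W = WmatD[OF Wmat_diff[OF elim A0]]
      have "Wk_norm a b k (\<lambda>t. (A e t - A 0 t) $ i $ j) \<le> (\<Sum>j\<in>UNIV. Wk_norm a b k (\<lambda>t. (A e t - A 0 t) $ i $ j))"
        by (rule member_le_sum[of j UNIV "\<lambda>j. Wk_norm a b k (\<lambda>t. (A e t - A 0 t) $ i $ j)"]) (simp_all only: Wk_norm_nonneg[OF W] finite UNIV_I)
      also have "\<dots> \<le> Wmat_norm a b k (\<lambda>t. A e t - A 0 t)"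
        unfolding Wmat_norm_def
        by (rule member_le_sum[of i UNIV "\<lambda>i. \<Sum>j\<in>UNIV. Wk_norm a b k (\<lambda>t. (A e t - A 0 t) $ i $ j)"])
           (simp_all only: sum_nonneg Wk_norm_nonneg[OF W] finite UNIV_I)
      finally show ?case using Wk_norm_nonneg[OF W, of i j] by simp
    qed
    then show "((\<lambda>e. Wk_norm a b k (\<lambda>t. A e t $ i $ j - A 0 t $ i $ j)) \<longlongrightarrow> 0) (at_right 0)"
      by (rule Lim_null_comparison[OF _ lim])
  qed
qed

text \<open>Uniform boundedness is available for sequences, so the filter at 0+ is treated by
  contradiction: parameters below 1/(i+1) that violate the constant \<open>i\<close> form a sequence
  of operators which converges pointwise and is therefore pointwise bounded.\<close>

lemma eventually_uniformly_bounded: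
  fixes B :: "real \<Rightarrow> (real \<Rightarrow> complex ^ 'm::finite) \<Rightarrow> complex ^ 'm"
  assumes B: "\<forall>\<^sub>F e in at_right 0. bounded_lin_op a b n (B e)"
    and lim: "\<And>y. Wvec a b n y \<Longrightarrow> ((\<lambda>e. B e y) \<longlongrightarrow> B 0 y) (at_right 0)"
  shows "\<exists>K. \<forall>\<^sub>F e in at_right 0. \<forall>y. Wvec a b n y \<longrightarrow> norm (B e y) \<le> K * Wvec_norm a b n y"
proof (rule ccontr)
  assume contra: "\<not> ?thesis"
  have "\<exists>e. 0 < e \<and> e < 1 / real (Suc i) \<and> bounded_lin_op a b n (B e) \<and>
      (\<exists>y. Wvec a b n y \<and> norm (B e y) > real i * Wvec_norm a b n y)" for i
  proof -
    have "\<forall>\<^sub>F e in at_right (0::real). 0 < e \<and> e < 1 / real (Suc i)"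
      by (subst eventually_at_right_field) (auto intro!: exI[of _ "1 / real (Suc i)"])
    moreover have "\<exists>\<^sub>F e in at_right 0. \<exists>y. Wvec a b n y \<and> norm (B e y) > real i * Wvec_norm a b n y"
    proof (rule ccontr)
      assume "\<not> ?thesis"
      then have "\<forall>\<^sub>F e in at_right 0. \<forall>y. Wvec a b n y \<longrightarrow> norm (B e y) \<le> real i * Wvec_norm a b n y"
        unfolding frequently_def not_not by eventually_elim (simp add: not_less)
      then show False using contra by (elim notE) (rule exI)
    qed
    ultimately show ?thesis
      using frequently_ex[OF frequently_eventually_frequently[OF _ eventually_conj[OF _ B]]] by fastforce
  qed
  then have "\<forall>i. \<exists>e. 0 < e \<and> e < 1 / real (Suc i) \<and> bounded_lin_op a b n (B e) \<and>
      (\<exists>y. Wvec a b n y \<and> norm (B e y) > real i * Wvec_norm a b n y)" by (rule allI)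
  from choice[OF this] obtain e where e: "\<forall>i. 0 < e i \<and> e i < 1 / real (Suc i) \<and> bounded_lin_op a b n (B (e i)) \<and>
      (\<exists>y. Wvec a b n y \<and> norm (B (e i) y) > real i * Wvec_norm a b n y)" by (rule exE)
  have "e \<longlonglongrightarrow> 0"
  proof (rule Lim_null_comparison[OF always_eventually LIMSEQ_Suc[OF lim_1_over_n]], rule allI)
    fix i show "norm (e i) \<le> 1 / of_nat (Suc i)" using e[rule_format, of i] by simp
  qed
  then have elim: "filterlim e (at_right 0) sequentially"
    by (rule tendsto_imp_filterlim_at_right) (use e in \<open>simp add: always_eventually\<close>)
  have "\<exists>K. \<forall>i. norm (B (e i) y) \<le> K" if y: "Wvec a b n y" for y
  proof -
    have "(\<lambda>i. B (e i) y) \<longlonglongrightarrow> B 0 y" by (rule filterlim_compose[OF lim[OF y] elim])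
    then have "Bseq (\<lambda>i. B (e i) y)" by (intro convergent_imp_Bseq convergentI)
    then show ?thesis by (auto simp: Bseq_def)
  qed
  moreover have "bounded_lin_op a b n (B (e i))" for i using e by blast
  ultimately obtain K where K: "\<And>i y. Wvec a b n y \<Longrightarrow> norm (B (e i) y) \<le> K * Wvec_norm a b n y"
    using uniform_boundedness[of n "\<lambda>i. B (e i)"] by blast
  obtain i where i: "real i > K" using reals_Archimedean2 by blast
  obtain y where y: "Wvec a b n y" "norm (B (e i) y) > real i * Wvec_norm a b n y" using e by blast
  have "K * Wvec_norm a b n y \<le> real i * Wvec_norm a b n y"
    using i Wvec_norm_nonneg[OF y(1)] by (intro mult_right_mono) auto
  then show False using K[OF y(1), of i] y(2) by linarith
qed

text \<open>The common bound near 0 controls the effect of the varying argument; at the fixed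
  argument \<open>y0\<close> strong convergence applies.\<close>

lemma bounded_lin_op_family_tendsto:
  fixes B :: "real \<Rightarrow> (real \<Rightarrow> complex ^ 'm::finite) \<Rightarrow> complex ^ 'm"
  assumes B: "\<forall>\<^sub>F e in at_right 0. bounded_lin_op a b n (B e)"
    and lim: "\<And>y. Wvec a b n y \<Longrightarrow> ((\<lambda>e. B e y) \<longlongrightarrow> B 0 y) (at_right 0)"
    and y: "\<forall>\<^sub>F e in at_right 0. Wvec a b n (y e)" and y0: "Wvec a b n y0"
    and ylim: "((\<lambda>e. Wvec_norm a b n (\<lambda>t. y e t - y0 t)) \<longlongrightarrow> 0) (at_right 0)"
  shows "((\<lambda>e. B e (y e)) \<longlongrightarrow> B 0 y0) (at_right 0)"
proof -
  obtain K where K: "\<forall>\<^sub>F e in at_right 0. \<forall>y. Wvec a b n y \<longrightarrow> norm (B e y) \<le> K * Wvec_norm a b n y"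
    using eventually_uniformly_bounded[OF B lim] by blast
  have "((\<lambda>e. B e (y e) - B e y0) \<longlongrightarrow> 0) (at_right 0)"
  proof (rule Lim_null_comparison)
    show "\<forall>\<^sub>F e in at_right 0. norm (B e (y e) - B e y0) \<le> K * Wvec_norm a b n (\<lambda>t. y e t - y0 t)"
      using B y K
    proof eventually_elim
      case (elim e)
      show ?case using elim(3)[rule_format, OF Wvec_diff[OF elim(2) y0]] bounded_lin_op_diff[OF elim(1,2) y0] by simp
    qed
    show "((\<lambda>e. K * Wvec_norm a b n (\<lambda>t. y e t - y0 t)) \<longlongrightarrow> 0) (at_right 0)"
      using tendsto_mult_left[OF ylim, of K] by simp
  qed
  from tendsto_add[OF this lim[OF y0]] show ?thesis by simp
qed

end

subsection \<open>Families of boundary value problems\<close>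

text \<open>The finite-dimensional lemmas concern real linear maps of a Euclidean space;
  compatibility with complex combinations yields such maps.\<close>

lemma linear_if_lincomb:
  fixes G :: "complex ^ 'm \<Rightarrow> complex ^ 'n"
  assumes G: "\<And>x y c. G (x + c *s y) = G x + c *s G y"
  shows "linear G"
proof (rule linearI)
  have one: "1 *s y = y" for y :: "complex ^ 'l" by (simp add: vec_eq_iff)
  have sc: "r *\<^sub>R y = complex_of_real r *s y" for r and y :: "complex ^ 'l"
    unfolding vec_eq_iff vector_scaleR_component vector_smult_component by (simp add: scaleR_conv_of_real)
  show add: "G (x + y) = G x + G y" for x y using G[of x 1 y] by (simp only: one)
  have "G 0 = 0" using add[of 0 0] by simp
  then show "G (r *\<^sub>R x) = r *\<^sub>R G x" for r x using G[of 0 "complex_of_real r" x] by (simp add: sc)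
qed

text \<open>Here \<open>k\<close> plays the part of n - 1: solutions have order
  \<open>Suc k\<close>, coefficients and right-hand sides order \<open>k\<close>.\<close>

locale bvp_family = interval +
  fixes \<epsilon>0 :: real and k :: nat
    and A :: "real \<Rightarrow> real \<Rightarrow> complex ^ 'm ^ 'm::finite"
    and B :: "real \<Rightarrow> (real \<Rightarrow> complex ^ 'm) \<Rightarrow> complex ^ 'm"
  assumes eps0: "\<epsilon>0 > 0"
    and A: "\<And>\<epsilon>. 0 \<le> \<epsilon> \<Longrightarrow> \<epsilon> < \<epsilon>0 \<Longrightarrow> Wmat a b k (A \<epsilon>)"
    and B: "\<And>\<epsilon>. 0 \<le> \<epsilon> \<Longrightarrow> \<epsilon> < \<epsilon>0 \<Longrightarrow> bounded_lin_op a b (Suc k) (B \<epsilon>)"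
begin

lemma eventually_small:
  assumes "\<epsilon>1 > 0" "\<And>\<epsilon>. 0 \<le> \<epsilon> \<Longrightarrow> \<epsilon> < \<epsilon>1 \<Longrightarrow> P \<epsilon>"
  shows "\<forall>\<^sub>F \<epsilon> in at_right 0. P (\<epsilon>::real)"
  by (rule eventually_at_rightI[of 0 \<epsilon>1]) (use assms in auto)

lemma A_0: "Wmat a b k (A 0)" and B_0: "bounded_lin_op a b (Suc k) (B 0)"
  using A[of 0] B[of 0] eps0 by auto

text \<open>A chosen solution is fixed only on \<open>{a..b}\<close>; therefore identities between
  such solutions are stated at points of the interval.\<close>

definition ivp :: "real \<Rightarrow> (real \<Rightarrow> complex ^ 'm) \<Rightarrow> complex ^ 'm \<Rightarrow> real \<Rightarrow> complex ^ 'm" where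
  "ivp \<epsilon> f q = (SOME y. Wvec a b (Suc k) y \<and> solves_int a b (A \<epsilon>) f y \<and> y a = q)"

lemma
  assumes "0 \<le> \<epsilon>" "\<epsilon> < \<epsilon>0" "Wvec a b k f"
  shows Wvec_ivp: "Wvec a b (Suc k) (ivp \<epsilon> f q)" and solves_ivp: "solves_int a b (A \<epsilon>) f (ivp \<epsilon> f q)"
    and ivp_init: "ivp \<epsilon> f q a = q"
  using someI_ex[OF solves_int_exists[OF A[OF assms(1,2)] assms(3), of q]] unfolding ivp_def by blast+

lemma ivp_eqI:
  assumes e: "0 \<le> \<epsilon>" "\<epsilon> < \<epsilon>0" and f: "Wvec a b k f" and y: "Wvec a b (Suc k) y" "solves_int a b (A \<epsilon>) f y"
    and t: "t \<in> {a..b}"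
  shows "y t = ivp \<epsilon> f (y a) t"
  by (rule solves_int_unique[OF y(2) solves_ivp[OF e f] A[OF e] f y(1) Wvec_ivp[OF e f] _ t]) (simp add: ivp_init[OF e f])

lemma ivp_lincomb:
  assumes e: "0 \<le> \<epsilon>" "\<epsilon> < \<epsilon>0" and f: "Wvec a b k f" and g: "Wvec a b k g" and t: "t \<in> {a..b}"
  shows "ivp \<epsilon> f q t + c *s ivp \<epsilon> g r t = ivp \<epsilon> (\<lambda>t. f t + c *s g t) (q + c *s r) t"
proof -
  note yf = Wvec_ivp[OF e f, of q] and yg = Wvec_ivp[OF e g, of r]
  have "solves_int a b (A \<epsilon>) (\<lambda>t. f t + c *s g t) (\<lambda>t. ivp \<epsilon> f q t + c *s ivp \<epsilon> g r t)"
    by (rule solves_int_lincomb[OF solves_ivp[OF e f] solves_ivp[OF e g] Wmat_imp_Wmat_0[OF A[OF e]]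
          Wvec_imp_Wvec_0[OF f] Wvec_imp_Wvec_0[OF g] Wvec_imp_Wvec_0[OF yf] Wvec_imp_Wvec_0[OF yg]])
  from ivp_eqI[OF e Wvec_add[OF f Wvec_scale[OF g]] Wvec_add[OF yf Wvec_scale[OF yg]] this t]
  show ?thesis by (simp add: ivp_init[OF e f] ivp_init[OF e g])
qed

abbreviation "hom \<epsilon> \<equiv> ivp \<epsilon> (\<lambda>t. 0)"

lemmas Wvec_hom = Wvec_ivp[OF _ _ Wvec_zero] and solves_hom = solves_ivp[OF _ _ Wvec_zero]
  and hom_init = ivp_init[OF _ _ Wvec_zero]

text \<open>Superposition: the boundary value splits into a part independent of \<open>q\<close> and
  a part linear in \<open>q\<close>.\<close>

lemma B_ivp:
  assumes e: "0 \<le> \<epsilon>" "\<epsilon> < \<epsilon>0" and f: "Wvec a b k f"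
  shows "B \<epsilon> (ivp \<epsilon> f q) = B \<epsilon> (ivp \<epsilon> f 0) + B \<epsilon> (hom \<epsilon> q)"
proof -
  have one: "1 *s y = y" for y :: "complex ^ 'm" by (simp add: vec_eq_iff)
  have "B \<epsilon> (ivp \<epsilon> f 0) + B \<epsilon> (hom \<epsilon> q) = B \<epsilon> (\<lambda>t. ivp \<epsilon> f 0 t + hom \<epsilon> q t)"
    by (rule bounded_lin_op_add[OF B[OF e] Wvec_ivp[OF e f] Wvec_hom[OF e], symmetric])
  also have "\<dots> = B \<epsilon> (ivp \<epsilon> f q)"
  proof (rule bounded_lin_op_cong[OF B[OF e] Wvec_add[OF Wvec_ivp[OF e f] Wvec_hom[OF e]]])
    fix t assume t: "t \<in> {a..b}"
    show "ivp \<epsilon> f 0 t + hom \<epsilon> q t = ivp \<epsilon> f q t"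
      using ivp_lincomb[OF e f Wvec_zero t, of 0 1 q] by (simp add: one)
  qed
  finally show ?thesis by (rule sym)
qed

lemma linear_B_hom:
  assumes e: "0 \<le> \<epsilon>" "\<epsilon> < \<epsilon>0"
  shows "linear (\<lambda>q. B \<epsilon> (hom \<epsilon> q))"
proof (rule linear_if_lincomb)
  fix x y and c :: complex
  have "B \<epsilon> (hom \<epsilon> x) + c *s B \<epsilon> (hom \<epsilon> y) = B \<epsilon> (\<lambda>t. hom \<epsilon> x t + c *s hom \<epsilon> y t)"
    by (rule bounded_lin_op_lincomb[OF B[OF e] Wvec_hom[OF e] Wvec_hom[OF e], symmetric])
  also have "\<dots> = B \<epsilon> (hom \<epsilon> (x + c *s y))"
  proof (rule bounded_lin_op_cong[OF B[OF e] Wvec_add[OF Wvec_hom[OF e] Wvec_scale[OF Wvec_hom[OF e]]]])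
    fix t assume t: "t \<in> {a..b}"
    show "hom \<epsilon> x t + c *s hom \<epsilon> y t = hom \<epsilon> (x + c *s y) t"
      using ivp_lincomb[OF e Wvec_zero Wvec_zero t, of x c y] by simp
  qed
  finally show "B \<epsilon> (hom \<epsilon> (x + c *s y)) = B \<epsilon> (hom \<epsilon> x) + c *s B \<epsilon> (hom \<epsilon> y)" by (rule sym)
qed

text \<open>Solutions are parametrised by their initial values. Solvability for all data thereby
  becomes surjectivity, and uniqueness becomes injectivity, of the linear map
  \<open>\<lambda>q. B \<epsilon> (hom \<epsilon> q)\<close>.\<close>

lemma is_solution_ivp:
  assumes e: "0 \<le> \<epsilon>" "\<epsilon> < \<epsilon>0" and f: "Wvec a b k f"
  shows "is_solution a b (Suc k) (A \<epsilon>) (B \<epsilon>) f c y \<longleftrightarrow>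
    (\<exists>q. (\<forall>t\<in>{a..b}. y t = ivp \<epsilon> f q t) \<and> B \<epsilon> (ivp \<epsilon> f 0) + B \<epsilon> (hom \<epsilon> q) = c)"
proof
  assume "is_solution a b (Suc k) (A \<epsilon>) (B \<epsilon>) f c y"
  then have sol: "Wvec a b (Suc k) y \<and> solves_int a b (A \<epsilon>) f y \<and> B \<epsilon> y = c"
    unfolding is_solution_iff[OF A[OF e] f] .
  note y = conjunct1[OF sol] conjunct1[OF conjunct2[OF sol]] conjunct2[OF conjunct2[OF sol]]
  have eq: "\<And>t. t \<in> {a..b} \<Longrightarrow> y t = ivp \<epsilon> f (y a) t" by (rule ivp_eqI[OF e f y(1,2)])
  have "B \<epsilon> y = B \<epsilon> (ivp \<epsilon> f (y a))" by (rule bounded_lin_op_cong[OF B[OF e] y(1) eq])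
  also have "\<dots> = B \<epsilon> (ivp \<epsilon> f 0) + B \<epsilon> (hom \<epsilon> (y a))" by (rule B_ivp[OF e f])
  finally have "B \<epsilon> (ivp \<epsilon> f 0) + B \<epsilon> (hom \<epsilon> (y a)) = c" unfolding y(3) by (rule sym)
  then show "\<exists>q. (\<forall>t\<in>{a..b}. y t = ivp \<epsilon> f q t) \<and> B \<epsilon> (ivp \<epsilon> f 0) + B \<epsilon> (hom \<epsilon> q) = c"
    by (intro exI[of _ "y a"] conjI ballI eq)
next
  assume "\<exists>q. (\<forall>t\<in>{a..b}. y t = ivp \<epsilon> f q t) \<and> B \<epsilon> (ivp \<epsilon> f 0) + B \<epsilon> (hom \<epsilon> q) = c"
  then obtain q where q': "\<forall>t\<in>{a..b}. y t = ivp \<epsilon> f q t" "B \<epsilon> (ivp \<epsilon> f 0) + B \<epsilon> (hom \<epsilon> q) = c"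
    by (elim exE conjE)
  note q = bspec[OF q'(1)] q'(2)[folded B_ivp[OF e f]]
  have y: "Wvec a b (Suc k) y" using Wvec_cong(1)[of y "ivp \<epsilon> f q" "Suc k", OF q(1)] Wvec_ivp[OF e f] by simp
  have ya: "y a = ivp \<epsilon> f q a" by (rule q(1)) (use ab in simp)
  have "solves_int a b (A \<epsilon>) f y" unfolding solves_int_def
  proof (intro allI ballI)
    fix i t assume t: "t \<in> {a..b}"
    have "y t $ i = ivp \<epsilon> f q a $ i + integral {a..t} (\<lambda>s. (f s - A \<epsilon> s *v ivp \<epsilon> f q s) $ i)"
      unfolding q(1)[OF t] by (rule bspec[OF solves_intD[OF solves_ivp[OF e f]] t])
    also have "integral {a..t} (\<lambda>s. (f s - A \<epsilon> s *v ivp \<epsilon> f q s) $ i) = integral {a..t} (\<lambda>s. (f s - A \<epsilon> s *v y s) $ i)"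
      by (rule Henstock_Kurzweil_Integration.integral_cong) (use q(1) t in simp)
    finally show "y t $ i = y a $ i + integral {a..t} (\<lambda>s. (f s - A \<epsilon> s *v y s) $ i)" unfolding ya .
  qed
  moreover have "B \<epsilon> y = c" unfolding q(2)[symmetric] by (rule bounded_lin_op_cong[OF B[OF e] y q(1)])
  ultimately show "is_solution a b (Suc k) (A \<epsilon>) (B \<epsilon>) f c y"
    unfolding is_solution_iff[OF A[OF e] f] using y by (intro conjI)
qed

section \<open>Sufficiency of the three conditions\<close>

lemma ivp_tendsto:
  assumes conv: "Wmat_conv a b k A" and e1: "0 < \<epsilon>1" "\<epsilon>1 \<le> \<epsilon>0"
    and f: "\<And>\<epsilon>. 0 \<le> \<epsilon> \<Longrightarrow> \<epsilon> < \<epsilon>1 \<Longrightarrow> Wvec a b k (f \<epsilon>)"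
    and flim: "((\<lambda>\<epsilon>. Wvec_norm a b k (\<lambda>t. f \<epsilon> t - f 0 t)) \<longlongrightarrow> 0) (at_right 0)"
    and q: "(q \<longlongrightarrow> q0) (at_right 0)"
  shows "((\<lambda>\<epsilon>. Wvec_norm a b (Suc k) (\<lambda>t. ivp \<epsilon> (f \<epsilon>) (q \<epsilon>) t - ivp 0 (f 0) q0 t)) \<longlongrightarrow> 0) (at_right 0)"
proof (rule solves_int_tendsto[where A = A and f = f and ?f0.0 = "f 0" and ?A0.0 = "A 0"])
  have f0: "Wvec a b k (f 0)" using f e1 by simp
  have ev: "\<forall>\<^sub>F \<epsilon> in at_right 0. 0 \<le> \<epsilon> \<and> \<epsilon> < \<epsilon>0 \<and> Wvec a b k (f \<epsilon>)"
    by (rule eventually_small[OF e1(1)]) (use e1 f in auto)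
  show eA: "\<forall>\<^sub>F \<epsilon> in at_right 0. Wmat a b k (A \<epsilon>)" using ev by eventually_elim (simp add: A)
  show "\<forall>\<^sub>F \<epsilon> in at_right 0. Wvec a b k (f \<epsilon>)" using ev by eventually_elim simp
  show "Wmat a b k (A 0)" "Wvec a b k (f 0)" by (fact A_0 f0)+
  show "((\<lambda>\<epsilon>. Wmat_norm a b k (\<lambda>t. A \<epsilon> t - A 0 t)) \<longlongrightarrow> 0) (at_right 0)"
    using conv unfolding Wmat_conv_iff[OF eA A_0] .
  show "\<forall>\<^sub>F \<epsilon> in at_right 0. Wvec a b (Suc k) (ivp \<epsilon> (f \<epsilon>) (q \<epsilon>))"
    using ev by eventually_elim (simp add: Wvec_ivp)
  show "\<forall>\<^sub>F \<epsilon> in at_right 0. solves_int a b (A \<epsilon>) (f \<epsilon>) (ivp \<epsilon> (f \<epsilon>) (q \<epsilon>))"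
    using ev by eventually_elim (simp add: solves_ivp)
  show "Wvec a b (Suc k) (ivp 0 (f 0) q0)" "solves_int a b (A 0) (f 0) (ivp 0 (f 0) q0)"
    using eps0 f0 by (simp_all add: Wvec_ivp solves_ivp)
  have "\<forall>\<^sub>F \<epsilon> in at_right 0. q \<epsilon> = ivp \<epsilon> (f \<epsilon>) (q \<epsilon>) a" using ev by eventually_elim (simp add: ivp_init)
  moreover have "ivp 0 (f 0) q0 a = q0" using eps0 f0 by (simp add: ivp_init)
  ultimately show "((\<lambda>\<epsilon>. ivp \<epsilon> (f \<epsilon>) (q \<epsilon>) a) \<longlongrightarrow> ivp 0 (f 0) q0 a) (at_right 0)"
    using q by (simp add: tendsto_cong)
qed (fact flim)

text \<open>The lower bound for \<open>G \<epsilon>\<close> near 0 does double duty: it gives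
  injectivity, which for endomorphisms of a finite-dimensional space includes surjectivity, and it
  forces the initial values of the solutions to converge.\<close>

theorem cont_dep_if:
  assumes triv: "\<And>y. is_solution a b (Suc k) (A 0) (B 0) (\<lambda>t. 0) 0 y \<Longrightarrow> \<forall>t\<in>{a..b}. y t = 0"
    and Aconv: "Wmat_conv a b k A"
    and Bconv: "\<And>y. Wvec a b (Suc k) y \<Longrightarrow> ((\<lambda>\<epsilon>. B \<epsilon> y) \<longlongrightarrow> B 0 y) (at_right 0)"
  shows "cont_dep a b (Suc k) \<epsilon>0 A B"
proof -
  define G where "G = (\<lambda>\<epsilon> q. B \<epsilon> (hom \<epsilon> q))"
  have lin: "linear (G \<epsilon>)" if "0 \<le> \<epsilon>" "\<epsilon> < \<epsilon>0" for \<epsilon> unfolding G_def by (rule linear_B_hom[OF that])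
  have linE: "\<forall>\<^sub>F \<epsilon> in at_right 0. linear (G \<epsilon>)" by (rule eventually_small[OF eps0 lin])
  have lin0: "linear (G 0)" using lin eps0 by simp
  have BE: "\<forall>\<^sub>F \<epsilon> in at_right 0. bounded_lin_op a b (Suc k) (B \<epsilon>)" by (rule eventually_small[OF eps0 B])
  \<comment> \<open>A vector in the kernel is the initial value of a solution with zero data, which
    the triviality condition makes 0.\<close>
  have "q = 0" if "G 0 q = 0" for q
  proof -
    have "B 0 (hom 0 0) = 0" using linear_0[OF lin0] unfolding G_def .
    then have "is_solution a b (Suc k) (A 0) (B 0) (\<lambda>t. 0) 0 (hom 0 q)"
      unfolding is_solution_ivp[OF order_refl eps0 Wvec_zero] using that
      by (intro exI[of _ q]) (simp add: G_def)
    then have "hom 0 q a = 0" using triv[of "hom 0 q"] ab by simp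
    then show ?thesis using hom_init[of 0 q] eps0 by simp
  qed
  then have inj0: "inj (G 0)" unfolding linear_injective_0[OF lin0] by blast
  have ivp_lim: "((\<lambda>\<epsilon>. B \<epsilon> (ivp \<epsilon> (f \<epsilon>) q)) \<longlongrightarrow> B 0 (ivp 0 (f 0) q)) (at_right 0)"
    if e1: "0 < \<epsilon>1" "\<epsilon>1 \<le> \<epsilon>0" and f: "\<And>\<epsilon>. 0 \<le> \<epsilon> \<Longrightarrow> \<epsilon> < \<epsilon>1 \<Longrightarrow> Wvec a b k (f \<epsilon>)"
      and flim: "((\<lambda>\<epsilon>. Wvec_norm a b k (\<lambda>t. f \<epsilon> t - f 0 t)) \<longlongrightarrow> 0) (at_right 0)" for f :: "real \<Rightarrow> real \<Rightarrow> complex ^ 'm" and q \<epsilon>1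
  proof (rule bounded_lin_op_family_tendsto[OF BE Bconv _ _ ivp_tendsto[OF Aconv e1 f flim tendsto_const]])
    show "\<forall>\<^sub>F \<epsilon> in at_right 0. Wvec a b (Suc k) (ivp \<epsilon> (f \<epsilon>) q)"
      by (rule eventually_small[OF e1(1)]) (use e1 f in \<open>simp add: Wvec_ivp\<close>)
    show "Wvec a b (Suc k) (ivp 0 (f 0) q)" using e1 f[of 0] eps0 by (simp add: Wvec_ivp)
  qed
  have Glim: "((\<lambda>\<epsilon>. G \<epsilon> q) \<longlongrightarrow> G 0 q) (at_right 0)" for q
    unfolding G_def by (rule ivp_lim[OF eps0 order_refl]) (simp_all add: Wvec_zero Wvec_norm_zero)
  obtain \<delta> where \<delta>: "\<delta> > 0" "\<forall>\<^sub>F \<epsilon> in at_right 0. \<forall>q. \<delta> * norm q \<le> norm (G \<epsilon> q)"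
    using linear_family_bounded_below[OF linE lin0 inj0 Glim] by blast
  then obtain \<beta> where \<beta>: "\<beta> > 0" "\<And>\<epsilon>. 0 < \<epsilon> \<Longrightarrow> \<epsilon> < \<beta> \<Longrightarrow> \<forall>q. \<delta> * norm q \<le> norm (G \<epsilon> q)"
    unfolding eventually_at_right_field by blast
  \<comment> \<open>\<open>\<beta>\<close> secures the lower bound, and half of
    \<open>\<epsilon>0\<close> keeps \<open>\<epsilon>1\<close> strictly below
    \<open>\<epsilon>0\<close>.\<close>
  define \<epsilon>1 where "\<epsilon>1 = min \<beta> (\<epsilon>0 / 2)"
  have e1: "0 < \<epsilon>1" "\<epsilon>1 < \<epsilon>0" using \<beta>(1) eps0 by (auto simp: \<epsilon>1_def)
  \<comment> \<open>The right-hand limit says nothing about the parameter 0 itself, where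
    injectivity is that of the limit map.\<close>
  have inj: "inj (G \<epsilon>)" if e: "0 \<le> \<epsilon>" "\<epsilon> < \<epsilon>1" for \<epsilon>
  proof (cases "\<epsilon> = 0")
    case False
    have l: "linear (G \<epsilon>)" using lin e e1 by simp
    have b: "\<delta> * norm q \<le> norm (G \<epsilon> q)" for q using \<beta>(2)[of \<epsilon>] e False by (auto simp: \<epsilon>1_def)
    show ?thesis unfolding linear_injective_0[OF l]
    proof (intro allI impI)
      fix q assume "G \<epsilon> q = 0"
      then have "\<delta> * norm q \<le> 0" using b[of q] by simp
      then show "q = 0" using \<delta>(1) by (simp add: mult_le_0_iff)
    qed
  qed (simp add: inj0)
  show ?thesis unfolding cont_dep_def diff_Suc_1
  proof (intro bexI[of _ \<epsilon>1] conjI ballI allI impI)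
    show "\<epsilon>1 \<in> {0<..<\<epsilon>0}" using e1 by simp
  next
    fix \<epsilon> and f :: "real \<Rightarrow> complex ^ 'm" and c assume e: "\<epsilon> \<in> {0..<\<epsilon>1}" and f: "Wvec a b k f"
    have e': "0 \<le> \<epsilon>" "\<epsilon> < \<epsilon>0" using e e1 by auto
    have "surj (G \<epsilon>)" using linear_injective_imp_surjective[OF lin[OF e']] inj e by simp
    then obtain q where "c - B \<epsilon> (ivp \<epsilon> f 0) = G \<epsilon> q" unfolding surj_def by blast
    then show "\<exists>y. is_solution a b (Suc k) (A \<epsilon>) (B \<epsilon>) f c y"
      unfolding is_solution_ivp[OF e' f] by (intro exI[of _ "ivp \<epsilon> f q"] exI[of _ q]) (simp add: G_def algebra_simps)
  next
    fix \<epsilon> and f :: "real \<Rightarrow> complex ^ 'm" and c y z t assume e: "\<epsilon> \<in> {0..<\<epsilon>1}" and f: "Wvec a b k f" and t: "t \<in> {a..b}"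
      and sol: "is_solution a b (Suc k) (A \<epsilon>) (B \<epsilon>) f c y" "is_solution a b (Suc k) (A \<epsilon>) (B \<epsilon>) f c z"
    have e': "0 \<le> \<epsilon>" "\<epsilon> < \<epsilon>0" using e e1 by auto
    obtain q r where q: "\<forall>t\<in>{a..b}. y t = ivp \<epsilon> f q t" "B \<epsilon> (ivp \<epsilon> f 0) + G \<epsilon> q = c"
        and r: "\<forall>t\<in>{a..b}. z t = ivp \<epsilon> f r t" "B \<epsilon> (ivp \<epsilon> f 0) + G \<epsilon> r = c"
      using sol unfolding is_solution_ivp[OF e' f] G_def by (elim exE conjE)
    have "G \<epsilon> q = G \<epsilon> r" using q(2) r(2) by (metis add_left_cancel)
    then have "q = r" using inj[of \<epsilon>] e by (simp add: inj_eq)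
    then show "y t = z t" using q(1) r(1) t by simp
  next
    fix F :: "real \<Rightarrow> real \<Rightarrow> complex ^ 'm" and C Y
    assume FY: "\<forall>\<epsilon>\<in>{0..<\<epsilon>1}. Wvec a b k (F \<epsilon>) \<and> is_solution a b (Suc k) (A \<epsilon>) (B \<epsilon>) (F \<epsilon>) (C \<epsilon>) (Y \<epsilon>)"
      and Fconv: "Wvec_conv a b k F" and Cconv: "(C \<longlongrightarrow> C 0) (at_right 0)"
    have F: "Wvec a b k (F \<epsilon>)" if "0 \<le> \<epsilon>" "\<epsilon> < \<epsilon>1" for \<epsilon> using FY that by simp
    have FE: "\<forall>\<^sub>F \<epsilon> in at_right 0. Wvec a b k (F \<epsilon>)" by (rule eventually_small[OF e1(1) F])
    have F0: "Wvec a b k (F 0)" using F e1 by simp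
    have flim: "((\<lambda>\<epsilon>. Wvec_norm a b k (\<lambda>t. F \<epsilon> t - F 0 t)) \<longlongrightarrow> 0) (at_right 0)"
      using Fconv unfolding Wvec_conv_iff[OF FE F0] .
    \<comment> \<open>Every given solution is represented by an initial vector; for parameters
      outside the range any vector will do.\<close>
    have "\<forall>\<epsilon>. \<exists>q. 0 \<le> \<epsilon> \<longrightarrow> \<epsilon> < \<epsilon>1 \<longrightarrow> (\<forall>t\<in>{a..b}. Y \<epsilon> t = ivp \<epsilon> (F \<epsilon>) q t) \<and>
        B \<epsilon> (ivp \<epsilon> (F \<epsilon>) 0) + G \<epsilon> q = C \<epsilon>"
    proof
      fix \<epsilon>
      show "\<exists>q. 0 \<le> \<epsilon> \<longrightarrow> \<epsilon> < \<epsilon>1 \<longrightarrow> (\<forall>t\<in>{a..b}. Y \<epsilon> t = ivp \<epsilon> (F \<epsilon>) q t) \<and> B \<epsilon> (ivp \<epsilon> (F \<epsilon>) 0) + G \<epsilon> q = C \<epsilon>"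
      proof (cases "0 \<le> \<epsilon> \<and> \<epsilon> < \<epsilon>1")
        case True
        then have "is_solution a b (Suc k) (A \<epsilon>) (B \<epsilon>) (F \<epsilon>) (C \<epsilon>) (Y \<epsilon>)" using FY by simp
        moreover have "0 \<le> \<epsilon>" "\<epsilon> < \<epsilon>0" "Wvec a b k (F \<epsilon>)" using True e1 F by auto
        ultimately show ?thesis using is_solution_ivp[of \<epsilon> "F \<epsilon>" "C \<epsilon>" "Y \<epsilon>"] unfolding G_def by simp
      qed auto
    qed
    from choice[OF this] obtain q where q: "\<forall>\<epsilon>. 0 \<le> \<epsilon> \<longrightarrow> \<epsilon> < \<epsilon>1 \<longrightarrow> (\<forall>t\<in>{a..b}. Y \<epsilon> t = ivp \<epsilon> (F \<epsilon>) (q \<epsilon>) t) \<and>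
        B \<epsilon> (ivp \<epsilon> (F \<epsilon>) 0) + G \<epsilon> (q \<epsilon>) = C \<epsilon>" by (rule exE)
    have q0: "\<And>t. t \<in> {a..b} \<Longrightarrow> Y 0 t = ivp 0 (F 0) (q 0) t" "B 0 (ivp 0 (F 0) 0) + G 0 (q 0) = C 0"
      using q[rule_format, of 0] e1 by blast+
    \<comment> \<open>The right-hand sides of the finite-dimensional equations for
      \<open>q \<epsilon>\<close> converge, hence so do their solutions.\<close>
    have "((\<lambda>\<epsilon>. C \<epsilon> - B \<epsilon> (ivp \<epsilon> (F \<epsilon>) 0)) \<longlongrightarrow> C 0 - B 0 (ivp 0 (F 0) 0)) (at_right 0)"
      by (intro tendsto_diff Cconv ivp_lim[OF e1(1) less_imp_le[OF e1(2)] F flim])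
    moreover have "\<forall>\<^sub>F \<epsilon> in at_right 0. C \<epsilon> - B \<epsilon> (ivp \<epsilon> (F \<epsilon>) 0) = G \<epsilon> (q \<epsilon>)"
    proof (rule eventually_small[OF e1(1)])
      fix \<epsilon> assume "0 \<le> \<epsilon>" "\<epsilon> < \<epsilon>1"
      then have "B \<epsilon> (ivp \<epsilon> (F \<epsilon>) 0) + G \<epsilon> (q \<epsilon>) = C \<epsilon>" using q by blast
      then show "C \<epsilon> - B \<epsilon> (ivp \<epsilon> (F \<epsilon>) 0) = G \<epsilon> (q \<epsilon>)" by (simp add: algebra_simps)
    qed
    moreover have "C 0 - B 0 (ivp 0 (F 0) 0) = G 0 (q 0)" using q0(2) by (simp add: algebra_simps)
    ultimately have "((\<lambda>\<epsilon>. G \<epsilon> (q \<epsilon>)) \<longlongrightarrow> G 0 (q 0)) (at_right 0)" by (simp add: tendsto_cong)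
    then have "(q \<longlongrightarrow> q 0) (at_right 0)"
      by (rule linear_family_preimage_tendsto[OF linE lin0 inj0 Glim])
    from ivp_tendsto[OF Aconv e1(1) less_imp_le[OF e1(2)] F flim this]
    have lim: "((\<lambda>\<epsilon>. Wvec_norm a b (Suc k) (\<lambda>t. ivp \<epsilon> (F \<epsilon>) (q \<epsilon>) t - ivp 0 (F 0) (q 0) t)) \<longlongrightarrow> 0) (at_right 0)" .
    have eq: "\<forall>\<^sub>F \<epsilon> in at_right 0. Wvec_norm a b (Suc k) (\<lambda>t. ivp \<epsilon> (F \<epsilon>) (q \<epsilon>) t - ivp 0 (F 0) (q 0) t)
        = Wvec_norm a b (Suc k) (\<lambda>t. Y \<epsilon> t - Y 0 t)"
    proof (rule eventually_small[OF e1(1)])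
      fix \<epsilon> assume "0 \<le> \<epsilon>" "\<epsilon> < \<epsilon>1"
      then have "\<And>t. t \<in> {a..b} \<Longrightarrow> Y \<epsilon> t = ivp \<epsilon> (F \<epsilon>) (q \<epsilon>) t" using q by blast
      then show "Wvec_norm a b (Suc k) (\<lambda>t. ivp \<epsilon> (F \<epsilon>) (q \<epsilon>) t - ivp 0 (F 0) (q 0) t) = Wvec_norm a b (Suc k) (\<lambda>t. Y \<epsilon> t - Y 0 t)"
        by (intro Wvec_cong(2)) (simp add: q0(1))
    qed
    have YW: "Wvec a b (Suc k) (Y \<epsilon>)" if "0 \<le> \<epsilon>" "\<epsilon> < \<epsilon>1" for \<epsilon> using FY that by (simp add: is_solution_def)
    have YE: "\<forall>\<^sub>F \<epsilon> in at_right 0. Wvec a b (Suc k) (Y \<epsilon>)" by (rule eventually_small[OF e1(1) YW])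
    show "Wvec_conv a b (Suc k) Y"
      unfolding Wvec_conv_iff[OF YE YW[OF order_refl e1(1)]]
      by (rule iffD1[OF tendsto_cong[OF eq] lim])
  qed
qed

end

section \<open>Matrix functions by columns and the adjoint equation\<close>

lemma matrix_diff_ldistrib: "P ** (Q - R) = P ** Q - P ** R" for P :: "'a::ring_1 ^ 'n ^ 'm"
  by (simp add: matrix_matrix_mult_def vec_eq_iff right_diff_distrib sum_subtractf)

lemma matrix_diff_rdistrib: "(P - Q) ** R = P ** R - Q ** R" for P :: "'a::ring_1 ^ 'n ^ 'm"
  by (simp add: matrix_matrix_mult_def vec_eq_iff left_diff_distrib sum_subtractf)

context interval begin

lemma Wvec_column: "Wmat a b k P \<Longrightarrow> Wvec a b k (\<lambda>t. column j (P t))"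
  by (rule WvecI) (simp add: column_def WmatD)

lemma Wmat_norm_columns: "Wmat_norm a b k P = (\<Sum>j\<in>UNIV. Wvec_norm a b k (\<lambda>t. column j (P t)))"
  unfolding Wmat_norm_def Wvec_norm_def column_def vec_lambda_beta by (rule sum.swap)

lemma WmatI_columns:
  assumes "\<And>j. Wvec a b k (\<lambda>t. column j (P t))"
  shows "Wmat a b k P"
  unfolding Wmat_def
proof (intro allI)
  fix i j
  show "Wk a b k (\<lambda>t. P t $ i $ j)" using WvecD[OF assms[of j], of i] by (simp add: column_def)
qed

lemma column_matrix_mult: "column j (P ** Q) = P *v column j Q"
  by (simp add: column_def matrix_matrix_mult_def matrix_vector_mult_def vec_eq_iff)

text \<open>Columnwise this is the matrix-vector estimate, with the same constant.\<close>

lemma Wmat_mult: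
  fixes P Q :: "real \<Rightarrow> complex ^ 'm ^ 'm::finite"
  assumes P: "Wmat a b k P" and Q: "Wmat a b k Q"
  shows "Wmat a b k (\<lambda>t. P t ** Q t)"
    "Wmat_norm a b k (\<lambda>t. P t ** Q t) \<le> 3 ^ k * Wmat_norm a b k P * Wmat_norm a b k Q"
proof -
  note W = Wmat_mult_vec[OF P Wvec_column[OF Q]]
  show "Wmat a b k (\<lambda>t. P t ** Q t)"
    by (rule WmatI_columns) (simp only: column_matrix_mult W(1))
  have "Wmat_norm a b k (\<lambda>t. P t ** Q t) \<le> (\<Sum>j\<in>UNIV. 3 ^ k * Wmat_norm a b k P * Wvec_norm a b k (\<lambda>t. column j (Q t)))"
    unfolding Wmat_norm_columns[of k "\<lambda>t. P t ** Q t"] column_matrix_mult by (rule sum_mono) (rule W(2))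
  also have "\<dots> = 3 ^ k * Wmat_norm a b k P * Wmat_norm a b k Q"
    unfolding Wmat_norm_columns[of k Q] by (rule sum_distrib_left[symmetric])
  finally show "Wmat_norm a b k (\<lambda>t. P t ** Q t) \<le> 3 ^ k * Wmat_norm a b k P * Wmat_norm a b k Q" .
qed

lemma Wmat_cong:
  assumes "\<And>t. t \<in> {a..b} \<Longrightarrow> P t = Q t"
  shows "Wmat_norm a b k P = Wmat_norm a b k Q"
proof -
  have "Wk_norm a b k (\<lambda>t. P t $ i $ j) = Wk_norm a b k (\<lambda>t. Q t $ i $ j)" for i j
    by (rule Wk_cong(2)) (simp add: assms)
  then show ?thesis unfolding Wmat_norm_def by simp
qed

lemma Wmat_norm_diff:
  assumes P: "Wmat a b k P" and Q: "Wmat a b k Q"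
  shows "Wmat_norm a b k (\<lambda>t. P t - Q t) \<le> Wmat_norm a b k P + Wmat_norm a b k Q"
  unfolding Wmat_norm_def sum.distrib[symmetric] vector_minus_component
  by (intro sum_mono Wk_norm_diff WmatD P Q)

text \<open>Since \<open>f\<close> cancels, the function on the left is minus the derivative of
  \<open>z - y\<close>, whose norm is a summand of the norm of order \<open>Suc k\<close>. This is
  how convergence of solutions yields information about coefficients.\<close>

lemma solves_int_rhs_diff:
  fixes y z :: "real \<Rightarrow> complex ^ 'm::finite"
  assumes sol: "solves_int a b A f z" "solves_int a b A0 f y"
    and W: "Wmat a b k A" "Wmat a b k A0" "Wvec a b k f" "Wvec a b (Suc k) z" "Wvec a b (Suc k) y"
  shows "Wvec_norm a b k (\<lambda>t. A t *v z t - A0 t *v y t) \<le> Wvec_norm a b (Suc k) (\<lambda>t. z t - y t)"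
  unfolding Wvec_norm_def
proof (rule sum_mono)
  fix i
  let ?F = "\<lambda>s. f s - A s *v z s" and ?G = "\<lambda>s. f s - A0 s *v y s"
  note Az = Wmat_mult_vec(1)[OF W(1) Wvec_Suc_mono(1)[OF W(4)]] and Ay = Wmat_mult_vec(1)[OF W(2) Wvec_Suc_mono(1)[OF W(5)]]
  note F = Wvec_diff[OF W(3) Az] and G = Wvec_diff[OF W(3) Ay]
  have eq: "\<forall>t\<in>{a..b}. (z t - y t) $ i = (z a - y a) $ i + integral {a..t} (\<lambda>s. (?F s - ?G s) $ i)"
  proof
    fix t assume t: "t \<in> {a..b}"
    have int: "(\<lambda>s. ?F s $ i) integrable_on {a..t}" "(\<lambda>s. ?G s $ i) integrable_on {a..t}"
      by (intro Wvec_component_integrable Wvec_imp_Wvec_0[OF F] Wvec_imp_Wvec_0[OF G] t)+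
    have eqs: "z t $ i = z a $ i + integral {a..t} (\<lambda>s. ?F s $ i)" "y t $ i = y a $ i + integral {a..t} (\<lambda>s. ?G s $ i)"
      by (rule bspec[OF solves_intD[OF sol(1)] t] bspec[OF solves_intD[OF sol(2)] t])+
    show "(z t - y t) $ i = (z a - y a) $ i + integral {a..t} (\<lambda>s. (?F s - ?G s) $ i)"
      unfolding vector_minus_component[of "?F _"] integral_diff[OF int]
      by (subst vector_minus_component, subst vector_minus_component, subst eqs(1), subst eqs(2)) simp
  qed
  note FG = WvecD[OF Wvec_diff[OF F G]]
  have "Wk_norm a b k (\<lambda>t. (A t *v z t - A0 t *v y t) $ i) = Wk_norm a b k (\<lambda>t. - ((?F t - ?G t) $ i))"
    by simp
  also have "\<dots> \<le> Wk_norm a b k (\<lambda>t. (?F t - ?G t) $ i)" by (rule Wk_norm_minus[OF FG])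
  also have "\<dots> \<le> Wk_norm a b (Suc k) (\<lambda>t. (z t - y t) $ i)"
    using Wk_norm_Suc[OF FG eq] Linf_norm_nonneg[OF Wk_Linf[OF WvecD[OF Wvec_diff[OF W(4,5)]]], of i] by simp
  finally show "Wk_norm a b k (\<lambda>t. (A t *v z t - A0 t *v y t) $ i) \<le> Wk_norm a b (Suc k) (\<lambda>t. (z t - y t) $ i)" .
qed

text \<open>Here x' = A^T x and y' = - A y, so the bilinear pairing, taken without conjugation, has
  derivative 0. It exhibits the inverse of a fundamental matrix as a matrix of solutions.\<close>

lemma adjoint_pairing_constant:
  fixes x y :: "real \<Rightarrow> complex ^ 'm::finite"
  assumes sol: "solves_int a b (\<lambda>t. - transpose (A t)) (\<lambda>t. 0) x" "solves_int a b A (\<lambda>t. 0) y"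
    and W: "Wmat a b k A" "Wmat a b k (\<lambda>t. - transpose (A t))" "Wvec a b (Suc k) x" "Wvec a b (Suc k) y" and t: "t \<in> {a..b}"
  shows "(\<Sum>l\<in>UNIV. x t $ l * y t $ l) = (\<Sum>l\<in>UNIV. x a $ l * y a $ l)"
proof -
  let ?F = "\<lambda>s. 0 - (- transpose (A s)) *v x s" and ?G = "\<lambda>s. 0 - A s *v y s"
  define p where "p = (\<lambda>t. \<Sum>l\<in>UNIV. x t $ l * y t $ l)"
  have F: "Wvec a b k ?F" by (intro Wvec_diff Wvec_zero Wmat_mult_vec(1) W Wvec_Suc_mono(1))
  have G: "Wvec a b k ?G" by (intro Wvec_diff Wvec_zero Wmat_mult_vec(1) W Wvec_Suc_mono(1))
  have "AE s in lebesgue. \<forall>l\<in>UNIV. s \<in> {a<..<b} \<longrightarrow> ((\<lambda>t. x t $ l) has_vector_derivative ?F s $ l) (at s)"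
    by (intro AE_finite_allI Wk_Suc_has_derivative[OF WvecD[OF F] solves_intD[OF sol(1)]]) simp
  moreover have "AE s in lebesgue. \<forall>l\<in>UNIV. s \<in> {a<..<b} \<longrightarrow> ((\<lambda>t. y t $ l) has_vector_derivative ?G s $ l) (at s)"
    by (intro AE_finite_allI Wk_Suc_has_derivative[OF WvecD[OF G] solves_intD[OF sol(2)]]) simp
  ultimately have der: "AE s in lebesgue. s \<in> {a<..<b} \<longrightarrow> (p has_vector_derivative 0) (at s)"
  proof eventually_elim
    case (elim s)
    show ?case
    proof
      assume s: "s \<in> {a<..<b}"
      have "((\<lambda>t. x t $ l * y t $ l) has_vector_derivative (x s $ l * ?G s $ l + ?F s $ l * y s $ l)) (at s)" for l
        using elim s by (intro has_vector_derivative_mult) blast+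
      then have "(p has_vector_derivative (\<Sum>l\<in>UNIV. x s $ l * ?G s $ l + ?F s $ l * y s $ l)) (at s)"
        unfolding p_def by (intro has_vector_derivative_sum) blast
      moreover have "(\<Sum>l\<in>UNIV. x s $ l * ?G s $ l + ?F s $ l * y s $ l) = 0"
      proof -
        have F': "?F s $ l = (\<Sum>r\<in>UNIV. A s $ r $ l * x s $ r)" for l
          by (simp add: matrix_vector_mult_def transpose_def sum_negf)
        have G': "?G s $ l = - (\<Sum>r\<in>UNIV. A s $ l $ r * y s $ r)" for l
          by (simp add: matrix_vector_mult_def)
        have "(\<Sum>l\<in>UNIV. ?F s $ l * y s $ l) = (\<Sum>l\<in>UNIV. \<Sum>r\<in>UNIV. x s $ r * (A s $ r $ l * y s $ l))"
          unfolding F' sum_distrib_right by (intro sum.cong refl) (simp add: mult_ac)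
        also have "\<dots> = (\<Sum>r\<in>UNIV. \<Sum>l\<in>UNIV. x s $ r * (A s $ r $ l * y s $ l))" by (rule sum.swap)
        also have "\<dots> = - (\<Sum>r\<in>UNIV. x s $ r * ?G s $ r)" unfolding G' by (simp add: sum_distrib_left sum_negf)
        finally show ?thesis unfolding sum.distrib by simp
      qed
      ultimately show "(p has_vector_derivative 0) (at s)" by simp
    qed
  qed
  have "Wk a b (Suc k) p" unfolding p_def by (intro Wk_sum(1) Wk_mult' WvecD W)
  then have "abs_cont_on a b p" by (rule Wk_SucE_deriv)
  then have "p t = p a + integral {a..t} (\<lambda>s. 0)" by (rule abs_cont_eq_integral[OF _ der t])
  then show ?thesis by (simp add: p_def)
qed

end

section \<open>Necessity of the three conditions\<close>

locale continuous_bvp_family = bvp_family a b \<epsilon>0 k A B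
  for a b \<epsilon>0 :: real and k :: nat
    and A :: "real \<Rightarrow> real \<Rightarrow> complex ^ 'm ^ 'm::finite"
    and B :: "real \<Rightarrow> (real \<Rightarrow> complex ^ 'm) \<Rightarrow> complex ^ 'm" +
  fixes \<epsilon>1 :: real
  assumes e1: "0 < \<epsilon>1" "\<epsilon>1 < \<epsilon>0"
    and ex: "\<And>\<epsilon> f c. 0 \<le> \<epsilon> \<Longrightarrow> \<epsilon> < \<epsilon>1 \<Longrightarrow> Wvec a b k f \<Longrightarrow> \<exists>y. is_solution a b (Suc k) (A \<epsilon>) (B \<epsilon>) f c y"
    and uniq: "\<And>\<epsilon> f c y z t. 0 \<le> \<epsilon> \<Longrightarrow> \<epsilon> < \<epsilon>1 \<Longrightarrow> Wvec a b k f \<Longrightarrow> is_solution a b (Suc k) (A \<epsilon>) (B \<epsilon>) f c y \<Longrightarrow>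
       is_solution a b (Suc k) (A \<epsilon>) (B \<epsilon>) f c z \<Longrightarrow> t \<in> {a..b} \<Longrightarrow> y t = z t"
    and conv: "\<And>F C Y. (\<forall>\<epsilon>\<in>{0..<\<epsilon>1}. Wvec a b k (F \<epsilon>) \<and> is_solution a b (Suc k) (A \<epsilon>) (B \<epsilon>) (F \<epsilon>) (C \<epsilon>) (Y \<epsilon>)) \<Longrightarrow>
       Wvec_conv a b k F \<Longrightarrow> (C \<longlongrightarrow> C 0) (at_right 0) \<Longrightarrow> Wvec_conv a b (Suc k) Y"
begin

definition bvp where "bvp \<epsilon> f c = (SOME y. is_solution a b (Suc k) (A \<epsilon>) (B \<epsilon>) f c y)"

lemma bvp:
  assumes e: "0 \<le> \<epsilon>" "\<epsilon> < \<epsilon>1" and f: "Wvec a b k f"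
  shows "is_solution a b (Suc k) (A \<epsilon>) (B \<epsilon>) f c (bvp \<epsilon> f c)"
  unfolding bvp_def by (rule someI_ex[OF ex[OF e f]])

lemma A_small: "0 \<le> \<epsilon> \<Longrightarrow> \<epsilon> < \<epsilon>1 \<Longrightarrow> Wmat a b k (A \<epsilon>)"
  and B_small: "0 \<le> \<epsilon> \<Longrightarrow> \<epsilon> < \<epsilon>1 \<Longrightarrow> bounded_lin_op a b (Suc k) (B \<epsilon>)"
  using A B e1 by simp_all

lemma
  assumes e: "0 \<le> \<epsilon>" "\<epsilon> < \<epsilon>1" and f: "Wvec a b k f"
  shows Wvec_bvp: "Wvec a b (Suc k) (bvp \<epsilon> f c)"
    and solves_bvp: "solves_int a b (A \<epsilon>) f (bvp \<epsilon> f c)"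
    and B_bvp: "B \<epsilon> (bvp \<epsilon> f c) = c"
  using bvp[OF e f, of c] unfolding is_solution_iff[OF A_small[OF e] f] by simp_all

lemma bvp_eqI:
  assumes e: "0 \<le> \<epsilon>" "\<epsilon> < \<epsilon>1" and f: "Wvec a b k f" and y: "Wvec a b (Suc k) y" "solves_int a b (A \<epsilon>) f y"
    and t: "t \<in> {a..b}"
  shows "y t = bvp \<epsilon> f (B \<epsilon> y) t"
proof (rule uniq[OF e f _ bvp[OF e f] t])
  show "is_solution a b (Suc k) (A \<epsilon>) (B \<epsilon>) f (B \<epsilon> y) y"
    unfolding is_solution_iff[OF A_small[OF e] f] using y by simp
qed

text \<open>The boundary value is held fixed, so convergence of the data reduces to that of the
  right-hand sides. All limits of solutions in the necessity part come from this case.\<close>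

lemma bvp_tendsto:
  assumes f: "\<And>\<epsilon>. 0 \<le> \<epsilon> \<Longrightarrow> \<epsilon> < \<epsilon>1 \<Longrightarrow> Wvec a b k (f \<epsilon>)"
    and flim: "((\<lambda>\<epsilon>. Wvec_norm a b k (\<lambda>t. f \<epsilon> t - f 0 t)) \<longlongrightarrow> 0) (at_right 0)"
  shows "((\<lambda>\<epsilon>. Wvec_norm a b (Suc k) (\<lambda>t. bvp \<epsilon> (f \<epsilon>) c t - bvp 0 (f 0) c t)) \<longlongrightarrow> 0) (at_right 0)"
proof -
  have fE: "\<forall>\<^sub>F \<epsilon> in at_right 0. Wvec a b k (f \<epsilon>)" by (rule eventually_small[OF e1(1) f])
  have f0: "Wvec a b k (f 0)" by (rule f[OF order_refl e1(1)])
  have fc: "Wvec_conv a b k f" unfolding Wvec_conv_iff[OF fE f0] by (rule flim)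
  have sol: "\<forall>\<epsilon>\<in>{0..<\<epsilon>1}. Wvec a b k (f \<epsilon>) \<and> is_solution a b (Suc k) (A \<epsilon>) (B \<epsilon>) (f \<epsilon>) c (bvp \<epsilon> (f \<epsilon>) c)"
    using f bvp by simp
  have YE: "\<forall>\<^sub>F \<epsilon> in at_right 0. Wvec a b (Suc k) (bvp \<epsilon> (f \<epsilon>) c)"
    by (rule eventually_small[OF e1(1)], rule Wvec_bvp) (simp_all add: f)
  have Y0: "Wvec a b (Suc k) (bvp 0 (f 0) c)" by (rule Wvec_bvp[OF order_refl e1(1) f0])
  show ?thesis
    using conv[of f "\<lambda>_. c" "\<lambda>\<epsilon>. bvp \<epsilon> (f \<epsilon>) c", OF sol fc tendsto_const]
    unfolding Wvec_conv_iff[of "Suc k" "\<lambda>\<epsilon>. bvp \<epsilon> (f \<epsilon>) c", OF YE Y0] .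
qed

lemma only_trivial_solution:
  assumes "is_solution a b (Suc k) (A 0) (B 0) (\<lambda>t. 0) 0 y" "t \<in> {a..b}"
  shows "y t = 0"
proof (rule uniq[OF order_refl e1(1) Wvec_zero assms(1) _ assms(2)])
  show "is_solution a b (Suc k) (A 0) (B 0) (\<lambda>t. 0) 0 (\<lambda>t. 0)"
    unfolding is_solution_iff[OF A_0 Wvec_zero] using bounded_lin_op_zero[OF B_0]
    by (simp add: Wvec_zero solves_int_def)
qed

text \<open>With Z solving the perturbed homogeneous problems and X = 1/Z(0) one has
  A(eps) - A(0) = (A(eps) Z(eps) - A(0) Z(0)) X - A(eps) (Z(eps) - Z(0)) X,
  where the first bracket is a difference of derivatives of Z.\<close>

lemma coefficients_converge: "Wmat_conv a b k A"
proof -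
  define Y where "Y = (\<lambda>j::'m. hom 0 (axis j 1))"
  \<comment> \<open>The boundary values are those of \<open>Y j\<close> under \<open>B 0\<close>,
    frozen in \<open>\<epsilon>\<close>: the data converge trivially, and at
    \<open>\<epsilon> = 0\<close> the solution is \<open>Y j\<close>.\<close>
  define Z where "Z = (\<lambda>j \<epsilon>. bvp \<epsilon> (\<lambda>t. 0) (B 0 (Y j)))"
  note z0 = order_refl eps0
  have YW: "Wvec a b (Suc k) (Y j)" and Ysol: "solves_int a b (A 0) (\<lambda>t. 0) (Y j)" and Yinit: "Y j a = axis j 1" for j
    unfolding Y_def by (rule Wvec_hom[OF z0] solves_hom[OF z0] hom_init[OF z0])+
  have ZW: "Wvec a b (Suc k) (Z j \<epsilon>)" and Zsol: "solves_int a b (A \<epsilon>) (\<lambda>t. 0) (Z j \<epsilon>)" if "0 \<le> \<epsilon>" "\<epsilon> < \<epsilon>1" for j \<epsilon>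
    unfolding Z_def by (rule Wvec_bvp[OF that Wvec_zero] solves_bvp[OF that Wvec_zero])+
  have Z0: "Y j t = Z j 0 t" if "t \<in> {a..b}" for j t
    unfolding Z_def by (rule bvp_eqI[OF order_refl e1(1) Wvec_zero YW Ysol that])
  have Zlim: "((\<lambda>\<epsilon>. Wvec_norm a b (Suc k) (\<lambda>t. Z j \<epsilon> t - Y j t)) \<longlongrightarrow> 0) (at_right 0)" for j
  proof -
    have "((\<lambda>\<epsilon>. Wvec_norm a b (Suc k) (\<lambda>t. Z j \<epsilon> t - Z j 0 t)) \<longlongrightarrow> 0) (at_right 0)"
      unfolding Z_def by (rule bvp_tendsto[of "\<lambda>_ _. 0"]) (simp_all add: Wvec_zero Wvec_norm_zero)
    moreover have "Wvec_norm a b (Suc k) (\<lambda>t. Z j \<epsilon> t - Z j 0 t) = Wvec_norm a b (Suc k) (\<lambda>t. Z j \<epsilon> t - Y j t)" for \<epsilon>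
      by (rule Wvec_cong(2)) (simp add: Z0)
    ultimately show ?thesis by simp
  qed
  \<comment> \<open>Solutions of the adjoint equation that start at the unit vectors form the rows
    of the inverse, with the regularity that the product estimates require.\<close>
  define A' where "A' = (\<lambda>t. - transpose (A 0 t))"
  have A': "Wmat a b k A'" unfolding A'_def Wmat_def
  proof (intro allI)
    fix i j
    show "Wk a b k (\<lambda>t. (- transpose (A 0 t)) $ i $ j)"
      using Wk_minus[OF WmatD[OF A_0, of j i]] by (simp add: transpose_def)
  qed
  have "\<forall>i. \<exists>x. Wvec a b (Suc k) x \<and> solves_int a b A' (\<lambda>t. 0) x \<and> x a = axis i 1"
    by (intro allI solves_int_exists A' Wvec_zero)
  from choice[OF this] obtain x where x: "\<forall>i. Wvec a b (Suc k) (x i) \<and> solves_int a b A' (\<lambda>t. 0) (x i) \<and> x i a = axis (i::'m) 1"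
    by (rule exE)
  define X where "X = (\<lambda>t. \<chi> i. x i t)"
  define Ym where "Ym = (\<lambda>t. \<chi> l j. Y j t $ l)"
  define Zm where "Zm = (\<lambda>\<epsilon> t. \<chi> l j. Z j \<epsilon> t $ l)"
  have colY: "column j (Ym t) = Y j t" and colZ: "column j (Zm \<epsilon> t) = Z j \<epsilon> t" for j t \<epsilon>
    by (simp_all add: column_def Ym_def Zm_def vec_eq_iff)
  have XW: "Wmat a b k X" unfolding Wmat_def X_def vec_lambda_beta
    using x WvecD Wvec_Suc_mono(1) by blast
  have YmW: "Wmat a b k Ym" by (rule WmatI_columns) (simp only: colY Wvec_Suc_mono(1)[OF YW])
  have ZmW: "Wmat a b k (Zm \<epsilon>)" if "0 \<le> \<epsilon>" "\<epsilon> < \<epsilon>1" for \<epsilon>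
    by (rule WmatI_columns) (simp only: colZ Wvec_Suc_mono(1)[OF ZW[OF that]])
  have "X t ** Ym t = mat 1" if t: "t \<in> {a..b}" for t
    unfolding vec_eq_iff
  proof (intro allI)
    fix i j :: 'm
    have "(X t ** Ym t) $ i $ j = (\<Sum>l\<in>UNIV. x i t $ l * Y j t $ l)"
      by (simp add: matrix_matrix_mult_def X_def Ym_def)
    also have "\<dots> = (\<Sum>l\<in>UNIV. x i a $ l * Y j a $ l)"
      by (rule adjoint_pairing_constant[OF _ Ysol A_0 A'[unfolded A'_def] _ YW t]) (use x in \<open>simp_all add: A'_def\<close>)
    also have "\<dots> = (\<Sum>l\<in>UNIV. if l = i then (if l = j then 1 else 0) else 0)"
      by (rule sum.cong) (use x in \<open>auto simp: Yinit axis_def\<close>)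
    also have "\<dots> = (mat 1 :: complex ^ 'm ^ 'm) $ i $ j" by (simp add: mat_def)
    finally show "(X t ** Ym t) $ i $ j = (mat 1 :: complex ^ 'm ^ 'm) $ i $ j" .
  qed
  \<comment> \<open>The pairing gives a left inverse; the factorisation below cancels
    \<open>Ym\<close> against \<open>X\<close> from the other side.\<close>
  then have YX: "Ym t ** X t = mat 1" if "t \<in> {a..b}" for t
    using that matrix_left_right_inverse[of "X t" "Ym t"] by blast
  define r where "r = (\<lambda>\<epsilon>. \<Sum>j\<in>UNIV. Wvec_norm a b (Suc k) (\<lambda>t. Z j \<epsilon> t - Y j t))"
  have "(r \<longlongrightarrow> (\<Sum>j\<in>(UNIV::'m set). 0)) (at_right 0)" unfolding r_def by (intro tendsto_sum Zlim)
  then have rlim: "(r \<longlongrightarrow> 0) (at_right 0)" by simp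
  define N where "N = Wmat_norm a b k X"
  have N: "N \<ge> 0" unfolding N_def by (rule Wmat_norm_nonneg[OF XW])
  define \<alpha> where "\<alpha> = (\<lambda>\<epsilon>. Wmat_norm a b k (\<lambda>t. A \<epsilon> t - A 0 t))"
  define \<alpha>0 where "\<alpha>0 = Wmat_norm a b k (A 0)"
  \<comment> \<open>Two product estimates are chained for the term with the difference of
    fundamental matrices, each contributing \<open>3 ^ k\<close>.\<close>
  define K where "K = 3 ^ k * (3 ^ k * N)"
  \<comment> \<open>As no bound for the norm of \<open>A \<epsilon>\<close> is at hand, it is
    replaced by \<open>\<alpha> \<epsilon> + \<alpha>0\<close>, and the unknown
    \<open>\<alpha> \<epsilon>\<close> appears on both sides.\<close>
  have main: "0 \<le> \<alpha> \<epsilon> \<and> \<alpha> \<epsilon> \<le> 3 ^ k * r \<epsilon> * N + (\<alpha> \<epsilon> + \<alpha>0) * (K * r \<epsilon>)" if e: "0 \<le> \<epsilon>" "\<epsilon> < \<epsilon>1" for \<epsilon>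
  proof
    note Ae = A_small[OF e]
    show "0 \<le> \<alpha> \<epsilon>" unfolding \<alpha>_def by (rule Wmat_norm_nonneg[OF Wmat_diff[OF Ae A_0]])
    define D where "D = (\<lambda>t. A \<epsilon> t ** Zm \<epsilon> t - A 0 t ** Ym t)"
    have DW: "Wmat a b k D" unfolding D_def by (intro Wmat_diff Wmat_mult(1) Ae A_0 ZmW[OF e] YmW)
    have colD: "column j (D t) = A \<epsilon> t *v Z j \<epsilon> t - A 0 t *v Y j t" for j t
    proof -
      have "column j (D t) = column j (A \<epsilon> t ** Zm \<epsilon> t) - column j (A 0 t ** Ym t)"
        by (simp add: D_def column_def vec_eq_iff)
      then show ?thesis unfolding column_matrix_mult colZ colY .
    qed
    have Dr: "Wmat_norm a b k D \<le> r \<epsilon>"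
      unfolding Wmat_norm_columns[of k D] colD r_def
      by (rule sum_mono, rule solves_int_rhs_diff[OF Zsol[OF e] Ysol Ae A_0 Wvec_zero ZW[OF e] YW])
    note EW = Wmat_diff[OF ZmW[OF e] YmW]
    have colE: "column j (Zm \<epsilon> t - Ym t) = Z j \<epsilon> t - Y j t" for j t
    proof -
      have "column j (Zm \<epsilon> t - Ym t) = column j (Zm \<epsilon> t) - column j (Ym t)" by (simp add: column_def vec_eq_iff)
      then show ?thesis unfolding colZ colY .
    qed
    have Er: "Wmat_norm a b k (\<lambda>t. Zm \<epsilon> t - Ym t) \<le> r \<epsilon>"
      unfolding Wmat_norm_columns[of k "\<lambda>t. Zm \<epsilon> t - Ym t"] colE r_def
      by (rule sum_mono, rule Wvec_Suc_mono(2)[OF Wvec_diff[OF ZW[OF e] YW]])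
    have r0: "r \<epsilon> \<ge> 0" using Dr Wmat_norm_nonneg[OF DW] by simp
    note EX = Wmat_mult[OF EW XW] and DX = Wmat_mult[OF DW XW]
    note AEX = Wmat_mult[OF Ae EX(1)]
    have "\<alpha> \<epsilon> = Wmat_norm a b k (\<lambda>t. D t ** X t - A \<epsilon> t ** ((Zm \<epsilon> t - Ym t) ** X t))"
      unfolding \<alpha>_def
    proof (rule Wmat_cong)
      fix t assume t: "t \<in> {a..b}"
      have "D t ** X t - A \<epsilon> t ** ((Zm \<epsilon> t - Ym t) ** X t) = A \<epsilon> t ** (Ym t ** X t) - A 0 t ** (Ym t ** X t)"
        by (simp add: D_def matrix_mul_assoc matrix_diff_ldistrib matrix_diff_rdistrib)
      then show "A \<epsilon> t - A 0 t = D t ** X t - A \<epsilon> t ** ((Zm \<epsilon> t - Ym t) ** X t)"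
        unfolding YX[OF t] by simp
    qed
    also have "\<dots> \<le> Wmat_norm a b k (\<lambda>t. D t ** X t) + Wmat_norm a b k (\<lambda>t. A \<epsilon> t ** ((Zm \<epsilon> t - Ym t) ** X t))"
      by (rule Wmat_norm_diff[OF DX(1) AEX(1)])
    also have "Wmat_norm a b k (\<lambda>t. D t ** X t) \<le> 3 ^ k * Wmat_norm a b k D * N" unfolding N_def by (rule DX(2))
    also have "\<dots> \<le> 3 ^ k * r \<epsilon> * N" using Dr N by (intro mult_right_mono mult_left_mono) auto
    also have "Wmat_norm a b k (\<lambda>t. A \<epsilon> t ** ((Zm \<epsilon> t - Ym t) ** X t))
        \<le> 3 ^ k * Wmat_norm a b k (A \<epsilon>) * Wmat_norm a b k (\<lambda>t. (Zm \<epsilon> t - Ym t) ** X t)" by (rule AEX(2))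
    also have "\<dots> \<le> 3 ^ k * (\<alpha> \<epsilon> + \<alpha>0) * (3 ^ k * r \<epsilon> * N)"
    proof (intro mult_mono)
      show "Wmat_norm a b k (A \<epsilon>) \<le> \<alpha> \<epsilon> + \<alpha>0" unfolding \<alpha>_def \<alpha>0_def by (rule Wmat_norm_triangle[OF Ae A_0])
      show "Wmat_norm a b k (\<lambda>t. (Zm \<epsilon> t - Ym t) ** X t) \<le> 3 ^ k * r \<epsilon> * N"
        by (rule order_trans[OF EX(2)]) (use Er N in \<open>simp add: N_def mult_right_mono mult_left_mono\<close>)
      show "0 \<le> 3 ^ k * (\<alpha> \<epsilon> + \<alpha>0)" using \<open>0 \<le> \<alpha> \<epsilon>\<close> Wmat_norm_nonneg[OF A_0] by (simp add: \<alpha>0_def)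
    qed (use Wmat_norm_nonneg[OF EX(1)] Wmat_norm_nonneg[OF Ae] in simp_all)
    finally show "\<alpha> \<epsilon> \<le> 3 ^ k * r \<epsilon> * N + (\<alpha> \<epsilon> + \<alpha>0) * (K * r \<epsilon>)" by (simp add: K_def mult_ac)
  qed
  have "((\<lambda>\<epsilon>. K * r \<epsilon>) \<longlongrightarrow> K * 0) (at_right 0)" by (intro tendsto_intros rlim)
  \<comment> \<open>Below 1/2 the factor lets half of \<open>\<alpha> \<epsilon>\<close> absorb its
    occurrence on the right, at the price of doubling the rest.\<close>
  then have "\<forall>\<^sub>F \<epsilon> in at_right 0. K * r \<epsilon> < 1 / 2" by (intro order_tendstoD(2)) auto
  moreover have "\<forall>\<^sub>F \<epsilon> in at_right 0. 0 \<le> \<alpha> \<epsilon> \<and> \<alpha> \<epsilon> \<le> 3 ^ k * r \<epsilon> * N + (\<alpha> \<epsilon> + \<alpha>0) * (K * r \<epsilon>)"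
    by (rule eventually_small[OF e1(1) main])
  ultimately have le: "\<forall>\<^sub>F \<epsilon> in at_right 0. norm (\<alpha> \<epsilon>) \<le> 2 * (3 ^ k * r \<epsilon> * N + \<alpha>0 * (K * r \<epsilon>))"
  proof eventually_elim
    case (elim \<epsilon>)
    note \<alpha> = conjunct1[OF elim(2)] conjunct2[OF elim(2)]
    have "\<alpha> \<epsilon> * (K * r \<epsilon>) \<le> \<alpha> \<epsilon> / 2"
      using mult_left_mono[OF less_imp_le[OF elim(1)] \<alpha>(1)] by simp
    moreover have "x \<le> 2 * (p + q)" if "x \<le> p + (y + q)" "y \<le> x / 2" for x y p q :: real
      using that by argo
    ultimately have "\<alpha> \<epsilon> \<le> 2 * (3 ^ k * r \<epsilon> * N + \<alpha>0 * (K * r \<epsilon>))"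
      using \<alpha>(2) unfolding distrib_right[of "\<alpha> \<epsilon>"] by blast
    then show ?case using \<alpha>(1) by simp
  qed
  have "((\<lambda>\<epsilon>. 2 * (3 ^ k * r \<epsilon> * N + \<alpha>0 * (K * r \<epsilon>))) \<longlongrightarrow> 2 * (3 ^ k * 0 * N + \<alpha>0 * (K * 0))) (at_right 0)"
    by (intro tendsto_intros rlim)
  then have "((\<lambda>\<epsilon>. 2 * (3 ^ k * r \<epsilon> * N + \<alpha>0 * (K * r \<epsilon>))) \<longlongrightarrow> 0) (at_right 0)" by simp
  note lim = Lim_null_comparison[OF le this]
  have AE: "\<forall>\<^sub>F \<epsilon> in at_right 0. Wmat a b k (A \<epsilon>)" by (rule eventually_small[OF eps0 A])
  from lim show ?thesis unfolding Wmat_conv_iff[OF AE A_0] \<alpha>_def .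
qed

text \<open>The map from boundary values to initial values of homogeneous solutions inverts
  \<open>\<lambda>q. B \<epsilon> (hom \<epsilon> q)\<close>. Continuous dependence gives the
  convergence of this inverse directly, hence its use in place of the forward map.\<close>

lemma linear_bvp_init:
  assumes e: "0 \<le> \<epsilon>" "\<epsilon> < \<epsilon>1"
  shows "linear (\<lambda>c. bvp \<epsilon> (\<lambda>t. 0) c a)"
proof (rule linear_if_lincomb)
  fix x y and c :: complex
  let ?y = "\<lambda>t. bvp \<epsilon> (\<lambda>t. 0) x t + c *s bvp \<epsilon> (\<lambda>t. 0) y t"
  note Wx = Wvec_bvp[OF e Wvec_zero]
  have W: "Wvec a b (Suc k) ?y" by (intro Wvec_add Wvec_scale Wx)
  have "solves_int a b (A \<epsilon>) (\<lambda>t. 0 + c *s 0) ?y"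
    by (rule solves_int_lincomb[OF solves_bvp[OF e Wvec_zero] solves_bvp[OF e Wvec_zero] Wmat_imp_Wmat_0[OF A_small[OF e]]
          Wvec_zero Wvec_zero Wvec_imp_Wvec_0[OF Wx] Wvec_imp_Wvec_0[OF Wx]])
  then have sol: "solves_int a b (A \<epsilon>) (\<lambda>t. 0) ?y" by simp
  have "B \<epsilon> ?y = x + c *s y"
    using bounded_lin_op_lincomb[OF B_small[OF e] Wx Wx] B_bvp[OF e Wvec_zero] by simp
  with bvp_eqI[OF e Wvec_zero W sol, of a] ab
  show "bvp \<epsilon> (\<lambda>t. 0) (x + c *s y) a = bvp \<epsilon> (\<lambda>t. 0) x a + c *s bvp \<epsilon> (\<lambda>t. 0) y a" by simp
qed

text \<open>\<open>y\<close> solves a boundary value problem whose boundary data are exactly what is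
  to be shown convergent. The comparison function \<open>u\<close> has the same right-hand side and
  frozen boundary data, so continuous dependence applies to it, and y - u(eps) is a homogeneous
  solution.\<close>

lemma boundary_operators_converge:
  assumes y: "Wvec a b (Suc k) y"
  shows "((\<lambda>\<epsilon>. B \<epsilon> y) \<longlongrightarrow> B 0 y) (at_right 0)"
proof -
  note e0 = order_refl e1(1)
  have "\<forall>i. \<exists>z. Wk a b k z \<and> (\<forall>t\<in>{a..b}. y t $ i = y a $ i + integral {a..t} z)"
    by (rule allI, rule Wk_SucE[OF WvecD[OF y]]) blast
  from choice[OF this] obtain z where z: "\<forall>i. Wk a b k (z i) \<and> (\<forall>t\<in>{a..b}. y t $ i = y a $ i + integral {a..t} (z i))"
    by (rule exE)
  \<comment> \<open>\<open>z\<close> represents the derivative of \<open>y\<close>, so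
    \<open>y\<close> solves the equation for every \<open>\<epsilon>\<close>. That these right-hand
    sides converge rests on the convergence of the coefficients.\<close>
  define f where "f = (\<lambda>\<epsilon> t. (\<chi> i. z i t) + A \<epsilon> t *v y t)"
  have zW: "Wvec a b k (\<lambda>t. \<chi> i. z i t)" by (rule WvecI) (use z in simp)
  note yW = Wvec_Suc_mono(1)[OF y]
  have f: "Wvec a b k (f \<epsilon>)" if e: "0 \<le> \<epsilon>" "\<epsilon> < \<epsilon>1" for \<epsilon>
    unfolding f_def by (rule Wvec_add[OF zW Wmat_mult_vec(1)[OF A_small[OF e] yW]])
  have ysol: "solves_int a b (A \<epsilon>) (f \<epsilon>) y" for \<epsilon>
    unfolding solves_int_def
  proof (intro allI)
    fix i
    have eq: "(f \<epsilon> s - A \<epsilon> s *v y s) $ i = z i s" for s by (simp add: f_def)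
    show "\<forall>t\<in>{a..b}. y t $ i = y a $ i + integral {a..t} (\<lambda>s. (f \<epsilon> s - A \<epsilon> s *v y s) $ i)"
      unfolding eq by (rule conjunct2[OF spec[OF z]])
  qed
  have AE: "\<forall>\<^sub>F \<epsilon> in at_right 0. Wmat a b k (A \<epsilon>)" by (rule eventually_small[OF eps0 A])
  have Alim: "((\<lambda>\<epsilon>. Wmat_norm a b k (\<lambda>t. A \<epsilon> t - A 0 t)) \<longlongrightarrow> 0) (at_right 0)"
    using coefficients_converge unfolding Wmat_conv_iff[OF AE A_0] .
  have flim: "((\<lambda>\<epsilon>. Wvec_norm a b k (\<lambda>t. f \<epsilon> t - f 0 t)) \<longlongrightarrow> 0) (at_right 0)"
  proof (rule Lim_null_comparison)
    show "\<forall>\<^sub>F \<epsilon> in at_right 0. norm (Wvec_norm a b k (\<lambda>t. f \<epsilon> t - f 0 t)) \<le> 3 ^ k * Wmat_norm a b k (\<lambda>t. A \<epsilon> t - A 0 t) * Wvec_norm a b k y"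
    proof (rule eventually_small[OF e1(1)])
      fix \<epsilon> assume e: "0 \<le> \<epsilon>" "\<epsilon> < \<epsilon>1"
      have eq: "f \<epsilon> t - f 0 t = (A \<epsilon> t - A 0 t) *v y t" for t by (simp add: f_def matrix_vector_mult_diff_rdistrib)
      show "norm (Wvec_norm a b k (\<lambda>t. f \<epsilon> t - f 0 t)) \<le> 3 ^ k * Wmat_norm a b k (\<lambda>t. A \<epsilon> t - A 0 t) * Wvec_norm a b k y"
        using Wmat_mult_vec(2)[OF Wmat_diff[OF A_small[OF e] A_0] yW] Wvec_norm_nonneg[OF Wvec_diff[OF f[OF e] f[OF e0]]]
        unfolding eq by simp
    qed
    have "((\<lambda>\<epsilon>. 3 ^ k * Wmat_norm a b k (\<lambda>t. A \<epsilon> t - A 0 t) * Wvec_norm a b k y) \<longlongrightarrow> 3 ^ k * 0 * Wvec_norm a b k y) (at_right 0)"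
      by (intro tendsto_intros Alim)
    then show "((\<lambda>\<epsilon>. 3 ^ k * Wmat_norm a b k (\<lambda>t. A \<epsilon> t - A 0 t) * Wvec_norm a b k y) \<longlongrightarrow> 0) (at_right 0)" by simp
  qed
  define u where "u = (\<lambda>\<epsilon>. bvp \<epsilon> (f \<epsilon>) (B 0 y))"
  have uW: "Wvec a b (Suc k) (u \<epsilon>)" and usol: "solves_int a b (A \<epsilon>) (f \<epsilon>) (u \<epsilon>)" and uB: "B \<epsilon> (u \<epsilon>) = B 0 y"
    if e: "0 \<le> \<epsilon>" "\<epsilon> < \<epsilon>1" for \<epsilon>
    unfolding u_def by (rule Wvec_bvp[OF e f[OF e]] solves_bvp[OF e f[OF e]] B_bvp[OF e f[OF e]])+
  have u0: "y a = u 0 a" unfolding u_def by (rule bvp_eqI[OF e0 f[OF e0] y ysol]) (use ab in simp)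
  have ulim: "((\<lambda>\<epsilon>. Wvec_norm a b (Suc k) (\<lambda>t. u \<epsilon> t - u 0 t)) \<longlongrightarrow> 0) (at_right 0)"
    unfolding u_def by (rule bvp_tendsto[OF f flim])
  define H where "H = (\<lambda>\<epsilon> c. bvp \<epsilon> (\<lambda>t. 0) c a)"
  \<comment> \<open>Norms of order at least 1 control the value at \<open>a\<close>.\<close>
  have init_lim: "((\<lambda>\<epsilon>. v \<epsilon> a - v 0 a) \<longlongrightarrow> 0) (at_right 0)"
    if vW: "\<And>\<epsilon>. 0 \<le> \<epsilon> \<Longrightarrow> \<epsilon> < \<epsilon>1 \<Longrightarrow> Wvec a b (Suc k) (v \<epsilon>)"
      and vlim: "((\<lambda>\<epsilon>. Wvec_norm a b (Suc k) (\<lambda>t. v \<epsilon> t - v 0 t)) \<longlongrightarrow> 0) (at_right 0)"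
    for v :: "real \<Rightarrow> real \<Rightarrow> complex ^ 'm"
  proof (rule vec_tendstoI)
    fix i
    have "\<forall>\<^sub>F \<epsilon> in at_right 0. norm ((v \<epsilon> a - v 0 a) $ i) \<le> Wvec_norm a b (Suc k) (\<lambda>t. v \<epsilon> t - v 0 t)"
      by (rule eventually_small[OF e1(1)], rule norm_component_le_Wvec_norm[OF Wvec_diff[OF vW vW[OF e0]]])
         (use ab in simp_all)
    then have "((\<lambda>\<epsilon>. (v \<epsilon> a - v 0 a) $ i) \<longlongrightarrow> 0) (at_right 0)" by (rule Lim_null_comparison[OF _ vlim])
    then show "((\<lambda>\<epsilon>. (v \<epsilon> a - v 0 a) $ i) \<longlongrightarrow> 0 $ i) (at_right 0)" by simp
  qed
  have lin: "linear (H \<epsilon>)" if e: "0 \<le> \<epsilon>" "\<epsilon> < \<epsilon>1" for \<epsilon> unfolding H_def by (rule linear_bvp_init[OF e])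
  have linE: "\<forall>\<^sub>F \<epsilon> in at_right 0. linear (H \<epsilon>)" by (rule eventually_small[OF e1(1) lin])
  have Hlim: "((\<lambda>\<epsilon>. H \<epsilon> c) \<longlongrightarrow> H 0 c) (at_right 0)" for c
  proof -
    have "((\<lambda>\<epsilon>. Wvec_norm a b (Suc k) (\<lambda>t. bvp \<epsilon> (\<lambda>t. 0) c t - bvp 0 (\<lambda>t. 0) c t)) \<longlongrightarrow> 0) (at_right 0)"
      by (rule bvp_tendsto[of "\<lambda>_ _. 0"]) (simp_all add: Wvec_zero Wvec_norm_zero)
    then have "((\<lambda>\<epsilon>. bvp \<epsilon> (\<lambda>t. 0) c a - bvp 0 (\<lambda>t. 0) c a) \<longlongrightarrow> 0) (at_right 0)"
      by (intro init_lim[of "\<lambda>\<epsilon>. bvp \<epsilon> (\<lambda>t. 0) c"] Wvec_bvp[OF _ _ Wvec_zero])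
    then show ?thesis unfolding H_def by (rule LIM_zero_cancel)
  qed
  \<comment> \<open>A homogeneous solution with initial value 0 vanishes identically, and so does
    its boundary value \<open>c\<close>.\<close>
  have "c = 0" if c: "H 0 c = 0" for c
  proof -
    let ?w = "bvp 0 (\<lambda>t. 0) c"
    have "?w t = 0" if t: "t \<in> {a..b}" for t
      by (rule solves_int_unique[OF solves_bvp[OF e0 Wvec_zero] _ A_0 Wvec_zero Wvec_bvp[OF e0 Wvec_zero] Wvec_zero _ t])
         (use c in \<open>simp_all add: solves_int_def H_def\<close>)
    then have "B 0 ?w = B 0 (\<lambda>t. 0)" by (rule bounded_lin_op_cong[OF B_0 Wvec_bvp[OF e0 Wvec_zero]])
    then show ?thesis unfolding B_bvp[OF e0 Wvec_zero] bounded_lin_op_zero[OF B_0] .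
  qed
  then have inj: "inj (H 0)" unfolding linear_injective_0[OF lin[OF e0]] by blast
  \<comment> \<open>The homogeneous solution y - u(eps) has the discrepancy
    \<open>B \<epsilon> y - B 0 y\<close> as its boundary value, so \<open>H \<epsilon>\<close> maps
    this discrepancy to the initial value.\<close>
  have diff: "y a - u \<epsilon> a = H \<epsilon> (B \<epsilon> y - B 0 y)" if e: "0 \<le> \<epsilon>" "\<epsilon> < \<epsilon>1" for \<epsilon>
  proof -
    note A0 = Wmat_imp_Wmat_0[OF A_small[OF e]] and f0 = Wvec_imp_Wvec_0[OF f[OF e]]
    have "solves_int a b (A \<epsilon>) (\<lambda>t. (f \<epsilon> t - f \<epsilon> t) - (A \<epsilon> t - A \<epsilon> t) *v u \<epsilon> t) (\<lambda>t. y t - u \<epsilon> t)"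
      by (rule solves_int_diff[OF ysol usol[OF e] A0 A0 f0 f0 Wvec_imp_Wvec_0[OF y] Wvec_imp_Wvec_0[OF uW[OF e]]])
    then have "solves_int a b (A \<epsilon>) (\<lambda>t. 0) (\<lambda>t. y t - u \<epsilon> t)" by simp
    from bvp_eqI[OF e Wvec_zero Wvec_diff[OF y uW[OF e]] this, of a] ab
    show ?thesis unfolding H_def bounded_lin_op_diff[OF B_small[OF e] y uW[OF e]] uB[OF e] by simp
  qed
  have "((\<lambda>\<epsilon>. H \<epsilon> (B \<epsilon> y - B 0 y)) \<longlongrightarrow> 0) (at_right 0)"
  proof -
    \<comment> \<open>As \<open>u 0\<close> and \<open>y\<close> agree at \<open>a\<close>, the
      initial value of y - u(eps) is minus the change of \<open>u\<close> there.\<close>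
    have "((\<lambda>\<epsilon>. - (u \<epsilon> a - u 0 a)) \<longlongrightarrow> - 0) (at_right 0)" by (intro tendsto_minus init_lim uW ulim)
    moreover have "\<forall>\<^sub>F \<epsilon> in at_right 0. - (u \<epsilon> a - u 0 a) = H \<epsilon> (B \<epsilon> y - B 0 y)"
      by (rule eventually_small[OF e1(1)]) (simp add: diff[symmetric] u0)
    ultimately show ?thesis by (simp add: tendsto_cong)
  qed
  then have "((\<lambda>\<epsilon>. H \<epsilon> (B \<epsilon> y - B 0 y)) \<longlongrightarrow> H 0 0) (at_right 0)" by (simp add: linear_0[OF lin[OF e0]])
  then have "((\<lambda>\<epsilon>. B \<epsilon> y - B 0 y) \<longlongrightarrow> 0) (at_right 0)"
    by (rule linear_family_preimage_tendsto[OF linE lin[OF e0] inj Hlim])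
  then show ?thesis by (rule LIM_zero_cancel)
qed

end

section \<open>The equivalence\<close>

theorem (in bvp_family) cont_dep_iff:
  "cont_dep a b (Suc k) \<epsilon>0 A B \<longleftrightarrow>
    (\<forall>y. is_solution a b (Suc k) (A 0) (B 0) (\<lambda>t. 0) 0 y \<longrightarrow> (\<forall>t\<in>{a..b}. y t = 0)) \<and>
    Wmat_conv a b k A \<and>
    (\<forall>y. Wvec a b (Suc k) y \<longrightarrow> ((\<lambda>\<epsilon>. B \<epsilon> y) \<longlongrightarrow> B 0 y) (at_right 0))"
proof
  assume "cont_dep a b (Suc k) \<epsilon>0 A B"
  then obtain \<epsilon>1 where e1: "\<epsilon>1 \<in> {0<..<\<epsilon>0}"
    and sol: "\<forall>\<epsilon>\<in>{0..<\<epsilon>1}. \<forall>f c. Wvec a b k f \<longrightarrow>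
            (\<exists>y. is_solution a b (Suc k) (A \<epsilon>) (B \<epsilon>) f c y) \<and>
            (\<forall>y z. is_solution a b (Suc k) (A \<epsilon>) (B \<epsilon>) f c y \<longrightarrow>
                   is_solution a b (Suc k) (A \<epsilon>) (B \<epsilon>) f c z \<longrightarrow> (\<forall>t\<in>{a..b}. y t = z t))"
    and lim: "\<forall>F C Y. (\<forall>\<epsilon>\<in>{0..<\<epsilon>1}. Wvec a b k (F \<epsilon>) \<and>
                     is_solution a b (Suc k) (A \<epsilon>) (B \<epsilon>) (F \<epsilon>) (C \<epsilon>) (Y \<epsilon>)) \<longrightarrow>
                  Wvec_conv a b k F \<longrightarrow> (C \<longlongrightarrow> C 0) (at_right 0) \<longrightarrow> Wvec_conv a b (Suc k) Y"
    unfolding cont_dep_def diff_Suc_1 by (elim bexE conjE)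
  have e: "0 < \<epsilon>1" "\<epsilon>1 < \<epsilon>0" using e1 by auto
  have ex: "\<exists>y. is_solution a b (Suc k) (A \<epsilon>) (B \<epsilon>) f c y" if "0 \<le> \<epsilon>" "\<epsilon> < \<epsilon>1" "Wvec a b k f" for \<epsilon> f c
    using sol[rule_format, of \<epsilon> f c] that by simp
  have uniq: "y t = z t" if "0 \<le> \<epsilon>" "\<epsilon> < \<epsilon>1" "Wvec a b k f" "is_solution a b (Suc k) (A \<epsilon>) (B \<epsilon>) f c y"
       "is_solution a b (Suc k) (A \<epsilon>) (B \<epsilon>) f c z" "t \<in> {a..b}" for \<epsilon> f c y z t
    using sol[rule_format, of \<epsilon> f c] that by simp
  interpret continuous_bvp_family a b \<epsilon>0 k A B \<epsilon>1
    using e ex uniq lim by unfold_locales auto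
  show "(\<forall>y. is_solution a b (Suc k) (A 0) (B 0) (\<lambda>t. 0) 0 y \<longrightarrow> (\<forall>t\<in>{a..b}. y t = 0)) \<and>
    Wmat_conv a b k A \<and> (\<forall>y. Wvec a b (Suc k) y \<longrightarrow> ((\<lambda>\<epsilon>. B \<epsilon> y) \<longlongrightarrow> B 0 y) (at_right 0))"
    by (intro conjI allI impI ballI only_trivial_solution coefficients_converge boundary_operators_converge)
next
  assume "(\<forall>y. is_solution a b (Suc k) (A 0) (B 0) (\<lambda>t. 0) 0 y \<longrightarrow> (\<forall>t\<in>{a..b}. y t = 0)) \<and>
    Wmat_conv a b k A \<and> (\<forall>y. Wvec a b (Suc k) y \<longrightarrow> ((\<lambda>\<epsilon>. B \<epsilon> y) \<longlongrightarrow> B 0 y) (at_right 0))"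
  then show "cont_dep a b (Suc k) \<epsilon>0 A B" by (intro cont_dep_if) simp_all
qed

theorem theorem1:
  fixes a b \<epsilon>0 :: real and n :: nat
    and A :: "real \<Rightarrow> real \<Rightarrow> complex ^ 'm ^ 'm::finite"
    and B :: "real \<Rightarrow> (real \<Rightarrow> complex ^ 'm) \<Rightarrow> complex ^ 'm"
  assumes "a < b" and "n \<ge> 1" and "\<epsilon>0 > 0"
    and "\<forall>\<epsilon>\<in>{0..<\<epsilon>0}. Wmat a b (n - 1) (A \<epsilon>)"
    and "\<forall>\<epsilon>\<in>{0..<\<epsilon>0}. bounded_lin_op a b n (B \<epsilon>)"
  shows "cont_dep a b n \<epsilon>0 A B \<longleftrightarrow>
     ((\<forall>y. is_solution a b n (A 0) (B 0) (\<lambda>t. 0) 0 y \<longrightarrow> (\<forall>t\<in>{a..b}. y t = 0)) \<and>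
      Wmat_conv a b (n - 1) A \<and>
      (\<forall>y. Wvec a b n y \<longrightarrow> ((\<lambda>\<epsilon>. B \<epsilon> y) \<longlongrightarrow> B 0 y) (at_right 0)))"
proof -
  \<comment> \<open>For \<open>n = 0\<close> truncated subtraction would turn the order into 1; this
    is where \<open>n \<ge> 1\<close> enters.\<close>
  have n: "n = Suc (n - 1)" using assms(2) by simp
  interpret bvp_family a b \<epsilon>0 "n - 1" A B
  proof
    show "a < b" "\<epsilon>0 > 0" by fact+
    fix \<epsilon> :: real assume e: "0 \<le> \<epsilon>" "\<epsilon> < \<epsilon>0"
    show "Wmat a b (n - 1) (A \<epsilon>)" using assms(4) e by simp
    show "bounded_lin_op a b (Suc (n - 1)) (B \<epsilon>)" unfolding n[symmetric] using assms(5) e by simp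
  qed
  show ?thesis using cont_dep_iff unfolding n[symmetric] .
qed

end
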